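(* Let $\Gamma<\mathrm{PSL}_2(\mathbb{C})$ be a finitely generated Zariski dense Kleinian group with limit set $\Lambda\subset\mathbb{S}^2$, whose ordinary set $\Omega=\mathbb{S}^2-\Lambda$ has at least two connected components. Let $\rho:\Gamma\to\mathrm{PSL}_2(\mathbb{C})$ be a discrete faithful Zariski dense representation with $\rho$-boundary map $f:\Lambda\to\mathbb{S}^2$. If $f$ maps the vertices of every ideal tetrahedron of zero volume with vertices in $\Lambda$ to the vertices of an ideal tetrahedron of zero volume (i.e., whenever four points of $\Lambda$ lie on a common circle in $\mathbb{S}^2$, their images under $f$ lie on a common circle), then there exists $g\in\mathrm{M\ddot{o}b}(\mathbb{S}^2)$ such that $f=g|_\Lambda$ and $\rho$ is the conjugation by $g$, i.e. $\rho(\gamma)=g\gamma g^{-1}$ for all $\gamma\in\Gamma$.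
   Context: $\mathrm{PSL}_2(\mathbb{C})\simeq\mathrm{Isom}^+(\mathbb{H}^3)$ acts on $\partial\mathbb{H}^3=\mathbb{S}^2=\mathbb{C}\cup\{\infty\}$ by Möbius transformations. A Kleinian group is a discrete subgroup of $\mathrm{PSL}_2(\mathbb{C})$. Its limit set $\Lambda\subset\mathbb{S}^2$ is the set of all accumulation points in $\mathbb{S}^2$ of an orbit $\Gamma(o)$, $o\in\mathbb{H}^3$. Zariski density is understood with $\mathrm{PSL}_2(\mathbb{C})$ regarded as a real algebraic group; $\rho$ is Zariski dense if $\rho(\Gamma)$ is Zariski dense in $\mathrm{PSL}_2(\mathbb{C})$. A representation is discrete and faithful if it is injective with discrete image. $\mathrm{M\ddot{o}b}(\mathbb{S}^2)$ is the group generated by inversions with respect to circles in $\mathbb{S}^2$; its elements are called Möbius transformations, and it contains $\mathrm{PSL}_2(\mathbb{C})$ as a normal subgroup of index two. A $\rho$-boundary map is a $\rho$-equivariant continuous embedding $f:\Lambda\to\mathbb{S}^2$, i.e. $f(\gamma\xi)=\rho(\gamma)f(\xi)$ for all $\gamma\in\Gamma,\ \xi\in\Lambda$. A quadruple of points in $\mathbb{S}^2$ determines an ideal tetrahedron of $\mathbb{H}^3$ with these points as vertices; it has zero volume if and only if the four points lie on a common circle in $\mathbb{S}^2$. *)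

theory Defs
  imports
    "HOL-Analysis.Analysis"
    "HOL-Algebra.Coset"
    "HOL-Algebra.Bij"
    "HOL-Algebra.Generated_Groups"
begin

section \<open>The group \<open>PSL\<^sub>2(\<complex>)\<close>\<close>

definition SL2C :: "(complex^2^2) monoid"
  where "SL2C = \<lparr>carrier = {A. det A = 1}, monoid.mult = (**), one = mat 1\<rparr>"

text \<open>An element of \<open>PSL\<^sub>2(\<complex>)\<close> is a coset, i.e. a set \<open>{A, -A}\<close> of matrices of determinant 1.\<close>

definition PSL2C :: "(complex^2^2) set monoid"
  where "PSL2C = SL2C Mod {mat 1, - mat 1}"

lemma carrier_SL2C [simp]: "A \<in> carrier SL2C \<longleftrightarrow> det A = 1"
  and mult_SL2C [simp]: "A \<otimes>\<^bsub>SL2C\<^esub> B = A ** B"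
  and one_SL2C [simp]: "\<one>\<^bsub>SL2C\<^esub> = mat 1"
  by (simp_all add: SL2C_def)

lemma group_SL2C: "group SL2C"
proof (rule groupI)
  fix A assume A: "A \<in> carrier SL2C"
  then have "invertible A" by (simp add: invertible_det_nz)
  then obtain B where B: "A ** B = mat 1" "B ** A = mat 1"
    by (auto simp: invertible_def)
  moreover have "det B = 1"
    using B(1) A by (metis carrier_SL2C det_I det_mul mult_1)
  ultimately show "\<exists>B\<in>carrier SL2C. B \<otimes>\<^bsub>SL2C\<^esub> A = \<one>\<^bsub>SL2C\<^esub>"
    by auto
qed (auto simp: det_mul det_I matrix_mul_assoc)

lemma matrix_uminus_mult: "(- A) ** B = - (A ** B)" "A ** (- B) = - (A ** B)"
  for A B :: "complex^2^2"
  by (simp_all add: matrix_matrix_mult_def vec_eq_iff sum_negf)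

lemma normal_center_SL2C: "{mat 1, - mat 1} \<lhd> SL2C"
proof -
  interpret group SL2C by (rule group_SL2C)
  have det: "det (- mat 1 :: complex^2^2) = 1"
    by (simp add: det_2 mat_def)
  have inv: "inv\<^bsub>SL2C\<^esub> (- mat 1) = - mat 1" "inv\<^bsub>SL2C\<^esub> (mat 1) = mat 1"
    by (rule inv_equality; simp add: det det_I matrix_uminus_mult)+
  have "subgroup {mat 1, - mat 1} SL2C"
    by (rule subgroupI) (auto simp: det det_I inv matrix_uminus_mult)
  then show ?thesis
    by (rule normalI) (auto simp: r_coset_def l_coset_def matrix_uminus_mult)
qed

lemma group_PSL2C: "group PSL2C"
  unfolding PSL2C_def by (rule normal.factorgroup_is_group[OF normal_center_SL2C])

lemma carrier_PSL2C: "carrier PSL2C = (\<lambda>A. {A, - A}) ` {A. det A = 1}"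
  unfolding PSL2C_def carrier_FactGroup
  by (auto simp: r_coset_def matrix_uminus_mult SL2C_def insert_commute image_iff)

text \<open>The quotient topology: \<open>\<Union>U\<close> is the preimage of \<open>U\<close> in \<open>SL\<^sub>2(\<complex>)\<close>.\<close>

definition PSL2C_topology :: "(complex^2^2) set topology"
  where "PSL2C_topology = topology (\<lambda>U. U \<subseteq> carrier PSL2C \<and>
           openin (top_of_set (carrier SL2C)) (\<Union>U))"

lemma openin_PSL2C_topology:
  "openin PSL2C_topology U \<longleftrightarrow>
     U \<subseteq> carrier PSL2C \<and> openin (top_of_set (carrier SL2C)) (\<Union>U)"
proof -
  have Un_Int: "\<Union>(U \<inter> V) = \<Union>U \<inter> \<Union>V"
    if "U \<subseteq> carrier PSL2C" "V \<subseteq> carrier PSL2C" for U V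
  proof -
    have "u = v" if "u \<in> carrier PSL2C" "v \<in> carrier PSL2C" "A \<in> u" "A \<in> v" for u v A
      using that by (auto simp: carrier_PSL2C)
    with that show ?thesis by blast
  qed
  have "istopology (\<lambda>U. U \<subseteq> carrier PSL2C \<and> openin (top_of_set (carrier SL2C)) (\<Union>U))"
    unfolding istopology_def
  proof (intro conjI allI impI)
    fix K :: "(complex^2^2) set set set"
    assume K: "\<forall>U\<in>K. U \<subseteq> carrier PSL2C \<and> openin (top_of_set (carrier SL2C)) (\<Union>U)"
    have "\<Union>(\<Union>K) = (\<Union>U\<in>K. \<Union>U)" by blast
    with K show "openin (top_of_set (carrier SL2C)) (\<Union>(\<Union>K))"
      by (auto intro: openin_Union)
  qed (auto simp: Un_Int openin_Int)
  then show ?thesis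
    by (simp add: PSL2C_topology_def topology_inverse')
qed

definition discrete_in_PSL2C :: "(complex^2^2) set set \<Rightarrow> bool"
  where "discrete_in_PSL2C S \<longleftrightarrow> subtopology PSL2C_topology S = discrete_topology S"

definition kleinian_group :: "(complex^2^2) set set \<Rightarrow> bool"
  where "kleinian_group \<Gamma> \<longleftrightarrow> subgroup \<Gamma> PSL2C \<and> discrete_in_PSL2C \<Gamma>"

definition finitely_generated :: "('a, 'b) monoid_scheme \<Rightarrow> 'a set \<Rightarrow> bool"
  where "finitely_generated G H \<longleftrightarrow> (\<exists>S. finite S \<and> S \<subseteq> carrier G \<and> generate G S = H)"

text \<open>The Zariski topology of \<open>PSL\<^sub>2(\<complex>) = SL\<^sub>2(\<complex>) / {\<plusminus>1}\<close> as a real algebraic group is the quotient of the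
  Zariski topology of \<open>SL\<^sub>2(\<complex>)\<close> as a real affine variety in \<open>M\<^sub>2(\<complex>) = \<real>\<^sup>8\<close>; thus polynomials in the
  real and imaginary parts of the matrix entries are allowed.\<close>

definition zariski_closed :: "(complex^2^2) set set \<Rightarrow> bool"
  where "zariski_closed Z \<longleftrightarrow> Z \<subseteq> carrier PSL2C \<and>
    (\<exists>P. (\<forall>p\<in>P. real_polynomial_function p) \<and> \<Union>Z = {A \<in> carrier SL2C. \<forall>p\<in>P. p A = 0})"

definition zariski_dense :: "(complex^2^2) set set \<Rightarrow> bool"
  where "zariski_dense S \<longleftrightarrow> (\<forall>Z. zariski_closed Z \<and> S \<subseteq> Z \<longrightarrow> Z = carrier PSL2C)"


section \<open>The sphere at infinity and hyperbolic space\<close>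

text \<open>\<open>\<S>\<^sup>2 = \<complex> \<union> {\<infinity>}\<close>, where \<open>\<infinity>\<close> is \<^const>\<open>None\<close>.\<close>

definition S2 :: "complex option topology"
  where "S2 = Alexandroff_compactification euclidean"

definition moebius_mat :: "complex^2^2 \<Rightarrow> complex option \<Rightarrow> complex option"
  where "moebius_mat A x =
    (let a = A $ 1 $ 1; b = A $ 1 $ 2; c = A $ 2 $ 1; d = A $ 2 $ 2 in
     case x of
       None \<Rightarrow> if c = 0 then None else Some (a / c)
     | Some z \<Rightarrow> if c * z + d = 0 then None else Some ((a * z + b) / (c * z + d)))"

definition moebius_action :: "(complex^2^2) set \<Rightarrow> complex option \<Rightarrow> complex option"
  where "moebius_action \<gamma> x = the_elem ((\<lambda>A. moebius_mat A x) ` \<gamma>)"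

text \<open>Hyperbolic space is the upper half-space, on which \<open>PSL\<^sub>2(\<complex>)\<close> acts by the Poincare extension.
  With \<open>(z, t)\<close> as the quaternion \<open>q = z + t j\<close>, this is \<open>q \<mapsto> (a q + b) (c q + d)\<^sup>-\<^sup>1\<close>.\<close>

definition H3 :: "(complex \<times> real) set"
  where "H3 = {(z, t). t > 0}"

definition poincare_mat :: "complex^2^2 \<Rightarrow> complex \<times> real \<Rightarrow> complex \<times> real"
  where "poincare_mat A = (\<lambda>(z, t).
    let a = A $ 1 $ 1; b = A $ 1 $ 2; c = A $ 2 $ 1; d = A $ 2 $ 2;
        D = (cmod (c * z + d))\<^sup>2 + (cmod c)\<^sup>2 * t\<^sup>2 in
    (((a * z + b) * cnj (c * z + d) + a * cnj c * of_real (t\<^sup>2)) / of_real D, t / D))"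

definition poincare_action :: "(complex^2^2) set \<Rightarrow> complex \<times> real \<Rightarrow> complex \<times> real"
  where "poincare_action \<gamma> p = the_elem ((\<lambda>A. poincare_mat A p) ` \<gamma>)"

lemma moebius_eq:
  assumes "\<gamma> \<in> carrier PSL2C" "A \<in> \<gamma>"
  shows "moebius_action \<gamma> x = moebius_mat A x"
proof -
  have neg: "- u * z + - v = - (u * z + v)" for u v z :: complex by simp
  have "moebius_mat (- B) x = moebius_mat B x" for B
    unfolding moebius_mat_def Let_def vector_uminus_component neg
    by (simp split: option.split del: minus_add_distrib)
  with assms show ?thesis by (auto simp: moebius_action_def carrier_PSL2C)
qed

lemma poincare_eq:
  assumes "\<gamma> \<in> carrier PSL2C" "A \<in> \<gamma>"
  shows "poincare_action \<gamma> p = poincare_mat A p"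
proof -
  have neg: "- u * z + - v = - (u * z + v)" for u v z :: complex by simp
  have "poincare_mat (- B) p = poincare_mat B p" for B
    unfolding poincare_mat_def Let_def vector_uminus_component neg
    by (simp split: prod.split del: minus_add_distrib complex_cnj_add)
  with assms show ?thesis by (auto simp: poincare_action_def carrier_PSL2C)
qed

text \<open>The compactification of hyperbolic space by the sphere at infinity: the one-point
  compactification of the closed half-space \<open>t \<ge> 0\<close>.\<close>

definition H3_closure :: "(complex \<times> real) option topology"
  where "H3_closure = Alexandroff_compactification (top_of_set {(z, t). t \<ge> 0})"

definition at_infinity_point :: "complex option \<Rightarrow> (complex \<times> real) option"
  where "at_infinity_point = map_option (\<lambda>z. (z, 0))"

text \<open>The limit set computed from the orbit of the base point \<open>p\<close>.\<close>

definition limit_set :: "(complex^2^2) set set \<Rightarrow> complex \<times> real \<Rightarrow> complex option set"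
  where "limit_set \<Gamma> p =
    {\<xi>. at_infinity_point \<xi> \<in> H3_closure derived_set_of ((\<lambda>\<gamma>. Some (poincare_action \<gamma> p)) ` \<Gamma>)}"

definition boundary_map ::
  "(complex^2^2) set set \<Rightarrow> complex option set \<Rightarrow> ((complex^2^2) set \<Rightarrow> (complex^2^2) set)
    \<Rightarrow> (complex option \<Rightarrow> complex option) \<Rightarrow> bool"
  where "boundary_map \<Gamma> \<Lambda> \<rho> f \<longleftrightarrow>
    embedding_map (subtopology S2 \<Lambda>) S2 f \<and>
    (\<forall>\<gamma>\<in>\<Gamma>. \<forall>\<xi>\<in>\<Lambda>. f (moebius_action \<gamma> \<xi>) = moebius_action (\<rho> \<gamma>) (f \<xi>))"


section \<open>Circles and Moebius transformations\<close>

text \<open>Circles in \<open>\<S>\<^sup>2\<close> are the Euclidean circles in \<open>\<complex>\<close> and the lines in \<open>\<complex>\<close> together with \<open>\<infinity>\<close>;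
  inversion in a circle of the latter kind is Euclidean reflection.\<close>

definition circle :: "complex \<Rightarrow> real \<Rightarrow> complex option set"
  where "circle c r = Some ` sphere c r"

definition line :: "complex \<Rightarrow> real \<Rightarrow> complex option set"
  where "line a b = insert None (Some ` {z. a \<bullet> z = b})"

definition circles :: "complex option set set"
  where "circles = {circle c r |c r. r > 0} \<union> {line a b |a b. a \<noteq> 0}"

definition circle_inversion :: "complex \<Rightarrow> real \<Rightarrow> complex option \<Rightarrow> complex option"
  where "circle_inversion c r x = (case x of
      None \<Rightarrow> Some c
    | Some z \<Rightarrow> if z = c then None else Some (c + of_real (r\<^sup>2) / cnj (z - c)))"

definition line_inversion :: "complex \<Rightarrow> real \<Rightarrow> complex option \<Rightarrow> complex option"
  where "line_inversion a b = map_option (\<lambda>z. z - (2 * (a \<bullet> z - b) / (a \<bullet> a)) *\<^sub>R a)"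

definition inversions :: "(complex option \<Rightarrow> complex option) set"
  where "inversions = {circle_inversion c r |c r. r > 0} \<union> {line_inversion a b |a b. a \<noteq> 0}"

definition Moeb_S2 :: "(complex option \<Rightarrow> complex option) set"
  where "Moeb_S2 = generate (BijGroup UNIV) inversions"

lemma circle_inversion_involution:
  assumes "r > 0" shows "circle_inversion c r (circle_inversion c r x) = x"
  using assms by (auto simp: circle_inversion_def split: option.split)

lemma line_inversion_involution:
  assumes "a \<noteq> 0" shows "line_inversion a b (line_inversion a b x) = x"
proof (cases x)
  case (Some z)
  define k where "k = 2 * (a \<bullet> z - b) / (a \<bullet> a)"
  have "k * (a \<bullet> a) = 2 * (a \<bullet> z - b)" using assms by (simp add: k_def)
  then have "2 * (a \<bullet> (z - k *\<^sub>R a) - b) / (a \<bullet> a) = - k"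
    using assms by (simp add: inner_diff_right divide_simps)
  then have "line_inversion a b (Some (z - k *\<^sub>R a)) = Some z"
    unfolding line_inversion_def option.map by simp
  then show ?thesis
    by (simp only: Some line_inversion_def option.map k_def)
qed (simp add: line_inversion_def)

lemma inversions_subset_BijGroup: "inversions \<subseteq> carrier (BijGroup UNIV)"
proof
  fix h assume "h \<in> inversions"
  then have "h (h x) = x" for x
    by (auto simp: inversions_def circle_inversion_involution line_inversion_involution)
  then have "bij h" by (rule involuntory_imp_bij)
  then show "h \<in> carrier (BijGroup UNIV)"
    by (simp add: BijGroup_def Bij_def)
qed

definition concyclic :: "complex option set \<Rightarrow> bool"
  where "concyclic X \<longleftrightarrow> (\<exists>C\<in>circles. X \<subseteq> C)"

end

theory Submission imports Defs begin

text \<open>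
  Conjugate a loxodromic element of \<open>\<Gamma>\<close> and its image so that both fix \<open>0\<close> and \<open>\<infinity>\<close> and expand \<open>\<complex>\<close>.
  Then \<open>f\<close> becomes a map \<open>F\<close> of a closed set \<open>L \<subseteq> \<complex>\<close> that preserves collinearity and conjugates each
  element \<open>A\<close> of the group to an element \<open>B\<close>; write \<open>a\<close>, \<open>a'\<close> for the upper left entries and \<open>w = A\<inverse>(0)\<close>.
  Let \<open>D\<close> be the expanding diagonal element. The map \<open>D\<^sup>n A\<close> carries a line through \<open>y \<in> L\<close> and a point
  of \<open>L\<close> near \<open>w\<close> to a curve near a ray from a fixed \<open>\<alpha> \<in> L\<close> in direction \<open>a\<^sup>2 (y - w)\<close>. If this ray crosses
  from one component of \<open>\<Omega>\<close> to another, then all nearby curves meet \<open>L\<close>, and collinearity gives in the limit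
  a point \<open>p \<in> L\<close> on the ray with \<open>F p - F \<alpha>\<close> a real multiple of \<open>a'\<^sup>2 (F y - F w)\<close>.

  By Zariski density the closure of the pairs of directions of \<open>(a\<^sup>2, a'\<^sup>2)\<close> in the torus projects onto the
  first circle, and up to sign it is the graph of a character of the circle. Hence the
  direction of \<open>F y - F w\<close> is, up to a constant and a sign, the \<open>m\<close>-th power of the direction of \<open>y - w\<close> or of its
  conjugate. If \<open>m = 0\<close>, the image lies in a line; if \<open>m \<ge> 2\<close>, the relations among triples of orbit points
  extend by Zariski density to a polynomial identity that is false. So \<open>m = 1\<close>, which forces \<open>F z = \<mu> z\<close> or \<open>F z = \<mu> \<bar>z\<close>.

  A suitable ray exists: with three components, take a circle through all three and move its end point into
  the orbit of a loxodromic fixed point; with two components, if every ray between the fixed points of a loxodromic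
  element stayed in one component, the directions of the rays in one component would form a proper connected subset
  of the circle that is invariant under a non-trivial rotation.
\<close>

section \<open>Closed semigroups and characters of the circle\<close>

text \<open>Collinearity of \<open>x\<close>, \<open>y\<close>, \<open>z\<close> is informative only
  when the third point is known to lie in \<open>L\<close>, and a line through two points of
  \<open>L\<close> may miss the rest of \<open>L\<close>. The components of \<Omega> repair this: a
  curve from one component to another must meet \<Lambda>, and so must every curve close to it. This
  is why the ray condition speaks of all nearby curves, and why the arc has to end at a loxodromic
  fixed point: only then is it a straight ray in the chart where the expanding element is diagonal,
  hence a limit of blown-up lines. The factor \<open>a^2\<close> is a derivative: at
  \<open>w = A^-1(0)\<close> the denominator \<open>c w + d\<close> is \<open>1/a\<close>, so
  \<open>A'(w) = a^2\<close>. Matrix entries are not multiplicative, but inserting a high power of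
  the diagonal element between two factors makes the upper left entry multiplicative in the limit;
  this turns the directions into a semigroup. The rotations that such powers bring along, in the
  source and in the target, are removed at once by simultaneous recurrence on the torus.
  Collinearity determines directions only up to sign, so directions are squared before they are
  compared.\<close>

lemma simultaneous_recurrence:
  fixes u v :: complex
  assumes "norm u = 1" "norm v = 1" "\<epsilon> > 0"
  obtains n where "n \<ge> N" "norm (u ^ n - 1) < \<epsilon>" "norm (v ^ n - 1) < \<epsilon>"
proof -
  \<comment> \<open>Exponents run through multiples of \<open>N'\<close>; two close terms of the
    orbit in the compact torus then differ by an exponent of at least \<open>N\<close>, and this
    difference is the recurrence time.\<close>
  define N' where "N' = max N 1"
  define X where "X = (\<lambda>j. (u ^ (N' * j), v ^ (N' * j)))"
  have "compact (sphere 0 1 \<times> sphere 0 1 :: (complex \<times> complex) set)"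
    by (intro compact_Times compact_sphere)
  moreover have "X j \<in> sphere 0 1 \<times> sphere 0 1" for j
    using assms by (simp add: X_def norm_power)
  ultimately obtain p r where r: "strict_mono (r :: nat \<Rightarrow> nat)" "(X \<circ> r) \<longlonglongrightarrow> p"
    unfolding compact_def by metis
  then have "Cauchy (X \<circ> r)" by (intro LIMSEQ_imp_Cauchy)
  then obtain M where M: "dist ((X \<circ> r) (Suc M)) ((X \<circ> r) M) < \<epsilon>"
    unfolding Cauchy_def using \<open>\<epsilon> > 0\<close> by (metis le_SucI order_refl)
  have lt: "r M < r (Suc M)" using r(1) by (simp add: strict_mono_Suc_iff)
  define n where "n = N' * (r (Suc M) - r M)"
  have N: "N' * r (Suc M) = n + N' * r M"
    using lt by (simp add: n_def diff_mult_distrib2 algebra_simps)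
  have *: "norm (z ^ n - 1) = dist (z ^ (N' * r (Suc M))) (z ^ (N' * r M))" if "norm z = 1" for z :: complex
  proof -
    have "z ^ (N' * r (Suc M)) - z ^ (N' * r M) = (z ^ n - 1) * z ^ (N' * r M)"
      unfolding N by (simp add: power_add algebra_simps)
    then show ?thesis using that by (simp add: dist_norm norm_mult norm_power)
  qed
  show thesis
  proof
    have "1 * N \<le> (r (Suc M) - r M) * N'" using lt by (intro mult_mono) (auto simp: N'_def)
    then show "n \<ge> N" by (simp add: n_def mult.commute)
    have "dist (fst ((X \<circ> r) (Suc M))) (fst ((X \<circ> r) M)) < \<epsilon>"
      using dist_fst_le M by (rule le_less_trans)
    then show "norm (u ^ n - 1) < \<epsilon>" using * assms by (simp add: X_def)
    have "dist (snd ((X \<circ> r) (Suc M))) (snd ((X \<circ> r) M)) < \<epsilon>"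
      using dist_snd_le M by (rule le_less_trans)
    then show "norm (v ^ n - 1) < \<epsilon>" using * assms by (simp add: X_def)
  qed
qed

lemma simultaneous_recurrence_seq:
  fixes u v :: complex
  assumes "norm u = 1" "norm v = 1"
  obtains n :: "nat \<Rightarrow> nat" where "filterlim n at_top sequentially"
    "(\<lambda>k. u ^ n k) \<longlonglongrightarrow> 1" "(\<lambda>k. v ^ n k) \<longlonglongrightarrow> 1"
proof -
  have "\<exists>n\<ge>k. norm (u ^ n - 1) < inverse (Suc k) \<and> norm (v ^ n - 1) < inverse (Suc k)" for k
    by (rule simultaneous_recurrence[of u v "inverse (Suc k)" k]) (use assms in auto)
  then obtain n where n: "\<And>k. n k \<ge> k" "\<And>k. norm (u ^ n k - 1) < inverse (Suc k)"
      "\<And>k. norm (v ^ n k - 1) < inverse (Suc k)"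
    by metis
  show thesis
  proof
    show "filterlim n at_top sequentially"
      by (rule filterlim_at_top_mono[OF filterlim_ident]) (use n in auto)
    have *: "(\<lambda>k. x k) \<longlonglongrightarrow> 1" if "\<And>k. norm (x k - 1) < inverse (Suc k)" for x :: "nat \<Rightarrow> complex"
      by (rule Lim_transform[OF tendsto_const],
          rule Lim_null_comparison[OF _ LIMSEQ_inverse_real_of_nat])
        (use that in \<open>auto simp: less_imp_le norm_minus_commute\<close>)
    show "(\<lambda>k. u ^ n k) \<longlonglongrightarrow> 1" "(\<lambda>k. v ^ n k) \<longlonglongrightarrow> 1"
      using n by (intro *; blast)+
  qed
qed

lemma norm_cis_minus_1_mono:
  assumes "0 \<le> r" "r \<le> t" "t \<le> pi"
  shows "norm (cis r - 1) \<le> norm (cis t - 1)"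
proof -
  have *: "(norm (cis x - 1))\<^sup>2 = 2 - 2 * cos x" for x
    unfolding cmod_power2 using sin_cos_squared_add[of x] by (simp add: power2_eq_square algebra_simps)
  have "cos t \<le> cos r" using assms by (intro cos_monotone_0_pi_le) auto
  then have "(norm (cis r - 1))\<^sup>2 \<le> (norm (cis t - 1))\<^sup>2" unfolding * by simp
  then show ?thesis by (rule power2_le_imp_le) simp
qed

text \<open>Steps of angle \<open>t\<close> along the circle leave no gap longer than one
  step.\<close>

lemma cis_power_approx:
  assumes "0 < t" "t \<le> pi" "norm z = 1"
  obtains n :: nat where "norm (cis t ^ Suc n - z) \<le> norm (cis t - 1)"
proof -
  \<comment> \<open>The extra full turn makes \<open>s\<close> at least \<open>t\<close>, so the
    number of steps is positive and the exponent has the form \<open>Suc n\<close>.\<close>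
  define s where "s = Arg2pi z + 2 * pi"
  have zs: "z = cis s"
    using Arg2pi_eq[of z] assms(3) unfolding s_def cis_mult[symmetric] cis_2pi by (simp add: cis_conv_exp)
  define m where "m = nat \<lfloor>s / t\<rfloor>"
  have "s \<ge> t" using assms Arg2pi[of z] by (simp add: s_def)
  then have st: "s / t \<ge> 1" using assms by simp
  then have "m \<ge> 1" by (simp add: m_def le_nat_iff)
  have "real m = of_int \<lfloor>s / t\<rfloor>" using st by (simp add: m_def)
  then have "real m \<le> s / t" "s / t < real m + 1" by linarith+
  then have r: "0 \<le> s - m * t" "s - m * t \<le> t" using assms by (auto simp: field_simps)
  have "cis t ^ m - z = - cis (m * t) * (cis (s - m * t) - 1)"
    by (simp add: zs Complex.DeMoivre right_diff_distrib cis_mult)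
  then have "norm (cis t ^ m - z) = norm (cis (s - m * t) - 1)" by (simp add: norm_mult)
  also have "\<dots> \<le> norm (cis t - 1)" using r assms by (intro norm_cis_minus_1_mono) auto
  finally show thesis using that[of "m - 1"] \<open>m \<ge> 1\<close> by simp
qed

lemma cis_Arg_unit: "norm z = 1 \<Longrightarrow> cis (Arg z) = z"
  by (cases "z = 0") (auto simp: cis_Arg sgn_eq)

lemma unit_power_approx:
  fixes q z :: complex
  assumes "norm q = 1" "q \<noteq> 1" "norm z = 1"
  obtains n :: nat where "norm (q ^ Suc n - z) \<le> norm (q - 1)"
proof -
  obtain t where q: "q = cis t" and A: "- pi < t" "t \<le> pi"
    using Arg_bounded[of q] cis_Arg_unit[OF assms(1)] by metis
  consider "t > 0" | "t < 0" using q assms(2) by (cases t "0 :: real" rule: linorder_cases) auto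
  then show thesis
  proof cases
    case 1
    then show thesis by (rule cis_power_approx[of t z]) (use A assms q that in auto)
  next
    case 2
    obtain n where n: "norm (cis (- t) ^ Suc n - cnj z) \<le> norm (cis (- t) - 1)"
      by (rule cis_power_approx[of "- t" "cnj z"]) (use 2 A assms in auto)
    have c: "cis (- t) = cnj q" by (simp add: q cis_cnj)
    have "norm (cnj (q ^ Suc n - z)) \<le> norm (cnj (q - 1))" using n unfolding c by simp
    then show thesis using that by (simp only: complex_mod_cnj)
  qed
qed

text \<open>If \<open>Q\<close> had points other than 1 arbitrarily close to 1, their powers would
  be dense in the circle. So there is a gap around 1, and recurrence, with a bound on the exponent
  that is uniform by compactness, forces a power of each element to be exactly 1.\<close>

lemma closed_subsemigroup_circle:
  fixes Q :: "complex set"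
  assumes Q: "closed Q" "Q \<subseteq> sphere 0 1" "\<And>x y. x \<in> Q \<Longrightarrow> y \<in> Q \<Longrightarrow> x * y \<in> Q"
    and ne: "Q \<noteq> sphere 0 1"
  obtains N where "N > 0" "\<And>q. q \<in> Q \<Longrightarrow> q ^ N = 1"
proof -
  have pow: "q ^ Suc n \<in> Q" if "q \<in> Q" for q n
    using that by (induction n) (use Q(3) in auto)
  have "\<exists>\<delta>>0. \<forall>q\<in>Q. q = 1 \<or> norm (q - 1) \<ge> \<delta>"
  proof (rule ccontr)
    assume "\<not> ?thesis"
    then have small: "\<exists>q\<in>Q. q \<noteq> 1 \<and> norm (q - 1) < \<delta>" if "\<delta> > 0" for \<delta>
      using that by force
    have "z \<in> Q" if z: "norm z = 1" for z
    proof -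
      have "\<exists>y\<in>Q. dist y z < \<epsilon>" if eps: "\<epsilon> > 0" for \<epsilon>
      proof -
        obtain q where q: "q \<in> Q" "q \<noteq> 1" "norm (q - 1) < \<epsilon>" using small[OF eps] by blast
        from q(1) Q(2) have "norm q = 1" by auto
        from this q(2) z obtain n where "norm (q ^ Suc n - z) \<le> norm (q - 1)"
          by (rule unit_power_approx)
        with q pow show ?thesis by (metis dist_norm le_less_trans)
      qed
      then show ?thesis using Q(1) closed_approachable by blast
    qed
    then show False using Q(2) ne by auto
  qed
  then obtain \<delta> where \<delta>: "\<delta> > 0" "\<And>q. q \<in> Q \<Longrightarrow> q = 1 \<or> norm (q - 1) \<ge> \<delta>" by auto
  \<comment> \<open>Were there no uniform bound, a limit point \<open>p\<close> of counterexamples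
    would recur at a fixed exponent \<open>m\<close>, and so would the counterexamples near
    \<open>p\<close>.\<close>
  obtain M where M: "\<And>q :: complex. norm q = 1 \<Longrightarrow> \<exists>m. 0 < m \<and> m \<le> M \<and> norm (q ^ m - 1) < \<delta>"
  proof (rule ccontr)
    assume "\<not> thesis"
    then have "\<exists>q :: complex. norm q = 1 \<and> (\<forall>m. 0 < m \<and> m \<le> M \<longrightarrow> norm (q ^ m - 1) \<ge> \<delta>)" for M
      using that by (metis not_le)
    then obtain q :: "nat \<Rightarrow> complex" where q: "\<And>M. norm (q M) = 1" "\<And>M m. 0 < m \<Longrightarrow> m \<le> M \<Longrightarrow> norm (q M ^ m - 1) \<ge> \<delta>"
      by metis
    have "compact (sphere 0 1 :: complex set)" "\<And>M. q M \<in> sphere 0 1" using q by auto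
    then obtain p r where pr: "p \<in> sphere 0 1" "strict_mono (r :: nat \<Rightarrow> nat)" "(q \<circ> r) \<longlonglongrightarrow> p"
      unfolding compact_def by metis
    obtain m where m: "m \<ge> 1" "norm (p ^ m - 1) < \<delta>"
      using simultaneous_recurrence[of p p \<delta> 1] \<delta> pr by auto
    have "(\<lambda>k. norm ((q \<circ> r) k ^ m - 1)) \<longlonglongrightarrow> norm (p ^ m - 1)"
      by (intro tendsto_intros pr)
    moreover have "\<forall>\<^sub>F k in sequentially. norm ((q \<circ> r) k ^ m - 1) \<ge> \<delta>"
      using eventually_ge_at_top[of m]
    proof eventually_elim
      case (elim k)
      then have "m \<le> r k" using seq_suble[OF pr(2), of k] by simp
      then show ?case using q(2)[of m "r k"] m by simp
    qed
    ultimately have "norm (p ^ m - 1) \<ge> \<delta>"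
      by (rule tendsto_lowerbound) auto
    with m show False by simp
  qed
  show thesis
  proof
    \<comment> \<open>\<open>fact M\<close> is a common multiple of all positive exponents up to
      \<open>M\<close>.\<close>
    show "fact M > (0::nat)" by simp
    fix q assume "q \<in> Q"
    with Q(2) have "norm q = 1" by auto
    from M[OF this] obtain m where m: "0 < m" "m \<le> M" "norm (q ^ m - 1) < \<delta>" by blast
    then have "q ^ m \<in> Q" using pow[OF \<open>q \<in> Q\<close>, of "m - 1"] by simp
    with m(3) \<delta>(2)[of "q ^ m"] have "q ^ m = 1" by linarith
    moreover have "m dvd fact M" using m by (simp add: dvd_fact)
    ultimately show "q ^ fact M = 1" by (metis dvdE power_mult power_one)
  qed
qed

lemma cis_eq_1_imp:
  assumes "cis t = 1"
  obtains n :: int where "t = 2 * pi * of_int n"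
proof -
  have "exp (\<i> * of_real t) = 1" using assms by (simp add: cis_conv_exp)
  then obtain n :: int where "t = of_int (2 * n) * pi" unfolding exp_eq_1 by auto
  then show thesis using that[of n] by simp
qed

text \<open>Lifting along \<open>cis\<close> turns \<open>\<psi>\<close> into a continuous map of
  the real line; its additivity defect is a whole number of turns, hence constant, hence 0.
  Continuity makes the additive lift linear, and the period \<open>2 * pi\<close> makes its slope an
  integer.\<close>

lemma circle_continuous_hom:
  fixes \<psi> :: "complex \<Rightarrow> complex"
  assumes cont: "continuous_on (sphere 0 1) \<psi>" and im: "\<And>u. norm u = 1 \<Longrightarrow> norm (\<psi> u) = 1"
    and hom: "\<And>u v. norm u = 1 \<Longrightarrow> norm v = 1 \<Longrightarrow> \<psi> (u * v) = \<psi> u * \<psi> v"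
  obtains k :: int where "\<And>u. norm u = 1 \<Longrightarrow> \<psi> u = u powi k"
proof -
  have "continuous_on UNIV (\<lambda>t::real. \<psi> (cis t))"
    by (rule continuous_on_compose2[OF cont]) (auto intro!: continuous_intros)
  moreover have "\<psi> (cis t) \<noteq> 0" for t using im[of "cis t"] by auto
  ultimately obtain g where g: "continuous_on UNIV g" "\<And>t::real. \<psi> (cis t) = exp (g t)"
    using continuous_logarithm_on_contractible[of "UNIV :: real set" "\<lambda>t. \<psi> (cis t)"]
    by (metis UNIV_I contractible_UNIV)
  define \<phi> where "\<phi> t = Im (g t) - Im (g 0)" for t
  have one: "\<psi> 1 = 1"
    using hom[of 1 1] im[of 1] by (metis mult_cancel_right1 norm_one norm_zero zero_neq_one mult_1)
  have psi: "\<psi> (cis t) = cis (\<phi> t)" for t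
  proof -
    have "Re (g t) = 0" for t using im[of "cis t"] g(2)[of t] by simp
    then have *: "\<psi> (cis t) = cis (Im (g t))" for t using g(2)[of t] by (simp add: exp_eq_polar)
    have "cis (Im (g 0)) = 1" using *[of 0] one by simp
    then show ?thesis using * by (simp add: \<phi>_def cis_divide[symmetric])
  qed
  have cphi: "continuous_on UNIV \<phi>" unfolding \<phi>_def by (intro continuous_intros g)
  have add: "\<phi> (s + t) = \<phi> s + \<phi> t" for s t
  proof -
    define d where "d = (\<lambda>s. (\<phi> (s + t) - \<phi> s - \<phi> t) / (2 * pi))"
    have "d s \<in> \<int>" for s
    proof -
      have "cis (\<phi> (s + t)) = cis (\<phi> s) * cis (\<phi> t)"
        using hom[of "cis s" "cis t"] by (simp add: psi cis_mult)
      then have "cis (\<phi> (s + t) - \<phi> s - \<phi> t) = 1"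
        by (simp add: cis_divide[symmetric])
      then obtain n :: int where "\<phi> (s + t) - \<phi> s - \<phi> t = 2 * pi * of_int n"
        by (rule cis_eq_1_imp)
      then show ?thesis by (simp add: d_def)
    qed
    moreover have "continuous_on UNIV d"
      unfolding d_def by (intro continuous_intros continuous_on_compose2[OF cphi]) auto
    ultimately have "d constant_on UNIV"
      by (intro continuous_discrete_range_constant)
        (auto intro!: exI[of _ 1] Ints_nonzero_abs_ge1)
    then have "d s = d 0" by (auto simp: constant_on_def)
    also have "d 0 = 0" by (simp add: d_def \<phi>_def)
    finally show ?thesis by (simp add: d_def)
  qed
  interpret additive \<phi> by (rule additive.intro) (rule add)
  have nat: "\<phi> (of_nat n * t) = of_nat n * \<phi> t" for n t
    by (induction n) (simp_all add: zero add algebra_simps)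
  have lin: "\<phi> t = t * \<phi> 1" for t
  proof -
    have rat: "\<phi> q = q * \<phi> 1" if rq: "q \<in> \<rat>" for q :: real
    proof -
      obtain a b :: int where q: "b > 0" "q = of_int a / of_int b"
        using rq by (rule Rats_cases')
      have int: "\<phi> (of_int a) = of_int a * \<phi> 1"
        using nat[of "nat a" 1] nat[of "nat (- a)" 1] minus[of "of_nat (nat (- a))"]
        by (cases "a \<ge> 0") auto
      have "of_nat (nat b) * q = of_int a" using q by simp
      then have "of_int b * \<phi> q = of_int a * \<phi> 1"
        using nat[of "nat b" q] q int by simp
      with q(1) have "\<phi> q = (of_int a / of_int b) * \<phi> 1" by (simp add: field_simps)
      then show ?thesis by (simp only: q(2))
    qed
    have "closed {x. \<phi> x = x * \<phi> 1}"
      by (intro closed_Collect_eq continuous_intros cphi)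
    then have "closure \<rat> \<subseteq> {x. \<phi> x = x * \<phi> 1}"
      using rat by (intro closure_minimal subsetI CollectI)
    then show ?thesis using Rats_closure_real by auto
  qed
  have "cis (2 * pi * \<phi> 1) = 1"
    using psi[of "2 * pi"] one lin[of "2 * pi"] by simp
  then obtain k :: int where "2 * pi * \<phi> 1 = 2 * pi * of_int k"
    by (rule cis_eq_1_imp)
  then have k: "\<phi> 1 = of_int k" by simp
  show thesis
  proof
    fix u :: complex assume u: "norm u = 1"
    then obtain t where t: "u = cis t" by (metis cis_Arg_unit)
    have "\<phi> t = of_int k * t" using lin[of t] k by simp
    then show "\<psi> u = u powi k" by (simp only: t psi cis_power_int)
  qed
qed

section \<open>Conjugacies in the plane that preserve collinearity\<close>

definition mat2 :: "complex \<Rightarrow> complex \<Rightarrow> complex \<Rightarrow> complex \<Rightarrow> complex^2^2"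
  where "mat2 a b c d = vector [vector [a, b], vector [c, d]]"

lemma mat2_nth [simp]:
  "mat2 a b c d $ 1 $ 1 = a" "mat2 a b c d $ 1 $ 2 = b"
  "mat2 a b c d $ 2 $ 1 = c" "mat2 a b c d $ 2 $ 2 = d"
  by (simp_all add: mat2_def)

lemma mat2_eq_iff: "A = B \<longleftrightarrow> A$1$1 = B$1$1 \<and> A$1$2 = B$1$2 \<and> A$2$1 = B$2$1 \<and> A$2$2 = B$2$2"
  for A B :: "complex^2^2"
  by (auto simp: vec_eq_iff forall_2)

lemma mult2_nth: "(A ** B) $ i $ j = A$i$1 * B$1$j + A$i$2 * B$2$j"
  for A B :: "complex^2^2"
  by (simp add: matrix_matrix_mult_def sum_2)

lemma mat_1_nth2: "(mat 1 :: complex^2^2)$1$1 = 1" "(mat 1 :: complex^2^2)$1$2 = 0"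
  "(mat 1 :: complex^2^2)$2$1 = 0" "(mat 1 :: complex^2^2)$2$2 = 1"
  by (simp_all add: mat_def)

definition inv2 :: "complex^2^2 \<Rightarrow> complex^2^2"
  where "inv2 A = mat2 (A$2$2) (- A$1$2) (- A$2$1) (A$1$1)"

lemma inv2_nth [simp]: "inv2 A $1$1 = A$2$2" "inv2 A $1$2 = - A$1$2" "inv2 A $2$1 = - A$2$1"
  "inv2 A $2$2 = A$1$1"
  by (simp_all add: inv2_def)

lemma inv2_inverse: assumes "det A = 1" shows "A ** inv2 A = mat 1" "inv2 A ** A = mat 1"
  using assms by (auto simp: mat2_eq_iff mult2_nth mat_1_nth2 det_2 algebra_simps)

lemma det_inv2 [simp]: "det (inv2 A) = det A"
  by (simp add: det_2 algebra_simps)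

lemma sgn_complex_power: "sgn (z ^ n) = sgn z ^ n" for z :: complex
  by (induction n) (simp_all add: sgn_mult)

lemma diff_quotients:
  fixes p q r s :: complex
  assumes "q \<noteq> 0" "s \<noteq> 0" shows "(p / q - r / s) * (q * s) = p * s - r * q"
  using assms by (simp add: field_simps)

text \<open>Division by zero yields 0, so the equivalence also covers \<open>a = 0\<close> and lets
  real quotients and collinearity be exchanged without case distinctions.\<close>

lemma real_quotient_iff: "b / a \<in> \<real> \<longleftrightarrow> Im (a * cnj b) = 0" for a b :: complex
proof (cases "a = 0")
  case False
  have "Im (b / a) = Im (b * cnj a) / (norm a)\<^sup>2"
    using Im_divide[of b a] by (simp add: cmod_power2 field_simps)
  moreover have "Im (b * cnj a) = - Im (a * cnj b)" by (simp add: algebra_simps)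
  ultimately have "Im (b / a) = 0 \<longleftrightarrow> Im (a * cnj b) = 0" using False by (simp del: times_complex.sel)
  then show ?thesis by (simp only: complex_is_Real_iff)
qed simp

text \<open>The stable form of the condition that the ray from \<open>\<alpha>\<close> in direction \<open>e\<close> crosses from one component
  of the complement of \<open>L\<close> to another between the radii \<open>r\<^sub>1\<close> and \<open>r\<^sub>2\<close>.\<close>

definition robust_ray :: "complex set \<Rightarrow> complex \<Rightarrow> real \<Rightarrow> real \<Rightarrow> real \<Rightarrow> complex \<Rightarrow> bool"
  where "robust_ray L \<alpha> r\<^sub>1 r\<^sub>2 \<epsilon> e \<longleftrightarrow>
    (\<forall>Q. continuous_on {r\<^sub>1..r\<^sub>2} Q \<and> (\<forall>r\<in>{r\<^sub>1..r\<^sub>2}. norm (Q r - (\<alpha> + of_real r * e)) < \<epsilon>)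
      \<longrightarrow> (\<exists>r\<in>{r\<^sub>1..r\<^sub>2}. Q r \<in> L))"

text \<open>\<open>G\<close> contains the pairs \<open>(A, B)\<close> of matrices such that \<open>F\<close> conjugates the action of \<open>A\<close> on \<open>L \<union> {\<infinity>}\<close>
  to the action of \<open>B\<close>, with \<open>F \<infinity> = \<infinity>\<close>; the point \<open>\<infinity>\<close> is expressed by \<open>infinity\<close> and \<open>act_pole\<close>.\<close>

locale plane_conjugacy =
  fixes G :: "((complex^2^2) \<times> (complex^2^2)) set" and L :: "complex set"
    and F :: "complex \<Rightarrow> complex" and l l' :: complex
    and \<alpha> e\<^sub>0 :: complex and r\<^sub>1 r\<^sub>2 \<epsilon>\<^sub>0 :: real
  assumes mult: "\<And>A B A' B'. (A, B) \<in> G \<Longrightarrow> (A', B') \<in> G \<Longrightarrow> (A ** A', B ** B') \<in> G"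
    and inverse: "\<And>A B. (A, B) \<in> G \<Longrightarrow> (inv2 A, inv2 B) \<in> G"
    and det: "\<And>A B. (A, B) \<in> G \<Longrightarrow> det A = 1" "\<And>A B. (A, B) \<in> G \<Longrightarrow> det B = 1"
    and dense_fst: "\<And>p A. real_polynomial_function p \<Longrightarrow> (\<And>A B. (A, B) \<in> G \<Longrightarrow> p A = 0) \<Longrightarrow>
      det A = 1 \<Longrightarrow> p A = 0"
    and dense_snd: "\<And>p A. real_polynomial_function p \<Longrightarrow> (\<And>A B. (A, B) \<in> G \<Longrightarrow> p B = 0) \<Longrightarrow>
      det A = 1 \<Longrightarrow> p A = 0"
    and closed: "closed L" and cont: "continuous_on L F" and inj: "inj_on F L"
    and zero: "0 \<in> L" "F 0 = 0"
    and infinity: "\<And>R. \<exists>R'. \<forall>z\<in>L. norm z > R' \<longrightarrow> norm (F z) > R"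
    and act: "\<And>A B z. (A, B) \<in> G \<Longrightarrow> z \<in> L \<Longrightarrow> A$2$1 * z + A$2$2 \<noteq> 0 \<Longrightarrow>
      (A$1$1 * z + A$1$2) / (A$2$1 * z + A$2$2) \<in> L \<and> B$2$1 * F z + B$2$2 \<noteq> 0 \<and>
      F ((A$1$1 * z + A$1$2) / (A$2$1 * z + A$2$2)) = (B$1$1 * F z + B$1$2) / (B$2$1 * F z + B$2$2)"
    and act_pole: "\<And>A B z. (A, B) \<in> G \<Longrightarrow> z \<in> L \<Longrightarrow> A$2$1 * z + A$2$2 = 0 \<Longrightarrow> B$2$1 * F z + B$2$2 = 0"
    and diag: "(mat2 l 0 0 (1 / l), mat2 l' 0 0 (1 / l')) \<in> G" "norm l > 1"
    and collinear: "\<And>x y z. x \<in> L \<Longrightarrow> y \<in> L \<Longrightarrow> z \<in> L \<Longrightarrow> distinct [x, y, z] \<Longrightarrow>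
      Im ((y - x) * cnj (z - x)) = 0 \<Longrightarrow> Im ((F y - F x) * cnj (F z - F x)) = 0"
    and alpha: "\<alpha> \<in> L" and e0: "norm e\<^sub>0 = 1" and radii: "0 < r\<^sub>1" "r\<^sub>1 \<le> r\<^sub>2" and eps: "\<epsilon>\<^sub>0 > 0"
    and robust: "robust_ray L \<alpha> r\<^sub>1 r\<^sub>2 \<epsilon>\<^sub>0 e\<^sub>0"
begin

lemma robust_ray_meets:
  assumes "robust_ray L \<alpha> r\<^sub>1 r\<^sub>2 \<epsilon> e" "\<epsilon> > 0"
  obtains r where "r \<in> {r\<^sub>1..r\<^sub>2}" "\<alpha> + of_real r * e \<in> L"
proof -
  have "continuous_on {r\<^sub>1..r\<^sub>2} (\<lambda>r. \<alpha> + of_real r * e)" by (intro continuous_intros)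
  then show thesis using assms that unfolding robust_ray_def
    by (metis (no_types, lifting) diff_self norm_zero)
qed

lemma l_nz: "l \<noteq> 0" "l' \<noteq> 0"
  using diag(2) det(2)[OF diag(1)] by (auto simp: det_2)

lemma diag_power: "(mat2 (l ^ n) 0 0 (1 / l ^ n), mat2 (l' ^ n) 0 0 (1 / l' ^ n)) \<in> G"
proof (induction n)
  case 0
  have "(mat2 l 0 0 (1 / l) ** inv2 (mat2 l 0 0 (1 / l)), mat2 l' 0 0 (1 / l') ** inv2 (mat2 l' 0 0 (1 / l'))) \<in> G"
    by (intro mult inverse diag)
  moreover have "mat2 x 0 0 (1 / x) ** inv2 (mat2 x 0 0 (1 / x)) = mat2 1 0 0 1" if "x \<noteq> 0" for x
    using that by (auto simp: mat2_eq_iff mult2_nth)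
  ultimately show ?case using l_nz by simp
next
  case (Suc n)
  have "mat2 x 0 0 (1 / x) ** mat2 (x ^ n) 0 0 (1 / x ^ n) = mat2 (x ^ Suc n) 0 0 (1 / x ^ Suc n)" for x
    by (auto simp: mat2_eq_iff mult2_nth)
  then show ?case using mult[OF diag(1) Suc] by simp
qed

text \<open>\<open>- A$1$2 / A$1$1\<close> is the preimage of 0 under \<open>A\<close>, and
  \<open>F\<close> fixes 0; so this is equivariance of \<open>F\<close> under the inverse
  pair.\<close>

lemma pole:
  assumes "(A, B) \<in> G" "A$1$1 \<noteq> 0"
  shows "- A$1$2 / A$1$1 \<in> L" "B$1$1 \<noteq> 0" "F (- A$1$2 / A$1$1) = - B$1$2 / B$1$1"
  using act[OF inverse[OF assms(1)] zero(1)] assms(2) zero(2) by auto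

text \<open>Equivariance under the inverse of \<open>D^n A\<close>: the diagonal power
  \<open>D^n\<close> multiplies by \<open>l^(2*n)\<close>, so its inverse sends \<open>p\<close> to
  \<open>q\<close>, and the formulas in the conclusion are those of \<open>inv2 A\<close> at
  \<open>q\<close> and of \<open>inv2 B\<close> at \<open>q'\<close>.\<close>

lemma expanding_act:
  assumes "(A, B) \<in> G" "p \<in> L" "A$1$1 - A$2$1 * (p / l^(2*n)) \<noteq> 0"
  defines "q \<equiv> p / l^(2*n)" and "q' \<equiv> F p / l'^(2*n)"
  shows "(A$2$2 * q - A$1$2) / (A$1$1 - A$2$1 * q) \<in> L" "B$1$1 - B$2$1 * q' \<noteq> 0"
    "F ((A$2$2 * q - A$1$2) / (A$1$1 - A$2$1 * q)) = (B$2$2 * q' - B$1$2) / (B$1$1 - B$2$1 * q')"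
proof -
  define X Y where "X = inv2 (mat2 (l ^ n) 0 0 (1 / l ^ n) ** A)"
    and "Y = inv2 (mat2 (l' ^ n) 0 0 (1 / l' ^ n) ** B)"
  have q: "q = p / (l^n * l^n)" "q' = F p / (l'^n * l'^n)"
    by (simp_all add: q_def q'_def power_add mult_2)
  have X: "X$2$1 * p + X$2$2 = l^n * (A$1$1 - A$2$1 * q)" "X$1$1 * p + X$1$2 = l^n * (A$2$2 * q - A$1$2)"
    using l_nz by (simp_all add: X_def mult2_nth q field_simps)
  have Y: "Y$2$1 * F p + Y$2$2 = l'^n * (B$1$1 - B$2$1 * q')" "Y$1$1 * F p + Y$1$2 = l'^n * (B$2$2 * q' - B$1$2)"
    using l_nz by (simp_all add: Y_def mult2_nth q field_simps)
  have *: "(X, Y) \<in> G"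
    unfolding X_def Y_def by (intro inverse mult diag_power assms)
  show "(A$2$2 * q - A$1$2) / (A$1$1 - A$2$1 * q) \<in> L" "B$1$1 - B$2$1 * q' \<noteq> 0"
    "F ((A$2$2 * q - A$1$2) / (A$1$1 - A$2$1 * q)) = (B$2$2 * q' - B$1$2) / (B$1$1 - B$2$1 * q')"
    using act[OF * assms(2), unfolded X Y] assms(3) l_nz by (simp_all add: q_def[symmetric])
qed

lemma nonzero_point: obtains y where "y \<in> L" "y \<noteq> 0"
proof -
  obtain r where r: "r \<in> {r\<^sub>1..r\<^sub>2}" "\<alpha> + of_real r * e\<^sub>0 \<in> L"
    using robust_ray_meets[OF robust eps] by blast
  then have "of_real r * e\<^sub>0 \<noteq> 0" using radii e0 by auto
  then have "\<alpha> \<noteq> 0 \<or> \<alpha> + of_real r * e\<^sub>0 \<noteq> 0" by auto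
  then show thesis using that alpha r by blast
qed

text \<open>Repeated expansion by \<open>l^2\<close> carries \<open>y\<close> to infinity; if
  \<open>l'\<close> did not expand, the images under \<open>F\<close> would stay bounded by
  \<open>norm (F y)\<close>, against \<open>infinity\<close>.\<close>

lemma norm_l'_gt_1: "norm l' > 1"
proof (rule ccontr)
  assume "\<not> norm l' > 1"
  obtain y where y: "y \<in> L" "y \<noteq> 0" by (rule nonzero_point)
  obtain R where R: "\<And>z. z \<in> L \<Longrightarrow> norm z > R \<Longrightarrow> norm (F z) > norm (F y)"
    using infinity by blast
  have "norm (l^2) > 1" using diag(2) by (simp add: norm_power one_less_power)
  then obtain n where n: "R / norm y < norm (l^2) ^ n" using real_arch_pow by blast
  have act': "l^(2*n) * y \<in> L \<and> F (l^(2*n) * y) = l'^(2*n) * F y"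
    using act[OF diag_power[of n] y(1)] l_nz by (simp add: mult_2 power_add) (simp add: mult_ac)?
  have "norm (l^(2*n) * y) > R"
  proof -
    have "norm (l^(2*n)) = norm (l^2) ^ n" by (simp only: power_mult norm_power)
    moreover have "R < norm (l^2) ^ n * norm y" using n y by (simp add: pos_divide_less_eq)
    ultimately show ?thesis by (simp only: norm_mult)
  qed
  then have "norm (l'^(2*n) * F y) > norm (F y)" using R act' by metis
  moreover have "norm (l'^(2*n) * F y) \<le> norm (F y)"
    using \<open>\<not> norm l' > 1\<close> by (simp add: norm_mult norm_power mult_left_le_one_le power_le_one)
  ultimately show False by simp
qed

text \<open>Let \<open>D\<close> be the diagonal element. A line through \<open>y\<close> and a
  point \<open>x k\<close> of \<open>L\<close> near \<open>w\<close> is carried by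
  \<open>D^n A\<close> to the curve \<open>P k\<close>, which is close to the given ray and so meets
  \<open>L\<close>. Pulled back, the meeting point is a further point of \<open>L\<close> on the
  line; collinearity of the images, transported by the target matrices and taken to the limit, gives
  the quotient.\<close>

lemma direction_quotient:
  assumes G: "(A, B) \<in> G" "A$1$1 \<noteq> 0"
  defines "w \<equiv> - A$1$2 / A$1$1"
  assumes y: "y \<in> L" "y \<noteq> w" and rob: "robust_ray L \<alpha> r\<^sub>1 r\<^sub>2 \<epsilon> (sgn (A$1$1^2 * (y - w)))" "\<epsilon> > 0"
  obtains r where "r \<in> {r\<^sub>1..r\<^sub>2}" "\<alpha> + of_real r * sgn (A$1$1^2 * (y - w)) \<in> L"
    "(F (\<alpha> + of_real r * sgn (A$1$1^2 * (y - w))) - F \<alpha>) / (B$1$1^2 * (F y - F w)) \<in> \<real>"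
proof -
  define a b c d where "a = A$1$1" "b = A$1$2" "c = A$2$1" "d = A$2$2"
  define a' b' c' d' where "a' = B$1$1" "b' = B$1$2" "c' = B$2$1" "d' = B$2$2"
  note abcd = a_b_c_d_def a'_b'_c'_d'_def
  define e where "e = sgn (a^2 * (y - w))"
  have nz: "a \<noteq> 0" "y - w \<noteq> 0" "a' \<noteq> 0" using G y pole(2)[OF G] by (auto simp: abcd)
  have det1: "a * d - b * c = 1" "a' * d' - b' * c' = 1"
    using det[OF G(1)] by (auto simp: det_2 abcd)
  have w: "w = - b / a" "w \<in> L" "F w = - b' / a'" using pole[OF G] by (auto simp: abcd w_def)
  have norm_e: "norm e = 1" using nz by (simp add: e_def norm_sgn)
  \<comment> \<open>Along these exponents the rotation parts of the powers of \<open>l^2\<close> and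
    \<open>l'^2\<close> both tend to the identity.\<close>
  obtain n :: "nat \<Rightarrow> nat" where n: "filterlim n at_top sequentially"
    "(\<lambda>k. sgn (l^2) ^ n k) \<longlonglongrightarrow> 1" "(\<lambda>k. sgn (l'^2) ^ n k) \<longlonglongrightarrow> 1"
    using simultaneous_recurrence_seq[of "sgn (l^2)" "sgn (l'^2)"] l_nz by (auto simp: norm_sgn)
  define \<Lambda> \<Lambda>' where "\<Lambda> k = l^(2 * n k)" and "\<Lambda>' k = l'^(2 * n k)" for k
  have inf: "filterlim (\<lambda>k. x^(2 * n k)) at_infinity sequentially" if "norm x > 1" for x :: complex
  proof -
    have "norm (x^2) > 1" using that by (simp add: norm_power one_less_power)
    then show ?thesis unfolding power_mult
      by (rule filterlim_compose[OF filterlim_realpow_sequentially_gt1 n(1)])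
  qed
  have lim_l: "filterlim \<Lambda> at_infinity sequentially" "filterlim \<Lambda>' at_infinity sequentially"
    unfolding \<Lambda>_def \<Lambda>'_def by (intro inf diag norm_l'_gt_1)+
  define q q' where "q k = \<alpha> / \<Lambda> k" and "q' k = F \<alpha> / \<Lambda>' k" for k
  have q: "q \<longlonglongrightarrow> 0" "q' \<longlonglongrightarrow> 0"
    unfolding q_def q'_def by (intro tendsto_divide_0[OF tendsto_const] lim_l)+
  \<comment> \<open>\<open>x k\<close> is the preimage of \<alpha> under \<open>D^(n k) A\<close>,
    hence eventually a point of \<open>L\<close>; it tends to \<open>w\<close> because
    \<open>q k\<close> tends to 0.\<close>
  define x where "x k = (d * q k - b) / (a - c * q k)" for k
  have x: "x \<longlonglongrightarrow> w" unfolding x_def w(1) using nz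
    by (auto intro!: tendsto_eq_intros q)
  have ev_a: "\<forall>\<^sub>F k in sequentially. a - c * q k \<noteq> 0"
    by (rule tendsto_imp_eventually_ne[of _ a]) (use nz in \<open>auto intro!: tendsto_eq_intros q\<close>)
  have ev_y: "\<forall>\<^sub>F k in sequentially. x k \<noteq> y"
    by (rule tendsto_imp_eventually_ne[OF x]) (use nz in auto)
  have xL: "x k \<in> L" "F (x k) = (d' * q' k - b') / (a' - c' * q' k)" "a' - c' * q' k \<noteq> 0"
    if "a - c * q k \<noteq> 0" for k
    using expanding_act[OF G(1) alpha, of "n k"] that
    by (simp_all add: abcd x_def q_def q'_def \<Lambda>_def \<Lambda>'_def)
  have Fx: "(\<lambda>k. F (x k)) \<longlonglongrightarrow> F w"
    by (rule continuous_on_tendsto_compose[OF cont x w(2)])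
      (use ev_a in \<open>eventually_elim, use xL in auto\<close>)
  \<comment> \<open>The scale at which the segment from \<open>x k\<close> to \<open>y\<close> has
    to be read: the point at parameter \<open>r * \<rho> k\<close> is blown up to distance about
    \<open>r\<close> from \<alpha>.\<close>
  define \<rho> where "\<rho> k = 1 / (norm (\<Lambda> k) * norm (a^2 * (y - w)))" for k
  have rho_pos: "\<rho> k > 0" for k using nz l_nz by (simp add: \<rho>_def \<Lambda>_def)
  have rho: "\<rho> \<longlonglongrightarrow> 0"
  proof -
    have "(\<lambda>k. 1 / norm (\<Lambda> k) * (1 / norm (a^2 * (y - w)))) \<longlonglongrightarrow> 0 * (1 / norm (a^2 * (y - w)))"
      by (intro tendsto_mult tendsto_const)
        (intro tendsto_divide_0[OF tendsto_const] filterlim_at_top_imp_at_infinity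
           filterlim_at_infinity_imp_norm_at_top lim_l)
    then show ?thesis by (simp add: \<rho>_def[abs_def])
  qed
  have sgn_lam: "sgn (\<Lambda> k) = sgn (l^2) ^ n k" "sgn (\<Lambda>' k) = sgn (l'^2) ^ n k" for k
    by (simp_all add: \<Lambda>_def \<Lambda>'_def power_mult sgn_complex_power)
  \<comment> \<open>Difference formula of a Moebius map: since
    \<open>c * x k + d = 1 / (a - c * q k)\<close>, the image of \<open>x k + s * (y - x k)\<close>
    under \<open>D^(n k) A\<close> is \<alpha> plus \<open>r * u k / (1 + r * v k)\<close>, where
    \<open>s = r * \<rho> k\<close>. The term \<open>v\<close> measures the bending of the curve and
    vanishes in the limit.\<close>
  define u v where "u k = \<Lambda> k * of_real (\<rho> k) * (y - x k) * (a - c * q k)^2"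
    and "v k = c * of_real (\<rho> k) * (y - x k) * (a - c * q k)" for k
  have u: "u \<longlonglongrightarrow> e"
  proof -
    have eq: "u = (\<lambda>k. sgn (l^2) ^ n k * (y - x k) * (a - c * q k)^2 / of_real (norm (a^2 * (y - w))))"
    proof
      fix k
      have "\<Lambda> k * of_real (\<rho> k) = sgn (l^2) ^ n k / of_real (norm (a^2 * (y - w)))"
        unfolding sgn_lam(1)[symmetric] by (simp add: \<rho>_def sgn_eq)
      then show "u k = sgn (l^2) ^ n k * (y - x k) * (a - c * q k)^2 / of_real (norm (a^2 * (y - w)))"
        unfolding u_def by (simp only: times_divide_eq_left)
    qed
    have "(\<lambda>k. sgn (l^2) ^ n k * (y - x k) * (a - c * q k)^2 / of_real (norm (a^2 * (y - w))))
       \<longlonglongrightarrow> 1 * (y - w) * (a - c * 0)^2 / of_real (norm (a^2 * (y - w)))"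
      by (intro tendsto_intros n q x) (use nz in auto)
    moreover have "1 * (y - w) * (a - c * 0)^2 / of_real (norm (a^2 * (y - w))) = e"
      by (simp add: e_def sgn_eq mult.commute)
    ultimately show ?thesis unfolding eq by metis
  qed
  have v: "v \<longlonglongrightarrow> 0"
    unfolding v_def by (auto intro!: tendsto_eq_intros q x rho)
  define P where "P k r = \<alpha> + of_real r * u k / (1 + of_real r * v k)" for k r
  \<comment> \<open>This bound keeps \<open>1 + r * v k\<close> at least 1/2 in absolute value for
    all \<open>r\<close> up to \<open>r\<^sub>2\<close>.\<close>
  have ev_v: "\<forall>\<^sub>F k in sequentially. norm (v k) < 1 / (2 * r\<^sub>2)"
    using v radii by (intro order_tendstoD(2)[OF tendsto_norm_zero[OF v]]) auto
  have ev_e: "\<forall>\<^sub>F k in sequentially. 2 * r\<^sub>2 * (norm (u k - e) + r\<^sub>2 * norm (v k)) < \<epsilon>"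
  proof (rule order_tendstoD(2))
    show "(\<lambda>k. 2 * r\<^sub>2 * (norm (u k - e) + r\<^sub>2 * norm (v k))) \<longlonglongrightarrow> 0"
      by (auto intro!: tendsto_eq_intros u v)
  qed (rule rob(2))
  have nz1: "norm (1 + of_real r * v k) \<ge> 1 / 2" if "norm (v k) < 1 / (2 * r\<^sub>2)" "r \<in> {r\<^sub>1..r\<^sub>2}" for r k
  proof -
    have "norm (of_real r * v k) \<le> r\<^sub>2 * (1 / (2 * r\<^sub>2))"
      unfolding norm_mult using that radii by (intro mult_mono) auto
    then show ?thesis using norm_diff_ineq[of 1 "of_real r * v k"] radii by simp
  qed
  have "\<forall>\<^sub>F k in sequentially. \<exists>r\<in>{r\<^sub>1..r\<^sub>2}. P k r \<in> L"
    using ev_v ev_e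
  proof eventually_elim
    case (elim k)
    have "continuous_on {r\<^sub>1..r\<^sub>2} (P k)"
      unfolding P_def using nz1[OF elim(1)] by (intro continuous_intros) fastforce
    moreover have "norm (P k r - (\<alpha> + of_real r * e)) < \<epsilon>" if r: "r \<in> {r\<^sub>1..r\<^sub>2}" for r
    proof -
      have n1: "norm (1 + of_real r * v k) \<ge> 1 / 2" by (rule nz1[OF elim(1) r])
      then have "1 + of_real r * v k \<noteq> 0" by auto
      then have "P k r - (\<alpha> + of_real r * e) = of_real r * ((u k - e) - of_real r * v k * e) / (1 + of_real r * v k)"
        by (simp add: P_def field_simps)
      then have "norm (P k r - (\<alpha> + of_real r * e)) =
         r * norm ((u k - e) - of_real r * v k * e) / norm (1 + of_real r * v k)"
        using r radii by (simp add: norm_mult norm_divide)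
      also have "\<dots> \<le> r\<^sub>2 * (norm (u k - e) + r\<^sub>2 * norm (v k)) / (1 / 2)"
      proof (intro frac_le mult_mono mult_nonneg_nonneg)
        have "norm ((u k - e) - of_real r * v k * e) \<le> norm (u k - e) + norm (of_real r * v k * e)"
          by (rule norm_triangle_ineq4)
        also have "norm (of_real r * v k * e) \<le> r\<^sub>2 * norm (v k)"
          using r radii norm_e by (simp add: norm_mult mult_right_mono)
        finally show "norm ((u k - e) - of_real r * v k * e) \<le> norm (u k - e) + r\<^sub>2 * norm (v k)" by simp
      qed (use r radii n1 in auto)
      also have "\<dots> < \<epsilon>" using elim(2) by simp
      finally show ?thesis .
    qed
    ultimately show ?case using rob(1) unfolding robust_ray_def e_def abcd by blast
  qed
  then obtain K where "\<And>k. k \<ge> K \<Longrightarrow> \<exists>r\<in>{r\<^sub>1..r\<^sub>2}. P k r \<in> L"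
    unfolding eventually_sequentially by blast
  then have "\<forall>k. \<exists>r. r \<in> {r\<^sub>1..r\<^sub>2} \<and> (k \<ge> K \<longrightarrow> P k r \<in> L)" using radii by (metis atLeastAtMost_iff order_refl)
  then obtain r where r: "\<And>k. r k \<in> {r\<^sub>1..r\<^sub>2}" "\<And>k. k \<ge> K \<Longrightarrow> P k (r k) \<in> L" by metis
  have evK: "\<forall>\<^sub>F k in sequentially. k \<ge> K" by (rule eventually_ge_at_top)
  define Q' where "Q' k = F (P k (r k)) / \<Lambda>' k" for k
  \<comment> \<open>The claim before the limit: the two brackets tend to \<open>a'\<close> and
    \<open>sgn (\<Lambda>' k)\<close> tends to 1, which leaves \<open>a'^2\<close>.\<close>
  have real: "\<forall>\<^sub>F k in sequentially. (F (P k (r k)) - F \<alpha>) /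
      (sgn (\<Lambda>' k) * (F y - F (x k)) * (a' - c' * Q' k) * (a' - c' * q' k)) \<in> \<real>"
    using evK ev_v ev_a ev_y
  proof eventually_elim
    case (elim k)
    define s where "s = r k * \<rho> k"
    have s: "s > 0" using r(1)[of k] radii rho_pos[of k] by (simp add: s_def)
    define z where "z = x k + of_real s * (y - x k)"
    have lam: "\<Lambda> k \<noteq> 0" "\<Lambda>' k \<noteq> 0" using l_nz by (auto simp: \<Lambda>_def \<Lambda>'_def)
    have n1: "1 + of_real (r k) * v k \<noteq> 0" using nz1[OF elim(2) r(1)[of k]] by auto
    have xk: "x k * (a - c * q k) = d * q k - b" using elim(3) by (simp add: x_def)
    have cxd: "(c * x k + d) * (a - c * q k) = 1" "(a * x k + b) * (a - c * q k) = q k"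
    proof -
      have "(c * x k + d) * (a - c * q k) = c * (x k * (a - c * q k)) + d * (a - c * q k)"
        by (simp add: algebra_simps)
      also have "\<dots> = a * d - b * c" unfolding xk by (simp add: algebra_simps)
      finally show "(c * x k + d) * (a - c * q k) = 1" by (simp only: det1)
      have "(a * x k + b) * (a - c * q k) = a * (x k * (a - c * q k)) + b * (a - c * q k)"
        by (simp add: algebra_simps)
      also have "\<dots> = (a * d - b * c) * q k" unfolding xk by (simp add: algebra_simps)
      finally show "(a * x k + b) * (a - c * q k) = q k" by (simp only: det1 mult_1)
    qed
    have czd: "(c * z + d) * (a - c * q k) = 1 + of_real (r k) * v k"
    proof -
      have "(c * z + d) * (a - c * q k) = (c * x k + d) * (a - c * q k) + c * of_real s * (y - x k) * (a - c * q k)"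
        by (simp add: z_def algebra_simps)
      then show ?thesis by (simp add: cxd v_def s_def)
    qed
    have azb: "(a * z + b) * (a - c * q k) = q k + a * of_real s * (y - x k) * (a - c * q k)"
    proof -
      have "(a * z + b) * (a - c * q k) = (a * x k + b) * (a - c * q k) + a * of_real s * (y - x k) * (a - c * q k)"
        by (simp add: z_def algebra_simps)
      then show ?thesis by (simp add: cxd)
    qed
    have cz: "c * z + d \<noteq> 0" using czd n1 by auto
    have Pz: "P k (r k) / \<Lambda> k = (a * z + b) / (c * z + d)"
    proof -
      have "P k (r k) * (1 + of_real (r k) * v k) = \<alpha> * (1 + of_real (r k) * v k) + of_real (r k) * u k"
        unfolding P_def distrib_right[of \<alpha>] using n1 by simp
      then have "P k (r k) / \<Lambda> k * (1 + of_real (r k) * v k) = q k * (1 + of_real (r k) * v k) + of_real (r k) * u k / \<Lambda> k"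
        by (simp only: q_def times_divide_eq_left add_divide_distrib)
      also have "of_real (r k) * u k / \<Lambda> k = of_real s * (y - x k) * (a - c * q k)^2"
        using lam by (simp add: u_def s_def)
      also have "q k * (1 + of_real (r k) * v k) + \<dots> = (a * z + b) * (a - c * q k)"
        unfolding azb v_def s_def by (simp add: algebra_simps power2_eq_square)
      finally have "P k (r k) / \<Lambda> k * ((c * z + d) * (a - c * q k)) = (a * z + b) * (a - c * q k)"
        unfolding czd .
      then have "P k (r k) / \<Lambda> k * (c * z + d) = a * z + b"
        unfolding mult.assoc[symmetric] by (rule mult_right_cancel[OF elim(3), THEN iffD1])
      then show ?thesis using cz by (simp add: nonzero_eq_divide_eq)
    qed
    define Q where "Q = P k (r k) / \<Lambda> k"
    have aQ: "a - c * Q = 1 / (c * z + d)" "(d * Q - b) / (a - c * Q) = z"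
    proof -
      show 1: "a - c * Q = 1 / (c * z + d)"
        unfolding Q_def Pz using cz det1(1) by (simp add: field_simps)
      have Qz: "Q * (c * z + d) = a * z + b" unfolding Q_def Pz using cz by simp
      have "(d * Q - b) * (c * z + d) = d * (Q * (c * z + d)) - b * (c * z + d)"
        by (simp add: algebra_simps)
      also have "\<dots> = (a * d - b * c) * z" unfolding Qz by (simp add: algebra_simps)
      finally have "(d * Q - b) * (c * z + d) = z" by (simp only: det1 mult_1)
      then show "(d * Q - b) / (a - c * Q) = z" unfolding 1 by simp
    qed
    have zL: "z \<in> L" "a' - c' * Q' k \<noteq> 0" "F z = (d' * Q' k - b') / (a' - c' * Q' k)"
    proof -
      note ex = expanding_act[OF G(1) r(2)[OF elim(1)], of "n k", folded abcd \<Lambda>_def \<Lambda>'_def,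
          folded Q_def Q'_def]
      have "a - c * Q \<noteq> 0" unfolding aQ(1) using cz by simp
      from ex[OF this] show "z \<in> L" "a' - c' * Q' k \<noteq> 0" "F z = (d' * Q' k - b') / (a' - c' * Q' k)"
        unfolding aQ(2) by auto
    qed
    \<comment> \<open>The difference formula again, now in the target: \<open>F (P k (r k))\<close>
      and \<open>F \<alpha>\<close> are the images of \<open>F z\<close> and \<open>F (x k)\<close>
      under the target matrix.\<close>
    have Fdiff: "F (P k (r k)) - F \<alpha> = \<Lambda>' k * (F z - F (x k)) * (a' - c' * Q' k) * (a' - c' * q' k)"
    proof -
      have "(F z - F (x k)) * ((a' - c' * Q' k) * (a' - c' * q' k))
          = (d' * Q' k - b') * (a' - c' * q' k) - (d' * q' k - b') * (a' - c' * Q' k)"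
        unfolding zL(3) xL(2)[OF elim(3)] by (rule diff_quotients[OF zL(2) xL(3)[OF elim(3)]])
      also have "\<dots> = (a' * d' - b' * c') * (Q' k - q' k)" by (simp add: algebra_simps)
      also have "\<dots> = (F (P k (r k)) - F \<alpha>) / \<Lambda>' k" by (simp add: det1 Q'_def q'_def diff_divide_distrib)
      finally show ?thesis using lam by (simp add: field_simps)
    qed
    have "Im ((F y - F (x k)) * cnj (F z - F (x k))) = 0"
    proof (cases "z = y")
      case False
      have "z - x k = of_real s * (y - x k)" by (simp add: z_def)
      then have "Im ((y - x k) * cnj (z - x k)) = 0" by (simp only:) (simp add: algebra_simps)
      moreover have "distinct [x k, y, z]" using False elim(4) s by (auto simp: z_def)
      ultimately show ?thesis using collinear xL(1)[OF elim(3)] y(1) zL(1) by blast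
    qed (simp add: algebra_simps)
    then have "(F z - F (x k)) / (F y - F (x k)) \<in> \<real>" by (simp add: real_quotient_iff)
    then have "of_real (norm (\<Lambda>' k)) * ((F z - F (x k)) / (F y - F (x k))) \<in> \<real>"
      by (intro Reals_mult Reals_of_real)
    moreover have "(F (P k (r k)) - F \<alpha>) / (sgn (\<Lambda>' k) * (F y - F (x k)) * (a' - c' * Q' k) * (a' - c' * q' k))
       = of_real (norm (\<Lambda>' k)) * ((F z - F (x k)) / (F y - F (x k)))"
      unfolding Fdiff using lam zL(2) xL(3)[OF elim(3)] by (simp add: sgn_eq)
    ultimately show ?case by simp
  qed
  have "compact {r\<^sub>1..r\<^sub>2}" by simp
  then obtain r' g where g: "r' \<in> {r\<^sub>1..r\<^sub>2}" "strict_mono (g :: nat \<Rightarrow> nat)" "(r \<circ> g) \<longlonglongrightarrow> r'"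
    using r(1) unfolding compact_def by metis
  have g_at_top: "filterlim g at_top sequentially" by (rule filterlim_subseq[OF g(2)])
  have sub: "(\<lambda>k. h (g k)) \<longlonglongrightarrow> z" if "h \<longlonglongrightarrow> z" for h :: "nat \<Rightarrow> complex" and z
    using filterlim_compose[OF that g_at_top] .
  have evsub: "\<forall>\<^sub>F k in sequentially. R (g k)" if "\<forall>\<^sub>F k in sequentially. R k" for R
    using eventually_compose_filterlim[OF that g_at_top] .
  have Plim: "(\<lambda>k. P (g k) (r (g k))) \<longlonglongrightarrow> \<alpha> + of_real r' * e"
  proof -
    have "(\<lambda>k. P (g k) (r (g k))) \<longlonglongrightarrow> \<alpha> + of_real r' * e / (1 + of_real r' * 0)"
      unfolding P_def using g(3)
      by (intro tendsto_intros sub[OF u] sub[OF v]) (auto simp: o_def)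
    then show ?thesis by simp
  qed
  have evL: "\<forall>\<^sub>F k in sequentially. P (g k) (r (g k)) \<in> L"
    using evsub[OF evK] by eventually_elim (rule r(2))
  have pL: "\<alpha> + of_real r' * e \<in> L"
    by (rule Lim_in_closed_set[OF closed evL _ Plim]) simp
  have FP: "(\<lambda>k. F (P (g k) (r (g k)))) \<longlonglongrightarrow> F (\<alpha> + of_real r' * e)"
    by (rule continuous_on_tendsto_compose[OF cont Plim pL evL])
  have Q': "(\<lambda>k. Q' (g k)) \<longlonglongrightarrow> 0"
    unfolding Q'_def by (intro tendsto_divide_0[OF FP] filterlim_compose[OF lim_l(2) g_at_top])
  have Fyw: "F y - F w \<noteq> 0" using y w(2) inj nz by (auto dest: inj_onD)
  have "(\<lambda>k. (F (P (g k) (r (g k))) - F \<alpha>) / (sgn (\<Lambda>' (g k)) * (F y - F (x (g k))) *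
       (a' - c' * Q' (g k)) * (a' - c' * q' (g k))))
     \<longlonglongrightarrow> (F (\<alpha> + of_real r' * e) - F \<alpha>) / (1 * (F y - F w) * (a' - c' * 0) * (a' - c' * 0))"
    unfolding sgn_lam using nz Fyw
    by (intro tendsto_intros FP sub[OF n(3)] sub[OF Fx] Q' sub[OF q(2)]) auto
  then have "(F (\<alpha> + of_real r' * e) - F \<alpha>) / (1 * (F y - F w) * (a' - c' * 0) * (a' - c' * 0)) \<in> \<real>"
    by (rule Lim_in_closed_set[OF closed_complex_Reals evsub[OF real] sequentially_bot])
  then show thesis using that g(1) pL
    by (simp add: e_def abcd power2_eq_square mult_ac)
qed

end

section \<open>Real polynomials in matrix entries and Zariski density\<close>

definition cpoly :: "('a::real_normed_vector \<Rightarrow> complex) \<Rightarrow> bool"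
  where "cpoly f \<longleftrightarrow> real_polynomial_function (\<lambda>x. Re (f x)) \<and> real_polynomial_function (\<lambda>x. Im (f x))"

lemmas rpf_linear = real_polynomial_function.intros(1)
  and rpf_const = real_polynomial_function.intros(2)
  and rpf_add = real_polynomial_function.intros(3)
  and rpf_mult = real_polynomial_function.intros(4)

lemma cpoly_const [intro, simp]: "cpoly (\<lambda>x. c)"
  by (auto simp: cpoly_def)

lemma cpoly_linear: "bounded_linear f \<Longrightarrow> cpoly f"
  using bounded_linear_compose[OF bounded_linear_Re] bounded_linear_compose[OF bounded_linear_Im]
  by (auto simp: cpoly_def o_def intro!: rpf_linear)

lemma cpoly_id [intro, simp]: "cpoly (\<lambda>x::complex. x)"
  by (rule cpoly_linear) (rule bounded_linear_ident)

lemma cpoly_nth [intro, simp]: "cpoly (\<lambda>A::complex^2^2. A $ i $ j)"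
  by (rule cpoly_linear) (intro bounded_linear_compose[OF bounded_linear_vec_nth bounded_linear_vec_nth, unfolded o_def])

lemma cpoly_add [intro]: "cpoly f \<Longrightarrow> cpoly g \<Longrightarrow> cpoly (\<lambda>x. f x + g x)"
  unfolding cpoly_def plus_complex.sel by (intro conjI rpf_add) auto

lemma cpoly_diff [intro]: "cpoly f \<Longrightarrow> cpoly g \<Longrightarrow> cpoly (\<lambda>x. f x - g x)"
  unfolding cpoly_def minus_complex.sel by (intro conjI real_polynomial_function_diff) auto

lemma cpoly_minus [intro]: "cpoly f \<Longrightarrow> cpoly (\<lambda>x. - f x)"
  unfolding cpoly_def uminus_complex.sel by (intro conjI real_polynomial_function_minus) auto

lemma cpoly_mult [intro]: "cpoly f \<Longrightarrow> cpoly g \<Longrightarrow> cpoly (\<lambda>x. f x * g x)"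
  unfolding cpoly_def times_complex.sel
  by (intro conjI real_polynomial_function_diff rpf_add rpf_mult) auto

lemma cpoly_cnj [intro]: "cpoly f \<Longrightarrow> cpoly (\<lambda>x. cnj (f x))"
  unfolding cpoly_def cnj.sel by (intro conjI real_polynomial_function_minus) auto

lemma cpoly_power [intro]: "cpoly f \<Longrightarrow> cpoly (\<lambda>x. f x ^ n)"
  by (induction n) auto

lemma cpoly_Im: "cpoly f \<Longrightarrow> real_polynomial_function (\<lambda>x. Im (f x))"
  and cpoly_Re: "cpoly f \<Longrightarrow> real_polynomial_function (\<lambda>x. Re (f x))"
  by (auto simp: cpoly_def)

lemma poly_norm_power:
  assumes "cpoly f" shows "real_polynomial_function (\<lambda>x. norm (f x) ^ (2 * n))"
proof -
  have "real_polynomial_function (\<lambda>x. (Re (f x) ^ 2 + Im (f x) ^ 2) ^ n)"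
    by (intro real_polynomial_function_power rpf_add cpoly_Re cpoly_Im assms)
  then show ?thesis by (simp only: power_mult cmod_power2)
qed

text \<open>Density is tested by polynomials on matrices rather than on elements of the quotient
  group, so that expressions such as a single entry, which change sign with the lift, can be
  used.\<close>

definition zariski_generic :: "(complex^2^2) set \<Rightarrow> bool"
  where "zariski_generic M \<longleftrightarrow>
    (\<forall>p. real_polynomial_function p \<and> (\<forall>A\<in>M. p A = 0) \<longrightarrow> (\<forall>A. det A = 1 \<longrightarrow> p A = 0))"

text \<open>With \<open>a\<close>, \<open>b\<close> the first row, a polynomial in the real and
  imaginary parts of \<open>- b / a\<close> becomes a polynomial in the matrix entries once a power
  of \<open>a * cnj a\<close> clears the denominators; the basic case is
  \<open>a * cnj a * (- b / a) = - b * cnj a\<close>. Two summands are brought to the same degree by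
  further powers of the norm.\<close>

lemma homogenize:
  fixes p :: "complex \<Rightarrow> real"
  assumes "real_polynomial_function p"
  shows "\<exists>N q. real_polynomial_function q \<and>
    (\<forall>A :: complex^2^2. A$1$1 \<noteq> 0 \<longrightarrow> q A = norm (A$1$1) ^ (2 * N) * p (- A$1$2 / A$1$1))"
  using assms
proof (induction rule: real_polynomial_function.induct)
  case (linear f)
  interpret bounded_linear f by fact
  define h where "h = (\<lambda>A :: complex^2^2. - A$1$2 * cnj (A$1$1))"
  have f: "f z = Re z * f 1 + Im z * f \<i>" for z

  proof -
    have "z = Re z *\<^sub>R 1 + Im z *\<^sub>R \<i>" by (simp add: complex_eq_iff)
    then have "f z = f (Re z *\<^sub>R 1 + Im z *\<^sub>R \<i>)" by simp
    then show ?thesis by (simp only: add scaleR real_scaleR_def)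
  qed
  have "cpoly h" unfolding h_def by (intro cpoly_minus cpoly_mult cpoly_cnj cpoly_nth)
  then have "real_polynomial_function (\<lambda>A. f (h A))"
    unfolding f[of "h _"]
    by (intro rpf_add rpf_mult rpf_const cpoly_Re cpoly_Im)
  moreover have "f (h A) = norm (A$1$1) ^ (2 * 1) * f (- A$1$2 / A$1$1)" if "A$1$1 \<noteq> 0" for A :: "complex^2^2"
  proof -
    have "h A = (norm (A$1$1))\<^sup>2 *\<^sub>R (- A$1$2 / A$1$1)"
      using that complex_norm_square[of "A$1$1"] by (simp add: h_def scaleR_conv_of_real field_simps)
    then show ?thesis by (simp only: scaleR real_scaleR_def mult_1_right)
  qed
  ultimately show ?case by blast
next
  case (const c)
  have "real_polynomial_function (\<lambda>A :: complex^2^2. c)" by auto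
  then show ?case by (intro exI[of _ 0] exI[of _ "\<lambda>A. c"]) simp
next
  case (add f g)
  from add.IH(1) obtain N1 q1 where q1: "real_polynomial_function q1"
    "\<forall>A :: complex^2^2. A$1$1 \<noteq> 0 \<longrightarrow> q1 A = norm (A$1$1) ^ (2 * N1) * f (- A$1$2 / A$1$1)"
    by blast
  from add.IH(2) obtain N2 q2 where q2: "real_polynomial_function q2"
    "\<forall>A :: complex^2^2. A$1$1 \<noteq> 0 \<longrightarrow> q2 A = norm (A$1$1) ^ (2 * N2) * g (- A$1$2 / A$1$1)"
    by blast
  note 1 = q1(1) q2(1) q1(2)[rule_format] q2(2)[rule_format]
  have "norm (A$1$1) ^ (2 * N2) * q1 A + norm (A$1$1) ^ (2 * N1) * q2 A =
      norm (A$1$1) ^ (2 * (N1 + N2)) * (f (- A$1$2 / A$1$1) + g (- A$1$2 / A$1$1))" if "A$1$1 \<noteq> 0" for A :: "complex^2^2"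
    unfolding 1(3)[OF that] 1(4)[OF that] distrib_left power_add by (simp only: mult_ac)
  moreover have "real_polynomial_function (\<lambda>A :: complex^2^2. norm (A$1$1) ^ (2 * N2) * q1 A + norm (A$1$1) ^ (2 * N1) * q2 A)"
    by (intro rpf_add rpf_mult poly_norm_power cpoly_nth 1)
  ultimately show ?case by blast
next
  case (mult f g)
  from mult.IH(1) obtain N1 q1 where q1: "real_polynomial_function q1"
    "\<forall>A :: complex^2^2. A$1$1 \<noteq> 0 \<longrightarrow> q1 A = norm (A$1$1) ^ (2 * N1) * f (- A$1$2 / A$1$1)"
    by blast
  from mult.IH(2) obtain N2 q2 where q2: "real_polynomial_function q2"
    "\<forall>A :: complex^2^2. A$1$1 \<noteq> 0 \<longrightarrow> q2 A = norm (A$1$1) ^ (2 * N2) * g (- A$1$2 / A$1$1)"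
    by blast
  note 1 = q1(1) q2(1) q1(2)[rule_format] q2(2)[rule_format]
  have "q1 A * q2 A = norm (A$1$1) ^ (2 * (N1 + N2)) * (f (- A$1$2 / A$1$1) * g (- A$1$2 / A$1$1))"
    if "A$1$1 \<noteq> 0" for A :: "complex^2^2"
    unfolding 1(3)[OF that] 1(4)[OF that] distrib_left power_add by (simp only: mult_ac)
  moreover have "real_polynomial_function (\<lambda>A. q1 A * q2 A)"
    by (intro rpf_mult 1)
  ultimately show ?case by blast
qed

lemma zariski_generic_orbit:
  assumes "zariski_generic M" "real_polynomial_function p"
    "\<And>A. A \<in> M \<Longrightarrow> A$1$1 \<noteq> 0 \<Longrightarrow> p (- A$1$2 / A$1$1) = 0"
  shows "p z = 0"
proof -
  obtain N q where q: "real_polynomial_function q"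
    "\<And>A :: complex^2^2. A$1$1 \<noteq> 0 \<Longrightarrow> q A = norm (A$1$1) ^ (2 * N) * p (- A$1$2 / A$1$1)"
    using homogenize[OF assms(2)] by blast
  \<comment> \<open>The extra factor makes the polynomial vanish also at matrices with upper left
    entry 0, about which the hypothesis says nothing.\<close>
  define q' where "q' A = norm (A$1$1) ^ (2 * 1) * q A" for A :: "complex^2^2"
  have "real_polynomial_function q'" unfolding q'_def
    by (rule rpf_mult[OF poly_norm_power q(1)]) (rule cpoly_nth)
  moreover have "\<forall>A\<in>M. q' A = 0"
  proof
    fix A assume "A \<in> M"
    then show "q' A = 0" using q(2)[of A] assms(3)[of A] by (cases "A$1$1 = 0") (auto simp: q'_def)
  qed
  \<comment> \<open>This translation sends \<open>z\<close> to 0, so testing at it evaluates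
    \<open>p\<close> at an arbitrary \<open>z\<close>.\<close>
  moreover have "det (mat2 1 (- z) 0 1) = 1" by (simp add: det_2)
  ultimately have "q' (mat2 1 (- z) 0 1) = 0" using assms(1) unfolding zariski_generic_def by blast
  then show ?thesis using q(2)[of "mat2 1 (- z) 0 1"] by (simp add: q'_def)
qed

lemma sgn_square_eq:
  fixes z w :: complex
  assumes "z / w \<in> \<real>" "z \<noteq> 0" "w \<noteq> 0"
  shows "sgn z ^ 2 = sgn w ^ 2"
proof -
  obtain r where r: "z / w = of_real r" using assms(1) by (rule Reals_cases)
  then have z: "z = of_real r * w" using assms(3) by (simp add: field_simps)
  then have "r \<noteq> 0" using assms(2) by auto
  then have "sgn r = 1 \<or> sgn r = - 1" by (auto simp: sgn_if)
  then have "(of_real (sgn r) :: complex) ^ 2 = 1" by auto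
  moreover have "sgn z = of_real (sgn r) * sgn w" unfolding z sgn_mult sgn_of_real ..
  ultimately show ?thesis by (simp add: power_mult_distrib)
qed

section \<open>The closed group of direction pairs in the torus\<close>

context plane_conjugacy
begin

lemma generic: "zariski_generic (fst ` G)" "zariski_generic (snd ` G)"
proof -
  show "zariski_generic (fst ` G)" unfolding zariski_generic_def
  proof (intro allI impI, elim conjE)
    fix p and A :: "complex^2^2" assume p: "real_polynomial_function p" "\<forall>A\<in>fst ` G. p A = 0" "det A = (1 :: complex)"
    show "p A = 0" by (rule dense_fst[OF p(1) _ p(3)]) (metis p(2) fst_conv imageI)
  qed
  show "zariski_generic (snd ` G)" unfolding zariski_generic_def
  proof (intro allI impI, elim conjE)
    fix p and A :: "complex^2^2" assume p: "real_polynomial_function p" "\<forall>A\<in>snd ` G. p A = 0" "det A = (1 :: complex)"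
    show "p A = 0" by (rule dense_snd[OF p(1) _ p(3)]) (metis p(2) snd_conv imageI)
  qed
qed

text \<open>In \<open>direction_quotient\<close>, \<open>A$1$1^2\<close> turns the source direction
  and \<open>B$1$1^2\<close> the target direction; \<open>S\<close> records these two
  rotations.\<close>

definition S where "S = {(sgn (A$1$1^2), sgn (B$1$1^2)) |A B. (A, B) \<in> G \<and> A$1$1 \<noteq> 0}"

definition H where "H = closure S"

lemma S_norm: "S \<subseteq> sphere 0 1 \<times> sphere 0 1"
  using pole(2) by (auto simp: S_def norm_sgn)

lemma H_norm: assumes "(u, v) \<in> H" shows "norm u = 1" "norm v = 1"
proof -
  have "H \<subseteq> sphere 0 1 \<times> sphere 0 1"
    unfolding H_def using S_norm by (intro closure_minimal closed_Times) auto
  then show "norm u = 1" "norm v = 1" using assms by auto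
qed

lemma compact_H: "compact H"
proof -
  have "bounded S" using S_norm by (rule bounded_subset[rotated]) (intro bounded_Times; simp)
  then show ?thesis unfolding H_def by (simp add: compact_closure)
qed

text \<open>The upper left entry of \<open>A1 D^n A\<close> is \<open>l^n\<close> times the product
  of the upper left entries, up to a relative error of order \<open>l^(-2*n)\<close>. Along
  recurrent exponents the direction of its square therefore tends to the product of the directions,
  while the preimage of 0 tends to that of \<open>A\<close>.\<close>

lemma product_approx:
  assumes "(A1, B1) \<in> G" "A1$1$1 \<noteq> 0" "(A, B) \<in> G" "A$1$1 \<noteq> 0" "\<epsilon> > 0"
  obtains X Y where "(X, Y) \<in> G" "X$1$1 \<noteq> 0" "norm (- X$1$2 / X$1$1 - (- A$1$2 / A$1$1)) < \<epsilon>"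
    "norm (sgn (X$1$1^2) - sgn (A1$1$1^2) * sgn (A$1$1^2)) < \<epsilon>"
    "norm (sgn (Y$1$1^2) - sgn (B1$1$1^2) * sgn (B$1$1^2)) < \<epsilon>"
proof -
  have nzB: "B1$1$1 \<noteq> 0" "B$1$1 \<noteq> 0" using pole(2) assms by blast+
  obtain n :: "nat \<Rightarrow> nat" where n: "filterlim n at_top sequentially"
    "(\<lambda>k. sgn (l^2) ^ n k) \<longlonglongrightarrow> 1" "(\<lambda>k. sgn (l'^2) ^ n k) \<longlonglongrightarrow> 1"
    using simultaneous_recurrence_seq[of "sgn (l^2)" "sgn (l'^2)"] l_nz by (auto simp: norm_sgn)
  define X Y where "X k = (A1 ** mat2 (l ^ n k) 0 0 (1 / l ^ n k)) ** A"
    and "Y k = (B1 ** mat2 (l' ^ n k) 0 0 (1 / l' ^ n k)) ** B" for k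
  have XY: "(X k, Y k) \<in> G" for k unfolding X_def Y_def by (intro mult diag_power assms)
  have small: "(\<lambda>k. 1 / x ^ (2 * n k)) \<longlonglongrightarrow> 0" if "norm x > 1" for x :: complex
  proof -
    have "norm (x^2) > 1" using that by (simp add: norm_power one_less_power)
    then show ?thesis unfolding power_mult
      by (intro tendsto_divide_0[OF tendsto_const] filterlim_compose[OF filterlim_realpow_sequentially_gt1 n(1)])
  qed
  have eqn0: "(U ** mat2 x 0 0 (1 / x)) ** V =
     mat2 (x * (U$1$1 * V$1$1 + U$1$2 * V$2$1 * (1 / (x * x))))
          (x * (U$1$1 * V$1$2 + U$1$2 * V$2$2 * (1 / (x * x))))
          (x * (U$2$1 * V$1$1 + U$2$2 * V$2$1 * (1 / (x * x))))
          (x * (U$2$1 * V$1$2 + U$2$2 * V$2$2 * (1 / (x * x))))"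
    if "x \<noteq> 0" for U V :: "complex^2^2" and x :: complex
    using that by (simp add: mat2_eq_iff mult2_nth field_simps)
  have eqn: "(U ** mat2 (x ^ m) 0 0 (1 / x ^ m)) ** V =
     mat2 (x ^ m * (U$1$1 * V$1$1 + U$1$2 * V$2$1 * (1 / x ^ (2 * m))))
          (x ^ m * (U$1$1 * V$1$2 + U$1$2 * V$2$2 * (1 / x ^ (2 * m))))
          (x ^ m * (U$2$1 * V$1$1 + U$2$2 * V$2$1 * (1 / x ^ (2 * m))))
          (x ^ m * (U$2$1 * V$1$2 + U$2$2 * V$2$2 * (1 / x ^ (2 * m))))"
    if "x \<noteq> 0" for U V :: "complex^2^2" and x :: complex and m
    using that unfolding mult_2 power_add by (intro eqn0) simp
  have lim: "(\<lambda>k. U$i$j * V$p$q + U$r$s * V$t$u * (1 / x ^ (2 * n k))) \<longlonglongrightarrow> U$i$j * V$p$q"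
    if "norm x > 1" for U V :: "complex^2^2" and x :: complex and i j p q r s t u
    using tendsto_add[OF tendsto_const tendsto_mult[OF tendsto_const small[OF that]]] by force
  have sg: "(\<lambda>k. sgn ((x ^ n k * h k)^2)) \<longlonglongrightarrow> sgn (z^2)"
    if "(\<lambda>k. sgn (x^2) ^ n k) \<longlonglongrightarrow> 1" "h \<longlonglongrightarrow> z" "z \<noteq> 0" for x z :: complex and h
  proof -
    have "sgn ((x ^ n k * h k)^2) = sgn (x^2) ^ n k * sgn (h k ^ 2)" for k
      by (simp add: power_mult_distrib sgn_mult sgn_complex_power flip: power_mult) (simp add: mult.commute)
    moreover have "(\<lambda>k. sgn (x^2) ^ n k * sgn (h k ^ 2)) \<longlonglongrightarrow> 1 * sgn (z^2)"
      by (intro tendsto_intros that) (use that in auto)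
    ultimately show ?thesis by simp
  qed
  have X11: "X k$1$1 = l ^ n k * (A1$1$1 * A$1$1 + A1$1$2 * A$2$1 * (1 / l ^ (2 * n k)))"
    and X12: "X k$1$2 = l ^ n k * (A1$1$1 * A$1$2 + A1$1$2 * A$2$2 * (1 / l ^ (2 * n k)))"
    and Y11: "Y k$1$1 = l' ^ n k * (B1$1$1 * B$1$1 + B1$1$2 * B$2$1 * (1 / l' ^ (2 * n k)))" for k
    unfolding X_def Y_def eqn[OF l_nz(1)] eqn[OF l_nz(2)] by simp_all
  have 1: "(\<lambda>k. sgn (X k$1$1^2)) \<longlonglongrightarrow> sgn ((A1$1$1 * A$1$1)^2)"
    unfolding X11 using assms by (intro sg n lim diag) auto
  have 2: "(\<lambda>k. sgn (Y k$1$1^2)) \<longlonglongrightarrow> sgn ((B1$1$1 * B$1$1)^2)"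
    unfolding Y11 using nzB by (intro sg n lim norm_l'_gt_1) auto
  have 3: "(\<lambda>k. - X k$1$2 / X k$1$1) \<longlonglongrightarrow> - A$1$2 / A$1$1"
  proof -
    have "- X k$1$2 / X k$1$1 = - (A1$1$1 * A$1$2 + A1$1$2 * A$2$2 * (1 / l ^ (2 * n k))) /
      (A1$1$1 * A$1$1 + A1$1$2 * A$2$1 * (1 / l ^ (2 * n k)))" for k
      unfolding X11 X12 mult_minus_right[symmetric] by (rule mult_divide_mult_cancel_left) (simp add: l_nz)
    moreover have "(\<lambda>k. - (A1$1$1 * A$1$2 + A1$1$2 * A$2$2 * (1 / l ^ (2 * n k))) /
      (A1$1$1 * A$1$1 + A1$1$2 * A$2$1 * (1 / l ^ (2 * n k)))) \<longlonglongrightarrow> - (A1$1$1 * A$1$2) / (A1$1$1 * A$1$1)"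
      using assms by (intro tendsto_intros lim diag) auto
    ultimately show ?thesis using assms(2) by simp
  qed
  have 4: "\<forall>\<^sub>F k in sequentially. X k$1$1 \<noteq> 0"
  proof -
    have "\<forall>\<^sub>F k in sequentially. A1$1$1 * A$1$1 + A1$1$2 * A$2$1 * (1 / l ^ (2 * n k)) \<noteq> 0"
      using assms by (intro tendsto_imp_eventually_ne[OF lim]) (auto intro: diag)
    then show ?thesis by eventually_elim (use l_nz X11 in auto)
  qed
  have "\<forall>\<^sub>F k in sequentially. X k$1$1 \<noteq> 0 \<and> dist (sgn (X k$1$1^2)) (sgn ((A1$1$1 * A$1$1)^2)) < \<epsilon> \<and>
      dist (sgn (Y k$1$1^2)) (sgn ((B1$1$1 * B$1$1)^2)) < \<epsilon> \<and> dist (- X k$1$2 / X k$1$1) (- A$1$2 / A$1$1) < \<epsilon>"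
    by (intro eventually_conj 4 tendstoD[OF 1] tendstoD[OF 2] tendstoD[OF 3] assms)
  then obtain k where "X k$1$1 \<noteq> 0" "dist (sgn (X k$1$1^2)) (sgn ((A1$1$1 * A$1$1)^2)) < \<epsilon>"
      "dist (sgn (Y k$1$1^2)) (sgn ((B1$1$1 * B$1$1)^2)) < \<epsilon>" "dist (- X k$1$2 / X k$1$1) (- A$1$2 / A$1$1) < \<epsilon>"
    by (auto simp: eventually_sequentially)
  then show thesis using that[OF XY[of k]] by (simp add: dist_norm sgn_mult power_mult_distrib)
qed

lemma H_approx:
  assumes "(u, v) \<in> H" "(A, B) \<in> G" "A$1$1 \<noteq> 0" "\<epsilon> > 0"
  obtains X Y where "(X, Y) \<in> G" "X$1$1 \<noteq> 0" "norm (- X$1$2 / X$1$1 - (- A$1$2 / A$1$1)) < \<epsilon>"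
    "norm (sgn (X$1$1^2) - u * sgn (A$1$1^2)) < \<epsilon>"
    "norm (sgn (Y$1$1^2) - v * sgn (B$1$1^2)) < \<epsilon>"
proof -
  have "B$1$1 \<noteq> 0" using pole(2) assms by blast
  obtain s where "s \<in> S" "dist s (u, v) < \<epsilon> / 2"
    using assms unfolding H_def closure_approachable by (meson half_gt_zero)
  then obtain A1 B1 where AB1: "(A1, B1) \<in> G" "A1$1$1 \<noteq> 0" "dist (sgn (A1$1$1^2), sgn (B1$1$1^2)) (u, v) < \<epsilon> / 2"
    unfolding S_def by auto
  have d1: "norm (sgn (A1$1$1^2) - u) < \<epsilon> / 2" "norm (sgn (B1$1$1^2) - v) < \<epsilon> / 2"
    using le_less_trans[OF dist_fst_le AB1(3)] le_less_trans[OF dist_snd_le AB1(3)] by (simp_all add: dist_norm)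
  have half: "\<epsilon> / 2 > 0" using assms by simp
  obtain X Y where XY: "(X, Y) \<in> G" "X$1$1 \<noteq> 0" "norm (- X$1$2 / X$1$1 - (- A$1$2 / A$1$1)) < \<epsilon> / 2"
    "norm (sgn (X$1$1^2) - sgn (A1$1$1^2) * sgn (A$1$1^2)) < \<epsilon> / 2"
    "norm (sgn (Y$1$1^2) - sgn (B1$1$1^2) * sgn (B$1$1^2)) < \<epsilon> / 2"
    by (rule product_approx[OF AB1(1,2) assms(2,3) half])
  have *: "norm (x - u * s) < \<epsilon>" if "norm (x - y * s) < \<epsilon> / 2" "norm (y - u) < \<epsilon> / 2" "norm s = 1" for x y s u :: complex
  proof -
    have "x - u * s = (x - y * s) + (y - u) * s" by (simp add: algebra_simps)
    then have "norm (x - u * s) \<le> norm (x - y * s) + norm (y - u) * norm s"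
      by (metis norm_triangle_ineq norm_mult)
    then show ?thesis using that by simp
  qed
  show thesis
    by (rule that[OF XY(1,2)]; (rule *[OF XY(4) d1(1)] *[OF XY(5) d1(2)])?)
      (use XY(3) assms \<open>B$1$1 \<noteq> 0\<close> in \<open>auto simp: norm_sgn\<close>)
qed

lemma H_mult:
  assumes "(u, v) \<in> H" "(u', v') \<in> H" shows "(u * u', v * v') \<in> H"
  unfolding H_def closure_approachable
proof (intro allI impI)
  fix \<epsilon> :: real assume "\<epsilon> > 0"
  then have e4: "\<epsilon> / 4 > 0" by simp
  have nu: "norm u = 1" "norm v = 1" using H_norm assms by auto
  obtain s where "s \<in> S" "dist s (u', v') < \<epsilon> / 4"
    using assms e4 unfolding H_def closure_approachable by meson
  then obtain A B where AB: "(A, B) \<in> G" "A$1$1 \<noteq> 0" "dist (sgn (A$1$1^2), sgn (B$1$1^2)) (u', v') < \<epsilon> / 4"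
    unfolding S_def by auto
  have d1: "norm (sgn (A$1$1^2) - u') < \<epsilon> / 4" "norm (sgn (B$1$1^2) - v') < \<epsilon> / 4"
    using le_less_trans[OF dist_fst_le AB(3)] le_less_trans[OF dist_snd_le AB(3)] by (simp_all add: dist_norm)
  obtain X Y where XY: "(X, Y) \<in> G" "X$1$1 \<noteq> 0" "norm (sgn (X$1$1^2) - u * sgn (A$1$1^2)) < \<epsilon> / 4"
    "norm (sgn (Y$1$1^2) - v * sgn (B$1$1^2)) < \<epsilon> / 4"
    by (rule H_approx[OF assms(1) AB(1,2) e4])
  have *: "norm (x - u * u') < \<epsilon> / 2" if "norm (x - u * y) < \<epsilon> / 4" "norm (y - u') < \<epsilon> / 4" "norm u = 1" for x y u u' :: complex
  proof -
    have "x - u * u' = (x - u * y) + u * (y - u')" by (simp add: algebra_simps)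
    then have "norm (x - u * u') \<le> norm (x - u * y) + norm u * norm (y - u')"
      by (metis norm_triangle_ineq norm_mult)
    then show ?thesis using that by simp
  qed
  have "dist (sgn (X$1$1^2), sgn (Y$1$1^2)) (u * u', v * v') \<le> norm (sgn (X$1$1^2) - u * u') + norm (sgn (Y$1$1^2) - v * v')"
    unfolding dist_Pair_Pair dist_norm[symmetric] by (intro sqrt_sum_squares_le_sum zero_le_dist)
  also have "\<dots> < \<epsilon>" using *[OF XY(3) d1(1) nu(1)] *[OF XY(4) d1(2) nu(2)] by simp
  finally show "\<exists>y\<in>S. dist y (u * u', v * v') < \<epsilon>" using XY(1,2) unfolding S_def by blast
qed

lemma H_closed: "closed H" by (simp add: H_def)

lemma H_power: assumes "(u, v) \<in> H" shows "(u ^ Suc n, v ^ Suc n) \<in> H"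
  by (induction n) (use assms H_mult in auto)

text \<open>In a compact group a closed subsemigroup contains inverses: \<open>u^(n-1)\<close> tends
  to \<open>inverse u\<close> along recurrent exponents \<open>n\<close>.\<close>

lemma H_inverse: assumes "(u, v) \<in> H" shows "(inverse u, inverse v) \<in> H"
proof -
  have nu: "norm u = 1" "norm v = 1" using H_norm assms by auto
  obtain n :: "nat \<Rightarrow> nat" where n: "filterlim n at_top sequentially"
    "(\<lambda>k. u ^ n k) \<longlonglongrightarrow> 1" "(\<lambda>k. v ^ n k) \<longlonglongrightarrow> 1"
    using simultaneous_recurrence_seq[OF nu] by blast
  \<comment> \<open>Only positive powers are known to lie in \<open>H\<close>, so
    \<open>n k - 1\<close> has to be positive.\<close>
  have ev: "\<forall>\<^sub>F k in sequentially. n k \<ge> 2" using n(1) by (simp add: filterlim_at_top)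
  have nz: "u \<noteq> 0" "v \<noteq> 0" using nu by auto
  have "\<forall>\<^sub>F k in sequentially. (u ^ n k * inverse u, v ^ n k * inverse v) \<in> H"
    using ev
  proof eventually_elim
    case (elim k)
    then obtain m where "n k = Suc (Suc m)" by (metis Suc_le_D numeral_2_eq_2 Suc_le_mono)
    then have "u ^ n k * inverse u = u ^ Suc m" "v ^ n k * inverse v = v ^ Suc m"
      using nz by (simp_all add: field_simps)
    then show ?case using H_power[OF assms, of m] by simp
  qed
  moreover have "(\<lambda>k. (u ^ n k * inverse u, v ^ n k * inverse v)) \<longlonglongrightarrow> (1 * inverse u, 1 * inverse v)"
    by (intro tendsto_intros n)
  ultimately show ?thesis using Lim_in_closed_set[OF H_closed] by fastforce
qed

text \<open>A proper closed subsemigroup would consist of \<open>N\<close>-th roots of unity; then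
  \<open>A$1$1^(2*N)\<close> would be real on the group, a polynomial identity that Zariski density
  extends to all of SL2.\<close>

lemma H_fst: assumes "norm u = 1" obtains v where "(u, v) \<in> H"
proof -
  define Q where "Q = fst ` H"
  have "closed Q" unfolding Q_def
    by (intro compact_imp_closed compact_continuous_image compact_H continuous_intros)
  moreover have "Q \<subseteq> sphere 0 1" using H_norm by (auto simp: Q_def)
  moreover have "x * y \<in> Q" if "x \<in> Q" "y \<in> Q" for x y
    using that H_mult unfolding Q_def by force
  ultimately have *: "\<exists>N>0. \<forall>q\<in>Q. q ^ N = 1" if "Q \<noteq> sphere 0 1"
    using closed_subsemigroup_circle[of Q] that by metis
  have "Q = sphere 0 1"
  proof (rule ccontr)
    assume "Q \<noteq> sphere 0 1"
    then obtain N where N: "N > 0" "\<And>q. q \<in> Q \<Longrightarrow> q ^ N = 1" using * by blast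
    have "Im (A$1$1 ^ (2 * N)) = 0" if "(A, B) \<in> G" for A B
    proof (cases "A$1$1 = 0")
      case False
      then have "(sgn (A$1$1^2), sgn (B$1$1^2)) \<in> H"
        using that closure_subset[of S] unfolding H_def S_def by blast
      then have "sgn (A$1$1^2) ^ N = 1" using N(2) by (force simp: Q_def)
      then have "sgn (A$1$1 ^ (2 * N)) = 1" by (simp add: sgn_complex_power power_mult)
      then have "A$1$1 ^ (2 * N) = of_real (norm (A$1$1 ^ (2 * N)))"
        using False by (simp add: sgn_eq)
      then show ?thesis by (metis Im_complex_of_real)
    qed (use N in simp)
    moreover have "real_polynomial_function (\<lambda>A :: complex^2^2. Im (A$1$1 ^ (2 * N)))"
      by (intro cpoly_Im cpoly_power cpoly_nth)
    \<comment> \<open>Chosen so that \<open>z^(2*N) = \<i>\<close>, which is not real.\<close>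
    moreover define z where "z = cis (pi / (4 * N))"
    have "det (mat2 z 0 0 (1 / z)) = 1" by (simp add: det_2 z_def)
    ultimately have "Im (z ^ (2 * N)) = 0"
      using dense_fst[of "\<lambda>A. Im (A$1$1 ^ (2 * N))" "mat2 z 0 0 (1 / z)"] by simp
    moreover have "z ^ (2 * N) = cis (pi / 2)"
      using N(1) by (simp add: z_def Complex.DeMoivre field_simps)
    ultimately show False by simp
  qed
  then have "u \<in> fst ` H" using assms by (simp add: Q_def)
  then show thesis using that by force
qed

text \<open>Here the rotation pair is only a limit of actual ones, so the ray can be aimed exactly
  at \<open>e\<^sub>0\<close>. The rays of nearby elements stay robust with half the tolerance, and
  compactness of the interval of radii provides the limit point.\<close>

lemma direction_quotient_limit:
  assumes uv: "(u, v) \<in> H" and G: "(A, B) \<in> G" "A$1$1 \<noteq> 0"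
  defines "w \<equiv> - A$1$2 / A$1$1"
  assumes y: "y \<in> L" "y \<noteq> w" and e0_eq: "e\<^sub>0 = u * sgn (A$1$1^2) * sgn (y - w)"
  obtains r where "r > 0" "\<alpha> + of_real r * e\<^sub>0 \<in> L"
    "(F (\<alpha> + of_real r * e\<^sub>0) - F \<alpha>) / (v * sgn (B$1$1^2) * (F y - F w)) \<in> \<real>"
proof -
  have "\<exists>X Y. (X, Y) \<in> G \<and> X$1$1 \<noteq> 0 \<and> norm (- X$1$2 / X$1$1 - w) < inverse (Suc k) \<and>
    norm (sgn (X$1$1^2) - u * sgn (A$1$1^2)) < inverse (Suc k) \<and>
    norm (sgn (Y$1$1^2) - v * sgn (B$1$1^2)) < inverse (Suc k)" for k :: nat
    using H_approx[OF uv G, of "inverse (Suc k)"] unfolding w_def by (metis inverse_positive_iff_positive of_nat_0_less_iff zero_less_Suc)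
  then obtain X Y where XY: "\<And>k. (X k, Y k) \<in> G" "\<And>k. X k$1$1 \<noteq> 0"
    "\<And>k. norm (- X k$1$2 / X k$1$1 - w) < inverse (Suc k)"
    "\<And>k. norm (sgn (X k$1$1^2) - u * sgn (A$1$1^2)) < inverse (Suc k)"
    "\<And>k. norm (sgn (Y k$1$1^2) - v * sgn (B$1$1^2)) < inverse (Suc k)" by metis
  have lim: "h \<longlonglongrightarrow> c" if "\<And>k. norm (h k - c) < inverse (Suc k)" for h :: "nat \<Rightarrow> complex" and c
  proof -
    have "(\<lambda>k. h k - c) \<longlonglongrightarrow> 0"
      by (rule Lim_null_comparison[OF _ LIMSEQ_inverse_real_of_nat]) (use that in \<open>auto simp: less_imp_le\<close>)
    then show ?thesis by (simp add: LIM_zero_iff)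
  qed
  define w' where "w' k = - X k$1$2 / X k$1$1" for k
  have w': "w' \<longlonglongrightarrow> w" unfolding w'_def by (rule lim) (rule XY)
  have sX: "(\<lambda>k. sgn (X k$1$1^2)) \<longlonglongrightarrow> u * sgn (A$1$1^2)" by (rule lim) (rule XY)
  have sY: "(\<lambda>k. sgn (Y k$1$1^2)) \<longlonglongrightarrow> v * sgn (B$1$1^2)" by (rule lim) (rule XY)
  have wL: "w \<in> L" using pole[OF G] by (simp add: w_def)
  have w'L: "w' k \<in> L" for k using pole[OF XY(1,2)] by (simp add: w'_def)
  have Fw': "(\<lambda>k. F (w' k)) \<longlonglongrightarrow> F w"
    by (rule continuous_on_tendsto_compose[OF cont w' wL]) (use w'L in auto)
  define e where "e k = sgn (X k$1$1^2 * (y - w' k))" for k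
  have elim: "e \<longlonglongrightarrow> e\<^sub>0"
    unfolding e_def e0_eq sgn_mult using y by (intro tendsto_intros sX w') auto
  \<comment> \<open>Turning the direction by this much moves points up to radius
    \<open>r\<^sub>2\<close> by at most half of \<open>\<epsilon>\<^sub>0\<close>.\<close>
  have ev: "\<forall>\<^sub>F k in sequentially. norm (e k - e\<^sub>0) < \<epsilon>\<^sub>0 / (2 * r\<^sub>2) \<and> w' k \<noteq> y"
    using tendstoD[OF elim, of "\<epsilon>\<^sub>0 / (2 * r\<^sub>2)"] tendsto_imp_eventually_ne[OF w', of y] y eps radii
    by (auto simp: dist_norm eventually_conj_iff)
  have "\<forall>\<^sub>F k in sequentially. \<exists>r\<in>{r\<^sub>1..r\<^sub>2}. \<alpha> + of_real r * e k \<in> L \<and>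
    (F (\<alpha> + of_real r * e k) - F \<alpha>) / (sgn (Y k$1$1^2) * (F y - F (w' k))) \<in> \<real>"
    using ev
  proof eventually_elim
    case (elim k)
    have "robust_ray L \<alpha> r\<^sub>1 r\<^sub>2 (\<epsilon>\<^sub>0 / 2) (e k)"
      unfolding robust_ray_def
    proof (intro allI impI, elim conjE)
      fix Q assume Q: "continuous_on {r\<^sub>1..r\<^sub>2} Q" "\<forall>r\<in>{r\<^sub>1..r\<^sub>2}. norm (Q r - (\<alpha> + of_real r * e k)) < \<epsilon>\<^sub>0 / 2"
      have "norm (Q r - (\<alpha> + of_real r * e\<^sub>0)) < \<epsilon>\<^sub>0" if r: "r \<in> {r\<^sub>1..r\<^sub>2}" for r
      proof -
        have "norm (of_real r * (e k - e\<^sub>0)) \<le> r\<^sub>2 * (\<epsilon>\<^sub>0 / (2 * r\<^sub>2))"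
          unfolding norm_mult using r radii elim by (intro mult_mono) auto
        also have "\<dots> = \<epsilon>\<^sub>0 / 2" using radii by simp
        finally have "norm (of_real r * (e k - e\<^sub>0)) \<le> \<epsilon>\<^sub>0 / 2" .
        have "Q r - (\<alpha> + of_real r * e\<^sub>0) = (Q r - (\<alpha> + of_real r * e k)) + of_real r * (e k - e\<^sub>0)"
          by (simp add: algebra_simps)
        then have "norm (Q r - (\<alpha> + of_real r * e\<^sub>0)) \<le>
            norm (Q r - (\<alpha> + of_real r * e k)) + norm (of_real r * (e k - e\<^sub>0))"
          by (simp only: norm_triangle_ineq)
        moreover have "norm (Q r - (\<alpha> + of_real r * e k)) < \<epsilon>\<^sub>0 / 2" using Q(2) r by blast
        ultimately show ?thesis using \<open>norm (of_real r * (e k - e\<^sub>0)) \<le> \<epsilon>\<^sub>0 / 2\<close> by linarith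
      qed
      with Q(1) robust show "\<exists>r\<in>{r\<^sub>1..r\<^sub>2}. Q r \<in> L" unfolding robust_ray_def by blast
    qed
    then have "robust_ray L \<alpha> r\<^sub>1 r\<^sub>2 (\<epsilon>\<^sub>0 / 2) (sgn (X k$1$1^2 * (y - (- X k$1$2 / X k$1$1))))"
      by (simp add: e_def w'_def)
    moreover have "y \<noteq> - X k$1$2 / X k$1$1" "\<epsilon>\<^sub>0 / 2 > 0" using elim eps by (auto simp: w'_def)
    ultimately obtain r where r: "r \<in> {r\<^sub>1..r\<^sub>2}" "\<alpha> + of_real r * e k \<in> L"
      "(F (\<alpha> + of_real r * e k) - F \<alpha>) / (Y k$1$1^2 * (F y - F (w' k))) \<in> \<real>"
      using direction_quotient[OF XY(1,2) y(1)] unfolding e_def w'_def by metis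
    have nzY: "Y k$1$1 \<noteq> 0" using pole[OF XY(1,2)] by blast
    have "(F (\<alpha> + of_real r * e k) - F \<alpha>) / (sgn (Y k$1$1^2) * (F y - F (w' k))) =
      of_real (norm (Y k$1$1^2)) * ((F (\<alpha> + of_real r * e k) - F \<alpha>) / (Y k$1$1^2 * (F y - F (w' k))))"
      using nzY by (simp add: sgn_eq)
    also have "\<dots> \<in> \<real>" using r(3) by (intro Reals_mult Reals_of_real)
    finally show ?case using r by blast
  qed
  then obtain K where "\<And>k. k \<ge> K \<Longrightarrow> \<exists>r\<in>{r\<^sub>1..r\<^sub>2}. \<alpha> + of_real r * e k \<in> L \<and>
    (F (\<alpha> + of_real r * e k) - F \<alpha>) / (sgn (Y k$1$1^2) * (F y - F (w' k))) \<in> \<real>"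
    unfolding eventually_sequentially by blast
  then have "\<forall>k. \<exists>r. r \<in> {r\<^sub>1..r\<^sub>2} \<and> (\<alpha> + of_real r * e (k + K) \<in> L \<and>
    (F (\<alpha> + of_real r * e (k + K)) - F \<alpha>) / (sgn (Y (k + K)$1$1^2) * (F y - F (w' (k + K)))) \<in> \<real>)"
    by (meson le_add2)
  then obtain r where r: "\<And>k. r k \<in> {r\<^sub>1..r\<^sub>2}" "\<And>k. \<alpha> + of_real (r k) * e (k + K) \<in> L"
    "\<And>k. (F (\<alpha> + of_real (r k) * e (k + K)) - F \<alpha>) / (sgn (Y (k + K)$1$1^2) * (F y - F (w' (k + K)))) \<in> \<real>"
    by metis
  have "compact {r\<^sub>1..r\<^sub>2}" by simp
  then obtain r' g where g: "r' \<in> {r\<^sub>1..r\<^sub>2}" "strict_mono (g :: nat \<Rightarrow> nat)" "(r \<circ> g) \<longlonglongrightarrow> r'"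
    using r(1) unfolding compact_def by metis
  have g_at_top: "filterlim (\<lambda>k. g k + K) at_top sequentially"
    by (rule filterlim_compose[OF filterlim_add_const_nat_at_top filterlim_subseq[OF g(2)]])
  have sub: "(\<lambda>k. h (g k + K)) \<longlonglongrightarrow> z" if "h \<longlonglongrightarrow> z" for h :: "nat \<Rightarrow> complex" and z
    using filterlim_compose[OF that g_at_top] .
  have Plim: "(\<lambda>k. \<alpha> + of_real (r (g k)) * e (g k + K)) \<longlonglongrightarrow> \<alpha> + of_real r' * e\<^sub>0"
    using g(3) by (intro tendsto_intros sub[OF elim]) (auto simp: o_def)
  have pL: "\<alpha> + of_real r' * e\<^sub>0 \<in> L"
    by (rule Lim_in_closed_set[OF closed _ _ Plim]) (use r in auto)
  have FP: "(\<lambda>k. F (\<alpha> + of_real (r (g k)) * e (g k + K))) \<longlonglongrightarrow> F (\<alpha> + of_real r' * e\<^sub>0)"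
    by (rule continuous_on_tendsto_compose[OF cont Plim pL]) (use r in auto)
  have Fyw: "F y - F w \<noteq> 0" using y wL inj by (auto dest: inj_onD)
  have nzv: "v * sgn (B$1$1^2) \<noteq> 0"
    using H_norm(2)[OF uv] pole(2)[OF G] by (auto simp: sgn_zero_iff)
  have "(\<lambda>k. (F (\<alpha> + of_real (r (g k)) * e (g k + K)) - F \<alpha>) / (sgn (Y (g k + K)$1$1^2) * (F y - F (w' (g k + K)))))
    \<longlonglongrightarrow> (F (\<alpha> + of_real r' * e\<^sub>0) - F \<alpha>) / (v * sgn (B$1$1^2) * (F y - F w))"
    using nzv Fyw by (intro tendsto_intros FP sub[OF sY] sub[OF Fw']) auto
  then have "(F (\<alpha> + of_real r' * e\<^sub>0) - F \<alpha>) / (v * sgn (B$1$1^2) * (F y - F w)) \<in> \<real>"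
    by (rule Lim_in_closed_set[OF closed_complex_Reals always_eventually[OF allI] sequentially_bot, rotated]) (rule r(3))
  then show thesis using that[of r'] g(1) pL radii by auto
qed

end

lemma Im_i_of_real: "Im (\<i> * of_real x) = x"
  by simp

section \<open>The character of the circle and the law of directions\<close>

context plane_conjugacy
begin

lemma F_eq_iff: "x \<in> L \<Longrightarrow> y \<in> L \<Longrightarrow> F x = F y \<longleftrightarrow> x = y"
  using inj by (auto dest: inj_onD)

lemma ray_ratio:
  assumes "r > 0" "s > 0" "\<alpha> + of_real r * e\<^sub>0 \<in> L" "\<alpha> + of_real s * e\<^sub>0 \<in> L"
  shows "(F (\<alpha> + of_real s * e\<^sub>0) - F \<alpha>) / (F (\<alpha> + of_real r * e\<^sub>0) - F \<alpha>) \<in> \<real>"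
proof (cases "r = s")
  case False
  have "e\<^sub>0 \<noteq> 0" using e0 by auto
  then have "distinct [\<alpha>, \<alpha> + of_real r * e\<^sub>0, \<alpha> + of_real s * e\<^sub>0]" using assms False by auto
  moreover have "Im ((\<alpha> + of_real r * e\<^sub>0 - \<alpha>) * cnj (\<alpha> + of_real s * e\<^sub>0 - \<alpha>)) = 0"
    by (simp add: algebra_simps)
  ultimately show ?thesis using collinear[OF alpha assms(3,4)] by (simp only: real_quotient_iff)
qed (simp add: divide_self_if)

lemma identity_mem: "(mat2 1 0 0 1, mat2 1 0 0 1) \<in> G"
  using diag_power[of 0] by simp

text \<open>The pairs \<open>(u, v)\<close> and \<open>(u, s * v)\<close> give points of
  \<open>L\<close> on the same ray whose image differences point along \<open>v * F y\<close> and
  \<open>s * v * F y\<close> up to real factors. Points on one ray have collinear images, so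
  \<open>s\<close> is real, and it has norm 1.\<close>

lemma H_one_imp: assumes "(1, s) \<in> H" shows "s^2 = 1"
proof -
  obtain y where y: "y \<in> L" "y \<noteq> 0" by (rule nonzero_point)
  \<comment> \<open>With the identity matrix, for which \<open>w = 0\<close>, this rotation aims the
    ray at \<open>e\<^sub>0\<close>.\<close>
  have "norm (e\<^sub>0 / sgn y) = 1" using y e0 by (simp add: norm_divide norm_sgn)
  then obtain v where v: "(e\<^sub>0 / sgn y, v) \<in> H" by (rule H_fst)
  then have sv: "(e\<^sub>0 / sgn y, s * v) \<in> H" using H_mult[OF assms v] by simp
  have nz: "v \<noteq> 0" "s \<noteq> 0" "F y \<noteq> 0"
    using H_norm[OF v] H_norm[OF assms] F_eq_iff[OF y(1) zero(1)] y zero by auto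
  have sy: "sgn y \<noteq> 0" using y by (simp add: sgn_zero_iff)
  obtain r where r: "r > 0" "\<alpha> + of_real r * e\<^sub>0 \<in> L" "(F (\<alpha> + of_real r * e\<^sub>0) - F \<alpha>) / (v * F y) \<in> \<real>"
    using direction_quotient_limit[OF v identity_mem, of y] y zero sy by auto
  obtain t where t: "t > 0" "\<alpha> + of_real t * e\<^sub>0 \<in> L" "(F (\<alpha> + of_real t * e\<^sub>0) - F \<alpha>) / (s * v * F y) \<in> \<real>"
    using direction_quotient_limit[OF sv identity_mem, of y] y zero sy by auto
  have "e\<^sub>0 \<noteq> 0" using e0 by auto
  then have nzF: "F (\<alpha> + of_real r * e\<^sub>0) - F \<alpha> \<noteq> 0" "F (\<alpha> + of_real t * e\<^sub>0) - F \<alpha> \<noteq> 0"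
    using F_eq_iff[OF r(2) alpha] F_eq_iff[OF t(2) alpha] r t by auto
  define a b where "a = F (\<alpha> + of_real r * e\<^sub>0) - F \<alpha>" and "b = F (\<alpha> + of_real t * e\<^sub>0) - F \<alpha>"
  have ab: "a \<noteq> 0" "b \<noteq> 0" "b / a \<in> \<real>" "a / (v * F y) \<in> \<real>" "b / (s * v * F y) \<in> \<real>"
    using nzF ray_ratio[OF r(1) t(1) r(2) t(2)] r(3) t(3) by (simp_all add: a_def b_def)
  have "s = (b / a) * (a / (v * F y)) / (b / (s * v * F y))" using ab nz by (simp add: field_simps)
  also have "\<dots> \<in> \<real>" by (rule Reals_divide[OF Reals_mult[OF ab(3,4)] ab(5)])
  finally obtain x where x: "s = of_real x" by (auto elim: Reals_cases)
  then have "\<bar>x\<bar> = 1" using H_norm[OF assms] by simp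
  then have "x^2 = 1" by (simp add: abs_square_eq_1)
  then show ?thesis unfolding x by (metis of_real_1 of_real_power)
qed

text \<open>The second component is determined by the first one up to sign, so its square does not depend on the choice.\<close>

definition \<psi> :: "complex \<Rightarrow> complex" where "\<psi> u = (SOME v. (u, v) \<in> H)^2"

lemma psi_eq: assumes "(u, v) \<in> H" shows "\<psi> u = v^2"
proof -
  define v' where "v' = (SOME v. (u, v) \<in> H)"
  have v': "(u, v') \<in> H" unfolding v'_def using assms by (rule someI)
  have nz: "u \<noteq> 0" "v \<noteq> 0" using H_norm[OF assms] by auto
  have "(1, v' * inverse v) \<in> H" using H_mult[OF v' H_inverse[OF assms]] nz by simp
  then have "(v' * inverse v)^2 = 1" by (rule H_one_imp)
  then have "v'^2 = v^2" using nz by (simp add: field_simps power_mult_distrib)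
  then show ?thesis by (simp add: \<psi>_def v'_def)
qed

lemma psi_norm: "norm u = 1 \<Longrightarrow> norm (\<psi> u) = 1"
  by (metis H_fst psi_eq H_norm(2) norm_power power_one)

lemma psi_mult: assumes "norm u = 1" "norm v = 1" shows "\<psi> (u * v) = \<psi> u * \<psi> v"
proof -
  obtain a b where "(u, a) \<in> H" "(v, b) \<in> H" using H_fst assms by metis
  with H_mult[OF this] show ?thesis by (simp add: psi_eq power_mult_distrib)
qed

text \<open>The graph is a continuous image of the compact set \<open>H\<close>, hence closed, and a
  map into the compact circle with closed graph is continuous.\<close>

lemma psi_continuous: "continuous_on (sphere 0 1) \<psi>"
proof (rule continuous_from_closed_graph[of "sphere 0 1"])
  have "(\<lambda>x. (x, \<psi> x)) ` sphere 0 1 = (\<lambda>(u, v). (u, v^2)) ` H"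
  proof (intro equalityI subsetI)
    fix z assume "z \<in> (\<lambda>x. (x, \<psi> x)) ` sphere 0 1"
    then obtain u where u: "norm u = 1" "z = (u, \<psi> u)" by auto
    obtain v where "(u, v) \<in> H" using H_fst u by blast
    then show "z \<in> (\<lambda>(u, v). (u, v^2)) ` H" using u psi_eq by force
  next
    fix z assume "z \<in> (\<lambda>(u, v). (u, v^2)) ` H"
    then obtain u v where uv: "(u, v) \<in> H" "z = (u, v^2)" by auto
    then show "z \<in> (\<lambda>x. (x, \<psi> x)) ` sphere 0 1" using psi_eq[OF uv(1)] H_norm[OF uv(1)] by auto
  qed
  moreover have "compact ((\<lambda>(u, v). (u, v^2)) ` H)"
    by (intro compact_continuous_image compact_H) (auto simp: case_prod_beta intro!: continuous_intros)
  ultimately show "closed ((\<lambda>x. (x, \<psi> x)) ` sphere 0 1)" by (metis compact_imp_closed)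
qed (use psi_norm in auto)

text \<open>For every \<open>A\<close> and \<open>y\<close> a rotation pair is chosen that aims at
  the same ray \<open>e\<^sub>0\<close>, along which the image differences have one direction up to
  sign. Solving for the direction of \<open>F y - F w\<close> leaves \<open>\<psi> (u * a)\<close>,
  in which the contribution of the matrix cancels because
  \<open>u * a = e\<^sub>0 / s\<close>.\<close>

lemma direction_law:
  obtains c and k :: int where "norm c = 1"
    "\<And>A B y. (A, B) \<in> G \<Longrightarrow> A$1$1 \<noteq> 0 \<Longrightarrow> y \<in> L \<Longrightarrow> y \<noteq> - A$1$2 / A$1$1 \<Longrightarrow>
       sgn (F y - F (- A$1$2 / A$1$1))^2 = c * sgn (y - (- A$1$2 / A$1$1)) powi k"
proof -
  obtain k :: int where k: "\<And>u. norm u = 1 \<Longrightarrow> \<psi> u = u powi k"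
    using circle_continuous_hom[OF psi_continuous psi_norm psi_mult] by blast
  obtain r0 where "r0 \<in> {r\<^sub>1..r\<^sub>2}" and p0: "\<alpha> + of_real r0 * e\<^sub>0 \<in> L"
    by (rule robust_ray_meets[OF robust eps])
  then have r0: "r0 > 0" using radii by auto
  have e0nz: "e\<^sub>0 \<noteq> 0" using e0 by auto
  define c0 where "c0 = sgn (F (\<alpha> + of_real r0 * e\<^sub>0) - F \<alpha>)^2"
  have c0n: "norm c0 = 1" using F_eq_iff[OF p0 alpha] r0 e0nz by (simp add: c0_def norm_power norm_sgn)
  show thesis
  proof
    show "norm (c0 / e\<^sub>0 powi k) = 1" using c0n e0 by (simp add: norm_divide norm_power_int)
    fix A B y assume G: "(A, B) \<in> G" "A$1$1 \<noteq> 0" and y: "y \<in> L" "y \<noteq> - A$1$2 / A$1$1"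
    define w where "w = - A$1$2 / A$1$1"
    have wL: "w \<in> L" using pole[OF G] by (simp add: w_def)
    have nzB: "B$1$1 \<noteq> 0" using pole[OF G] by blast
    define s where "s = sgn (y - w)"
    have s: "norm s = 1" "s \<noteq> 0" using y unfolding w_def[symmetric] by (simp_all add: s_def norm_sgn sgn_zero_iff)
    define a where "a = sgn (A$1$1^2)"
    have a: "norm a = 1" "a \<noteq> 0" using G by (auto simp: a_def norm_sgn sgn_zero_iff)
    define u where "u = e\<^sub>0 / (a * s)"
    have u: "norm u = 1" using e0 a s by (simp add: u_def norm_divide norm_mult)
    then obtain v where uv: "(u, v) \<in> H" by (rule H_fst)
    define X where "X = F y - F w"
    have X: "X \<noteq> 0" using F_eq_iff[OF y(1) wL] y by (simp add: X_def w_def)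
    have e: "e\<^sub>0 = u * sgn (A$1$1^2) * sgn (y - w)" using a s by (simp add: u_def flip: a_def s_def)
    obtain r where r: "r > 0" "\<alpha> + of_real r * e\<^sub>0 \<in> L"
      "(F (\<alpha> + of_real r * e\<^sub>0) - F \<alpha>) / (v * sgn (B$1$1^2) * X) \<in> \<real>"
      using direction_quotient_limit[OF uv G y] e unfolding w_def X_def by blast
    define p where "p = F (\<alpha> + of_real r * e\<^sub>0) - F \<alpha>"
    have p: "p \<noteq> 0" using F_eq_iff[OF r(2) alpha] r e0nz by (simp add: p_def)
    have nzv: "v \<noteq> 0" "norm v = 1" using H_norm[OF uv] by auto
    have "sgn p^2 = sgn (v * sgn (B$1$1^2) * X)^2"
      by (rule sgn_square_eq) (use r(3) p nzv nzB X in \<open>auto simp: p_def sgn_zero_iff\<close>)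
    also have "\<dots> = v^2 * sgn (B$1$1^2)^2 * sgn X^2"
      using nzv nzB by (simp add: sgn_mult power_mult_distrib sgn_sgn) (simp add: sgn_eq)
    also have "v^2 = \<psi> u" by (simp add: psi_eq[OF uv])
    also have "sgn (B$1$1^2)^2 = \<psi> a"
    proof -
      have "(sgn (A$1$1^2), sgn (B$1$1^2)) \<in> H"
        using G closure_subset[of S] unfolding H_def S_def by blast
      then show ?thesis by (simp add: psi_eq a_def)
    qed
    also have "\<psi> u * \<psi> a = \<psi> (u * a)" using psi_mult[OF u a(1)] by simp
    also have "u * a = e\<^sub>0 / s" using a s by (simp add: u_def)
    also have "\<psi> (e\<^sub>0 / s) = e\<^sub>0 powi k / s powi k"
      using k[of "e\<^sub>0 / s"] s e0 by (simp add: norm_divide power_int_divide_distrib)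
    finally have "sgn p^2 = e\<^sub>0 powi k / s powi k * sgn X^2" .
    moreover have "sgn p^2 = c0"
      unfolding c0_def p_def using p F_eq_iff[OF p0 alpha] r0 e0nz
      by (intro sgn_square_eq ray_ratio r(1) r0 p0 r(2)) (auto simp: p_def)
    moreover have "e\<^sub>0 powi k \<noteq> 0" "s powi k \<noteq> 0" using e0nz s by auto
    ultimately have "sgn X^2 = c0 / e\<^sub>0 powi k * s powi k" by (simp add: field_simps)
    then show "sgn (F y - F (- A$1$2 / A$1$1))^2 = c0 / e\<^sub>0 powi k * sgn (y - (- A$1$2 / A$1$1)) powi k"
      by (simp only: X_def w_def s_def)
  qed
qed

definition Orb where "Orb = {- A$1$2 / A$1$1 |A B. (A, B) \<in> G \<and> A$1$1 \<noteq> 0}"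

lemma Orb_subset: "Orb \<subseteq> L"
  using pole(1) by (auto simp: Orb_def)

lemma zero_in_Orb: "0 \<in> Orb"
  using identity_mem unfolding Orb_def by force

lemma Orb_dense: assumes "real_polynomial_function p" "\<And>z. z \<in> Orb \<Longrightarrow> p z = 0" shows "p z = 0"
  using zariski_generic_orbit[OF generic(1) assms(1), of z] assms(2) unfolding Orb_def by force

lemma F_Orb_dense: assumes "real_polynomial_function p" "\<And>z. z \<in> Orb \<Longrightarrow> p (F z) = 0" shows "p z = 0"
proof (rule zariski_generic_orbit[OF generic(2) assms(1)])
  fix B assume "B \<in> snd ` G" and nz: "B$1$1 \<noteq> 0"
  then obtain A where AB: "(A, B) \<in> G" by auto
  \<comment> \<open>If \<open>A$1$1\<close> were 0, the inverse of \<open>A\<close> would send 0 to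
    infinity, and so would the inverse of \<open>B\<close>.\<close>
  have "A$1$1 \<noteq> 0" using act_pole[OF inverse[OF AB] zero(1)] zero(2) nz by auto
  then show "p (- B$1$2 / B$1$1) = 0" using assms(2)[of "- A$1$2 / A$1$1"] pole(3)[OF AB] AB unfolding Orb_def by force
qed

lemma nonzero_in_Orb: obtains w where "w \<in> Orb" "w \<noteq> 0"
proof (rule ccontr)
  assume "\<not> thesis"
  then have "\<And>z. z \<in> Orb \<Longrightarrow> Re z = 0" using that by force
  then show False using Orb_dense[OF cpoly_Re[OF cpoly_id], of 1] by simp
qed

lemma power_law:
  obtains \<kappa> \<tau> and m :: nat where "\<kappa> \<noteq> 0" "\<tau> = (\<lambda>z. z) \<or> \<tau> = cnj"
    "\<And>w y. w \<in> Orb \<Longrightarrow> y \<in> L \<Longrightarrow> y \<noteq> w \<Longrightarrow> (F y - F w) / (\<kappa> * \<tau> (y - w) ^ m) \<in> \<real>"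
proof -
  obtain c and k :: int where c: "norm c = 1" and law0:
    "\<And>A B y. (A, B) \<in> G \<Longrightarrow> A$1$1 \<noteq> 0 \<Longrightarrow> y \<in> L \<Longrightarrow> y \<noteq> - A$1$2 / A$1$1 \<Longrightarrow>
       sgn (F y - F (- A$1$2 / A$1$1))^2 = c * sgn (y - (- A$1$2 / A$1$1)) powi k"
    using direction_law by blast
  have law: "sgn (F y - F w)^2 = c * sgn (y - w) powi k" if "w \<in> Orb" "y \<in> L" "y \<noteq> w" for w y
    using that law0 unfolding Orb_def by blast
  \<comment> \<open>Exchanging the points \<open>w\<close> and 0 preserves the squared direction on
    the left but multiplies the right side by \<open>(-1)^k\<close>.\<close>
  have "even k"
  proof (rule ccontr)
    assume "odd k"
    obtain w where w: "w \<in> Orb" "w \<noteq> 0" by (rule nonzero_in_Orb)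
    have "sgn (F w - F 0)^2 = sgn (F 0 - F w)^2"
      using sgn_minus[of "F w - F 0"] by (simp add: power2_eq_square)
    then have "c * sgn (w - 0) powi k = c * sgn (0 - w) powi k"
      using law[OF zero_in_Orb, of w] law[OF w(1), of 0] w Orb_subset zero_in_Orb by (metis subsetD)
    then have "sgn w powi k = (- sgn w) powi k" using c by (auto simp: sgn_minus)
    also have "\<dots> = - (sgn w powi k)" using \<open>odd k\<close> by (rule power_int_minus_left_odd)
    finally show False using w by (simp add: sgn_zero_iff)
  qed
  then obtain j where j: "k = 2 * j" by (elim evenE)
  \<comment> \<open>Negative exponents are absorbed into the conjugation, which inverts unit complex
    numbers.\<close>
  define \<tau> :: "complex \<Rightarrow> complex" where "\<tau> = (if j \<ge> 0 then (\<lambda>z. z) else cnj)"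
  define m where "m = nat \<bar>j\<bar>"
  have tau: "sgn (\<tau> z ^ m) = sgn z powi j" if "z \<noteq> 0" for z
  proof (cases "j \<ge> 0")
    case True
    then show ?thesis by (simp add: \<tau>_def m_def sgn_complex_power power_int_def)
  next
    case False
    have "norm (sgn z) = 1" using that by (simp add: norm_sgn)
    then have "cnj (sgn z) = inverse (sgn z)"
      by (metis complex_norm_square inverse_unique mult.commute of_real_1 power_one)
    moreover have "sgn (cnj z) = cnj (sgn z)" by (simp add: sgn_eq)
    ultimately show ?thesis using False by (simp add: \<tau>_def m_def sgn_complex_power power_int_def)
  qed
  show thesis
  proof
    \<comment> \<open>The square root undoes the squaring up to a sign, which a real factor
      absorbs.\<close>
    show "csqrt c \<noteq> 0" "\<tau> = (\<lambda>z. z) \<or> \<tau> = cnj" using c by (auto simp: \<tau>_def)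
    fix w y assume wy: "w \<in> Orb" "y \<in> L" "y \<noteq> w"
    have wL: "w \<in> L" using wy Orb_subset by blast
    define X where "X = F y - F w"
    define Z where "Z = csqrt c * \<tau> (y - w) ^ m"
    have "norm (csqrt c) = 1" using c by (simp add: norm_csqrt)
    then have "sgn (csqrt c) = csqrt c" by (simp add: sgn_eq)
    then have "sgn Z ^ 2 = c * (sgn (y - w) powi j)\<^sup>2"
      using wy tau[of "y - w"] by (simp add: Z_def sgn_mult power_mult_distrib)
    also have "(sgn (y - w) powi j)\<^sup>2 = sgn (y - w) powi k"
      unfolding j mult.commute[of 2] power_int_mult by simp
    also have "c * sgn (y - w) powi k = sgn X ^ 2" unfolding X_def by (rule law[OF wy, symmetric])
    finally have "sgn X ^ 2 = sgn Z ^ 2" by simp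
    then have "sgn X = sgn Z \<or> sgn X = - sgn Z" by (simp add: power2_eq_iff)
    moreover have nz: "X \<noteq> 0" "Z \<noteq> 0" using F_eq_iff[OF wy(2) wL] wy c by (auto simp: X_def Z_def \<tau>_def)
    moreover have "X = of_real (norm X) * sgn X" "Z = of_real (norm Z) * sgn Z" using nz by (simp_all add: sgn_eq)
    ultimately have "X / Z = of_real (norm X / norm Z) \<or> X / Z = of_real (- norm X / norm Z)"
      by (metis (no_types, lifting) mult_divide_mult_cancel_right mult_minus_right of_real_divide of_real_minus minus_divide_left sgn_zero_iff)
    then have "X / Z \<in> \<real>" by (metis Reals_of_real)
    then show "(F y - F w) / (csqrt c * \<tau> (y - w) ^ m) \<in> \<real>" by (simp add: X_def Z_def)
  qed
qed

end

text \<open>If \<open>F x = \<kappa> r(x) x\<^sup>m\<close> with real \<open>r\<close>, and \<open>F x - F y\<close> is a real multiple of \<open>\<kappa> (x - y)\<^sup>m\<close>, then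
  \<open>r(x) skew m x (x - y) = r(y) skew m y (x - y)\<close>. Eliminating \<open>r\<close> along a triple gives the
  polynomial identity that \<open>skew_cycle_false\<close> refutes.\<close>

definition skew :: "nat \<Rightarrow> complex \<Rightarrow> complex \<Rightarrow> real"
  where "skew m p q = Im (p ^ m * cnj (q ^ m))"

text \<open>At \<open>s = 0\<close> the imaginary part vanishes and its derivative is
  \<open>m * Im p\<close>, which is not 0.\<close>

lemma eventually_power_not_real:
  assumes "Im p \<noteq> 0" "m > 0"
  shows "\<forall>\<^sub>F s in at_right 0. Im ((1 + of_real s * p) ^ m) \<noteq> 0"
proof -
  have der: "((\<lambda>s::real. Im ((1 + of_real s * p) ^ m)) has_real_derivative Im (of_nat m * p)) (at 0)"
  proof -
    have "((\<lambda>z. (1 + z * p) ^ m) has_field_derivative of_nat m * p) (at (of_real 0))"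
      by (auto intro!: derivative_eq_intros)
    then have "((\<lambda>s::real. (1 + of_real s * p) ^ m) has_vector_derivative of_nat m * p) (at 0)"
      using has_vector_derivative_real_field[of "\<lambda>z. (1 + z * p) ^ m" _ "0::real" UNIV] by simp
    then show ?thesis unfolding has_real_derivative_iff_has_vector_derivative
      by (rule bounded_linear.has_vector_derivative[OF bounded_linear_Im])
  qed
  have "((\<lambda>s. (Im ((1 + of_real s * p) ^ m) - Im ((1 + of_real 0 * p) ^ m)) / (s - 0)) \<longlongrightarrow> Im (of_nat m * p)) (at 0)"
    using der by (simp only: has_field_derivative_iff)
  then have "((\<lambda>s. Im ((1 + of_real s * p) ^ m) / s) \<longlongrightarrow> Im (of_nat m * p)) (at_right 0)"
    using tendsto_mono[OF at_le[OF subset_UNIV[of "{0<..}"]]] by simp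
  then have "\<forall>\<^sub>F s in at_right 0. Im ((1 + of_real s * p) ^ m) / s \<noteq> 0"
    by (rule tendsto_imp_eventually_ne) (use assms in auto)
  then show ?thesis by eventually_elim auto
qed

lemma Im_power_minus: "Im ((- w) ^ m) = 0 \<longleftrightarrow> Im (w ^ m) = 0"
  by (cases "even m") simp_all

text \<open>Take \<open>x = 1\<close> and choose \<open>y\<close>, \<open>z\<close> so that one
  factor on the left vanishes and no factor on the right does. For \<open>m \<ge> 2\<close> the root
  \<omega> of \<open>\<omega>^m = -1\<close> is not real, which leaves room for this choice.\<close>

lemma skew_cycle_false:
  assumes m: "m \<ge> 2"
    and cyc: "\<And>x y z. skew m x (x - y) * skew m y (y - z) * skew m z (z - x) =
      skew m y (x - y) * skew m z (y - z) * skew m x (z - x)"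
  shows False
proof -
  define \<omega> where "\<omega> = cis (pi / m)"
  have wm: "\<omega> ^ m = - 1" using m by (simp add: \<omega>_def Complex.DeMoivre)
  have wnz: "\<omega> \<noteq> 0" by (simp add: \<omega>_def)
  have scale: "skew m p q = norm q ^ (2 * m) * Im ((p / q) ^ m)" if "q \<noteq> 0" for p q
  proof -
    have "p ^ m * cnj (q ^ m) = (p / q) ^ m * of_real (norm q ^ (2 * m))"
    proof -
      have "of_real (norm q ^ (2 * m)) = q ^ m * cnj q ^ m"
        unfolding power_mult of_real_power[of "norm q ^ 2"] complex_norm_square by (simp add: power_mult_distrib)
      then show ?thesis using that by (simp add: power_divide)
    qed
    then show ?thesis by (simp add: skew_def mult.commute)
  qed
  have sinpos: "sin (pi / m) > 0" using m by (intro sin_gt_zero) (auto simp: field_simps)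
  have "Im (- inverse \<omega>) \<noteq> 0" using sinpos by (simp add: \<omega>_def cis_inverse)
  then have "\<forall>\<^sub>F s in at_right 0. s > 0 \<and> Im ((1 + of_real s * (- inverse \<omega>)) ^ m) \<noteq> 0"
    using m by (intro eventually_conj eventually_power_not_real eventually_at_right_less) auto
  then obtain s :: real where s: "s > 0" "Im ((1 + of_real s * (- inverse \<omega>)) ^ m) \<noteq> 0"
    using eventually_happens'[OF trivial_limit_at_right_real] by blast
  \<comment> \<open>\<open>1 - y\<close> is a real multiple of \<omega>, so \<open>(1 - y)^m\<close>
    is real and \<open>skew m 1 (1 - y) = 0\<close>; the choice of \<open>s\<close> keeps
    \<open>(y / (1 - y))^m\<close> off the real axis.\<close>
  define y where "y = 1 - \<omega> / of_real s"
  have xy: "1 - y = \<omega> / of_real s" by (simp add: y_def)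
  have "(y / (1 - y)) = - (1 + of_real s * (- inverse \<omega>))"
    unfolding xy using s wnz by (simp add: y_def field_simps)
  then have i1: "Im ((y / (1 - y)) ^ m) \<noteq> 0" using s(2) Im_power_minus by metis
  have h1: "1 - y \<noteq> 0" using s wnz by (simp add: xy)
  have 1: "skew m y (1 - y) \<noteq> 0" unfolding scale[OF h1] using i1 h1 by simp
  have 2: "skew m 1 (1 - y) = 0"
    unfolding skew_def xy using wm s by (simp add: power_divide flip: of_real_power)
  \<comment> \<open>A square root of \<omega> with \<open>d^m = \<i>\<close>: in directions near
    \<open>d\<close> the \<open>m\<close>-th powers stay away from the real axis.\<close>
  define d where "d = cis (pi / (2 * m))"
  have dm: "d ^ m = \<i>" using m by (simp add: d_def Complex.DeMoivre)
  have dnz: "d \<noteq> 0" by (simp add: d_def)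
  have dd: "\<omega> = d * d" using m by (simp add: d_def \<omega>_def cis_mult field_simps)
  have "Im (y / d) \<noteq> 0"
  proof -
    have "y / d = inverse d - d / of_real s" unfolding y_def dd using dnz s by (simp add: field_simps)
    then have "Im (y / d) = Im (inverse d) - Im (d / of_real s)" by (simp only: minus_complex.sel)
    moreover have "Im (inverse d) = - sin (pi / (2 * m))" by (simp add: d_def cis_inverse)
    moreover have "Im (d / of_real s) = sin (pi / (2 * m)) / s" by (simp add: d_def)
    ultimately have "Im (y / d) = - (sin (pi / (2 * m)) * (1 + 1 / s))" using s by (simp add: field_simps)
    moreover have "sin (pi / (2 * m)) > 0" using m by (intro sin_gt_zero) (auto simp: field_simps)
    moreover have "1 + 1 / s > 0" using s by (simp add: add_pos_pos)
    ultimately show ?thesis by simp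
  qed
  then have ev1: "\<forall>\<^sub>F t in at_right 0. Im ((1 + of_real t * (y / d)) ^ m) \<noteq> 0"
    using m by (intro eventually_power_not_real) auto
  have "((\<lambda>t::real. Im ((d + of_real t * (y - 1)) ^ m)) \<longlongrightarrow> Im ((d + of_real 0 * (y - 1)) ^ m)) (at_right 0)"
    by (intro tendsto_intros)
  then have ev2: "\<forall>\<^sub>F t in at_right 0. Im ((d + of_real t * (y - 1)) ^ m) \<noteq> 0"
    by (rule tendsto_imp_eventually_ne) (simp add: dm)
  have "\<forall>\<^sub>F t in at_right 0. t > 0 \<and> Im ((1 + of_real t * (y / d)) ^ m) \<noteq> 0 \<and> Im ((d + of_real t * (y - 1)) ^ m) \<noteq> 0"
    by (intro eventually_conj ev1 ev2 eventually_at_right_less)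
  then obtain t :: real where t: "t > 0" "Im ((1 + of_real t * (y / d)) ^ m) \<noteq> 0" "Im ((d + of_real t * (y - 1)) ^ m) \<noteq> 0"
    using eventually_happens'[OF trivial_limit_at_right_real] by blast
  \<comment> \<open>For small \<open>t\<close> the point \<open>z\<close> is far from
    \<open>y\<close> in the direction \<open>d\<close>: then \<open>z - 1\<close> has nearly the
    direction \<open>d\<close>, and \<open>z / (y - z)\<close> is a perturbation of -1 whose
    \<open>m\<close>-th power is not real because \<open>y / d\<close> is not.\<close>
  define z where "z = y + d / of_real t"
  have "z / (y - z) = - (1 + of_real t * (y / d))" using t dnz by (simp add: z_def field_simps)
  then have i3: "Im ((z / (y - z)) ^ m) \<noteq> 0" using t(2) Im_power_minus by metis
  have h3: "y - z \<noteq> 0" using t dnz by (simp add: z_def)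
  have 3: "skew m z (y - z) \<noteq> 0" unfolding scale[OF h3] using i3 h3 by simp
  have "z - 1 = (d + of_real t * (y - 1)) / of_real t" using t by (simp add: z_def field_simps)
  then have zm: "(z - 1) ^ m = (d + of_real t * (y - 1)) ^ m / of_real (t ^ m)" by (simp add: power_divide)
  have "skew m 1 (z - 1) = - Im ((d + of_real t * (y - 1)) ^ m) / t ^ m"
    unfolding skew_def zm power_one mult_1 cnj.sel Im_divide_of_real by simp
  then have 4: "skew m 1 (z - 1) \<noteq> 0" using t by simp
  show False using cyc[of 1 y z] 1 2 3 4 by simp
qed

lemma Im_mult_cnj_combination:
  "Im (q * cnj (of_real a * x - of_real b * y)) = b * Im (y * cnj q) - a * Im (x * cnj q)"
  by (simp add: algebra_simps)

lemma cpoly_skew: "cpoly f \<Longrightarrow> cpoly g \<Longrightarrow> real_polynomial_function (\<lambda>x. skew m (f x) (g x))"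
  unfolding skew_def by (intro cpoly_Im cpoly_mult cpoly_power cpoly_cnj)

context plane_conjugacy
begin

theorem affine_or_conjugate_affine:
  obtains \<mu> where "\<mu> \<noteq> 0" "(\<forall>z\<in>L. F z = \<mu> * z) \<or> (\<forall>z\<in>L. F z = \<mu> * cnj z)"
proof -
  obtain \<kappa> \<tau> and m :: nat where \<kappa>: "\<kappa> \<noteq> 0" and \<tau>: "\<tau> = (\<lambda>z. z) \<or> \<tau> = cnj" and
    law: "\<And>w y. w \<in> Orb \<Longrightarrow> y \<in> L \<Longrightarrow> y \<noteq> w \<Longrightarrow> (F y - F w) / (\<kappa> * \<tau> (y - w) ^ m) \<in> \<real>"
    by (rule power_law) blast
  have tau_simps: "\<tau> 0 = 0" "\<And>x y. \<tau> (x - y) = \<tau> x - \<tau> y" "\<And>x. \<tau> x = 0 \<longleftrightarrow> x = 0" using \<tau> by auto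
  define r where "r y = Re (F y / (\<kappa> * \<tau> y ^ m))" for y
  have Fr: "F y = \<kappa> * of_real (r y) * \<tau> y ^ m" if "y \<in> L" "y \<noteq> 0" for y
  proof -
    have "F y / (\<kappa> * \<tau> y ^ m) \<in> \<real>" using law[OF zero_in_Orb that] zero by simp
    then have "F y / (\<kappa> * \<tau> y ^ m) = of_real (r y)" by (simp add: r_def)
    then show ?thesis using \<kappa> tau_simps that by (simp add: field_simps)
  qed
  have rnz: "r y \<noteq> 0" if "y \<in> L" "y \<noteq> 0" for y
    using Fr[OF that] F_eq_iff[OF that(1) zero(1)] zero that by auto
  \<comment> \<open>For \<open>m = 0\<close> all images of orbit points would lie on the real line
    spanned by \<kappa>, against the Zariski density of these images.\<close>
  have m0: "m \<noteq> 0"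
  proof
    assume m: "m = 0"
    have 0: "Im (F z * cnj \<kappa>) = 0" if "z \<in> Orb" for z
    proof (cases "z = 0")
      case False
      then have "F z = \<kappa> * of_real (r z)" using Fr[of z] that Orb_subset m by auto
      then show ?thesis by (simp add: algebra_simps)
    qed (simp add: zero)
    have "real_polynomial_function (\<lambda>z. Im (z * cnj \<kappa>))" by (intro cpoly_Im cpoly_mult cpoly_id cpoly_const)
    from F_Orb_dense[OF this 0] have "Im (\<i> * \<kappa> * cnj \<kappa>) = 0" by blast
    moreover have "\<i> * \<kappa> * cnj \<kappa> = \<i> * of_real (norm \<kappa> ^ 2)"
      unfolding complex_norm_square by (simp only: mult.assoc)
    then have "Im (\<i> * \<kappa> * cnj \<kappa>) = norm \<kappa> ^ 2" by (simp only: Im_i_of_real)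
    ultimately have "\<kappa> = 0" by simp
    then show False using \<kappa> by (simp add: complex_eq_iff sum_squares_eq_zero_iff)
  qed
  \<comment> \<open>Conjugation only reverses the sign of \<open>skew\<close>, so both cases of
    \<tau> lead to the same relations.\<close>
  have sign: "\<exists>\<sigma>::real. \<sigma> \<noteq> 0 \<and> (\<forall>p q. Im (\<tau> p ^ m * cnj (\<tau> q ^ m)) = \<sigma> * skew m p q)"
    using \<tau>
  proof
    assume "\<tau> = cnj"
    then have "\<tau> p ^ m * cnj (\<tau> q ^ m) = cnj (p ^ m * cnj (q ^ m))" for p q by simp
    then have "Im (\<tau> p ^ m * cnj (\<tau> q ^ m)) = (- 1) * skew m p q" for p q
      unfolding skew_def by (metis cnj.simps(2) mult_minus1)
    then show ?thesis by (intro exI[of _ "- 1"]) simp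
  qed (auto simp: skew_def intro!: exI[of _ 1])
  have step: "r x * skew m x (x - y) = r y * skew m y (x - y)"
    if "x \<in> L" "x \<noteq> 0" "y \<in> Orb" "y \<noteq> 0" for x y
  proof (cases "x = y")
    case False
    have yL: "y \<in> L" using that Orb_subset by blast
    have "(F x - F y) / (\<kappa> * \<tau> (x - y) ^ m) \<in> \<real>" using law[OF that(3,1)] False by simp
    moreover have "F x - F y = \<kappa> * (of_real (r x) * \<tau> x ^ m - of_real (r y) * \<tau> y ^ m)"
      unfolding Fr[OF that(1,2)] Fr[OF yL that(4)] by (simp only: right_diff_distrib mult.assoc)
    ultimately have "(of_real (r x) * \<tau> x ^ m - of_real (r y) * \<tau> y ^ m) / \<tau> (x - y) ^ m \<in> \<real>"
      using mult_divide_mult_cancel_left[OF \<kappa>] by metis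
    then have "Im (\<tau> (x - y) ^ m * cnj (of_real (r x) * \<tau> x ^ m - of_real (r y) * \<tau> y ^ m)) = 0"
      by (simp only: real_quotient_iff)
    then have "r x * Im (\<tau> x ^ m * cnj (\<tau> (x - y) ^ m)) = r y * Im (\<tau> y ^ m * cnj (\<tau> (x - y) ^ m))"
      unfolding Im_mult_cnj_combination by simp
    moreover obtain \<sigma> :: real where \<sigma>: "\<sigma> \<noteq> 0" "\<And>p q. Im (\<tau> p ^ m * cnj (\<tau> q ^ m)) = \<sigma> * skew m p q"
      using sign by blast
    ultimately have "\<sigma> * (r x * skew m x (x - y)) = \<sigma> * (r y * skew m y (x - y))"
      unfolding \<sigma>(2) by (simp only: mult_ac)
    then show ?thesis using \<sigma>(1) by simp
  qed (use m0 in \<open>simp add: skew_def\<close>)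
  have m1: "m = 1"
  proof (rule ccontr)
    assume "m \<noteq> 1"
    then have m2: "m \<ge> 2" using m0 by simp
    define T where "T x y z = skew m x (x - y) * skew m y (y - z) * skew m z (z - x) -
      skew m y (x - y) * skew m z (y - z) * skew m x (z - x)" for x y z
    have T: "T x y z = 0" if Orb: "x \<in> Orb" "y \<in> Orb" "z \<in> Orb" for x y z
    proof (cases "x = 0 \<or> y = 0 \<or> z = 0")
      case True
      have "skew m 0 q = 0" for q using m0 by (simp add: skew_def)
      then show ?thesis using True by (auto simp: T_def)
    next
      case False
      have L: "x \<in> L" "y \<in> L" "z \<in> L" using Orb Orb_subset by auto
      have "(r x * r y * r z) * T x y z =
        (r x * skew m x (x - y)) * (r y * skew m y (y - z)) * (r z * skew m z (z - x)) -
        (r y * skew m y (x - y)) * (r z * skew m z (y - z)) * (r x * skew m x (z - x))"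
        by (simp only: T_def right_diff_distrib mult_ac)
      also have "\<dots> = 0" using step[OF L(1) _ Orb(2)] step[OF L(2) _ Orb(3)] step[OF L(3) _ Orb(1)] False by simp
      finally show ?thesis using rnz L False by auto
    qed
    have polyT: "real_polynomial_function (\<lambda>t. T (f t) (g t) (h t))"
      if "cpoly f" "cpoly g" "cpoly h" for f g h :: "complex \<Rightarrow> complex"
      unfolding T_def
      by (intro real_polynomial_function_diff rpf_mult cpoly_skew cpoly_diff that)
    \<comment> \<open>Density frees one variable at a time, while the later ones are still confined
      to the orbit.\<close>
    have T1: "T x y z = 0" if "y \<in> Orb" "z \<in> Orb" for x y z
      by (rule Orb_dense[OF polyT[OF cpoly_id cpoly_const cpoly_const]]) (rule T[OF _ that])
    have T2: "T x y z = 0" if "z \<in> Orb" for x y z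
      by (rule Orb_dense[OF polyT[OF cpoly_const cpoly_id cpoly_const]]) (rule T1[OF _ that])
    have "T x y z = 0" for x y z
      by (rule Orb_dense[OF polyT[OF cpoly_const cpoly_const cpoly_id]]) (rule T2)
    then have cyc: "skew m x (x - y) * skew m y (y - z) * skew m z (z - x) =
        skew m y (x - y) * skew m z (y - z) * skew m x (z - x)" for x y z by (simp add: T_def)
    show False by (rule skew_cycle_false[OF m2 cyc])
  qed
  \<comment> \<open>For \<open>m = 1\<close> both skew terms equal \<open>- Im (x * cnj y)\<close>,
    so \<open>r\<close> agrees at two points that are not collinear with 0.\<close>
  have req: "r x = r y" if "x \<in> L" "x \<noteq> 0" "y \<in> Orb" "Im (x * cnj y) \<noteq> 0" for x y
  proof -
    have "y \<noteq> 0" using that by auto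
    have "skew m x (x - y) = - Im (x * cnj y)" "skew m y (x - y) = - Im (x * cnj y)"
      by (simp_all add: skew_def m1 algebra_simps)
    then show ?thesis using step[OF that(1,2,3) \<open>y \<noteq> 0\<close>] that by simp
  qed
  have const: "r x = r y" if xy: "x \<in> L" "x \<noteq> 0" "y \<in> L" "y \<noteq> 0" for x y
  proof -
    \<comment> \<open>An orbit point that lies neither on the line through 0 and \<open>x\<close>
      nor on the line through 0 and \<open>y\<close> links the two values. It exists because the
      product of the two linear forms is not the zero polynomial.\<close>
    have "\<exists>z\<in>Orb. Im (x * cnj z) * Im (y * cnj z) \<noteq> 0"
    proof (rule ccontr)
      assume no: "\<not> ?thesis"
      have rp: "real_polynomial_function (\<lambda>z. Im (x * cnj z) * Im (y * cnj z))"
        by (intro rpf_mult cpoly_Im cpoly_mult cpoly_cnj cpoly_const cpoly_id)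
      have *: "Im (x * cnj z) * Im (y * cnj z) = 0" for z
        by (rule Orb_dense[OF rp]) (use no in blast)
      have nrm: "Im (z * cnj (\<i> * z)) \<noteq> 0" if "z \<noteq> 0" for z
      proof -
        have "z * cnj (\<i> * z) = - (\<i> * of_real (norm z ^ 2))" unfolding complex_norm_square by simp
        then have "Im (z * cnj (\<i> * z)) = - (norm z ^ 2)" by (simp only: Im_i_of_real uminus_complex.simps)
        then show ?thesis using that by simp
      qed
      show False
      \<comment> \<open>The expression vanishes exactly when \<open>x\<close> and \<open>y\<close>
        are orthogonal. If they are not, \<open>\<i> * x\<close> avoids both lines; if they are,
        \<open>\<i> * (x + y)\<close> does.\<close>
      proof (cases "Im (y * cnj (\<i> * x)) = 0")
        case False
        then show False using *[of "\<i> * x"] nrm[OF xy(2)] by auto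
      next
        case True
        then have "Im (x * cnj (\<i> * y)) = 0" by (simp add: algebra_simps)
        then have "Im (x * cnj (\<i> * (x + y))) = Im (x * cnj (\<i> * x))" "Im (y * cnj (\<i> * (x + y))) = Im (y * cnj (\<i> * y))"
          using True by (simp_all add: algebra_simps)
        then show False using *[of "\<i> * (x + y)"] nrm[OF xy(2)] nrm[OF xy(4)] by auto
      qed
    qed
    then show ?thesis using req xy by (metis mult_eq_0_iff)
  qed
  obtain y where y: "y \<in> L" "y \<noteq> 0" by (rule nonzero_point)
  have "F z = (\<kappa> * of_real (r y)) * \<tau> z" if "z \<in> L" for z
    using Fr[OF that] const[OF that _ y] zero tau_simps m1 by (cases "z = 0") auto
  then show thesis using that[of "\<kappa> * of_real (r y)"] \<kappa> rnz[OF y] \<tau> by auto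
qed

end

section \<open>Moebius transformations and circles in homogeneous coordinates\<close>

text \<open>Homogeneous coordinates make Moebius maps linear and treat infinity like any other
  point. The pair \<open>(0, 0)\<close> is sent to \<open>None\<close> as a default, so statements
  about points exclude it.\<close>

definition hom_point :: "complex \<Rightarrow> complex \<Rightarrow> complex option"
  where "hom_point x y = (if y = 0 then None else Some (x / y))"

lemma hom_point_scale: "s \<noteq> 0 \<Longrightarrow> hom_point (s * x) (s * y) = hom_point x y"
  by (simp add: hom_point_def)

lemma hom_point_cases:
  obtains x y where "\<xi> = hom_point x y" "x \<noteq> 0 \<or> y \<noteq> 0"
proof (cases \<xi>)
  case None
  then show thesis using that[of 1 0] by (simp add: hom_point_def)
next
  case (Some z)
  then show thesis using that[of z 1] by (simp add: hom_point_def)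
qed

lemma hom_point_simps: "hom_point z 1 = Some z" "x \<noteq> 0 \<Longrightarrow> hom_point x 0 = None"
  by (simp_all add: hom_point_def)

lemma hom_point_eq_iff:
  assumes "x \<noteq> 0 \<or> y \<noteq> 0" "x' \<noteq> 0 \<or> y' \<noteq> 0"
  shows "hom_point x y = hom_point x' y' \<longleftrightarrow> x * y' = x' * y"
  using assms by (auto simp: hom_point_def field_simps)

lemma moebius_hom_point:
  assumes "x \<noteq> 0 \<or> y \<noteq> 0"
  shows "moebius_mat A (hom_point x y) = hom_point (A$1$1 * x + A$1$2 * y) (A$2$1 * x + A$2$2 * y)"
proof (cases "y = 0")
  case True
  then show ?thesis using assms by (auto simp: hom_point_def moebius_mat_def Let_def)
next
  case False
  have "A$2$1 * (x / y) + A$2$2 = (A$2$1 * x + A$2$2 * y) / y"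
    "A$1$1 * (x / y) + A$1$2 = (A$1$1 * x + A$1$2 * y) / y"
    using False by (simp_all add: field_simps)
  then show ?thesis using False by (simp add: hom_point_def moebius_mat_def Let_def)
qed

lemma mat2_vec_nonzero:
  fixes A :: "complex^2^2"
  assumes "det A = 1" "x \<noteq> 0 \<or> y \<noteq> 0"
  shows "A$1$1 * x + A$1$2 * y \<noteq> 0 \<or> A$2$1 * x + A$2$2 * y \<noteq> (0::complex)"
proof (rule ccontr)
  assume "\<not> ?thesis"
  then have *: "A$1$1 * x + A$1$2 * y = 0" "A$2$1 * x + A$2$2 * y = 0" by auto
  have "det A * x = A$2$2 * (A$1$1 * x + A$1$2 * y) - A$1$2 * (A$2$1 * x + A$2$2 * y)"
    "det A * y = A$1$1 * (A$2$1 * x + A$2$2 * y) - A$2$1 * (A$1$1 * x + A$1$2 * y)"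
    by (simp_all add: det_2 algebra_simps)
  then show False using assms unfolding * by simp
qed

lemma moebius_mult:
  assumes "det B = 1" shows "moebius_mat A (moebius_mat B \<xi>) = moebius_mat (A ** B) \<xi>"
proof -
  obtain x y where xy: "\<xi> = hom_point x y" "x \<noteq> 0 \<or> y \<noteq> 0" by (rule hom_point_cases)
  show ?thesis unfolding xy(1) moebius_hom_point[OF xy(2)] moebius_hom_point[OF mat2_vec_nonzero[OF assms xy(2)]]
    by (simp add: mult2_nth algebra_simps)
qed

lemma moebius_one [simp]: "moebius_mat (mat 1) \<xi> = \<xi>"
  by (cases \<xi>) (simp_all add: moebius_mat_def Let_def mat_1_nth2)

lemma moebius_inv2 [simp]:
  assumes "det A = 1"
  shows "moebius_mat A (moebius_mat (inv2 A) \<xi>) = \<xi>" "moebius_mat (inv2 A) (moebius_mat A \<xi>) = \<xi>"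
  using assms by (simp_all add: moebius_mult inv2_inverse)

lemma moebius_eq_iff: "det A = 1 \<Longrightarrow> moebius_mat A \<xi> = moebius_mat A \<eta> \<longleftrightarrow> \<xi> = \<eta>"
  by (metis moebius_inv2(2))

lemma inv2_mult: "inv2 (A ** B) = inv2 B ** inv2 A"
  by (simp add: mat2_eq_iff mult2_nth algebra_simps)

lemma inv2_inv2 [simp]: "inv2 (inv2 A) = A"
  by (simp add: mat2_eq_iff)

lemma topspace_S2 [simp]: "topspace S2 = UNIV"
  unfolding S2_def topspace_Alexandroff_compactification by (auto simp: notin_range_Some)

lemma openin_S2: "openin S2 U \<longleftrightarrow> open {z. Some z \<in> U} \<and> (None \<in> U \<longrightarrow> (\<exists>R. \<forall>z. norm z > R \<longrightarrow> Some z \<in> U))"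
  (is "_ \<longleftrightarrow> ?rhs")
proof
  assume "openin S2 U"
  then consider V where "open V" "U = Some ` V" | C where "compact C" "U = insert None (Some ` (UNIV - C))"
    unfolding S2_def openin_Alexandroff_compactification by auto
  then show ?rhs
  proof cases
    case 1
    then have "{z. Some z \<in> U} = V" by auto
    with 1 show ?thesis by auto
  next
    case 2
    then have "{z. Some z \<in> U} = - C" by auto
    moreover obtain R where "\<And>z. z \<in> C \<Longrightarrow> norm z \<le> R"
      using compact_imp_bounded[OF 2(1)] unfolding bounded_iff by blast
    then have "\<forall>z. norm z > R \<longrightarrow> Some z \<in> U" using 2(2) by (auto simp: not_le[symmetric])
    ultimately show ?thesis using 2(1) by (auto intro: compact_imp_closed)
  qed
next
  assume r: ?rhs
  define V where "V = {z. Some z \<in> U}"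
  have "open V" using r by (simp add: V_def)
  show "openin S2 U"
  proof (cases "None \<in> U")
    case False
    then have "U = Some ` V" using not_None_eq by (auto simp: V_def image_iff) (metis not_None_eq)
    then show ?thesis using \<open>open V\<close> unfolding S2_def openin_Alexandroff_compactification by auto
  next
    case True
    then obtain R where R: "\<forall>z. norm z > R \<longrightarrow> Some z \<in> U" using r by blast
    have "bounded (- V)" unfolding bounded_iff
    proof (intro exI ballI)
      fix z assume "z \<in> - V"
      then show "norm z \<le> R" using R by (metis (mono_tags) ComplD V_def mem_Collect_eq not_less)
    qed
    then have "compact (- V)" using \<open>open V\<close> by (simp add: compact_eq_bounded_closed closed_Compl)
    moreover have "U = insert None (Some ` (UNIV - (- V)))"
      using True by (auto simp: V_def image_iff) (metis not_None_eq)
    ultimately show ?thesis unfolding S2_def openin_Alexandroff_compactification by (auto simp: compact_imp_closed)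
  qed
qed

lemma limitin_hom_point:
  assumes u: "(u \<longlongrightarrow> u0) Fl" and v: "(v \<longlongrightarrow> v0) Fl" and nz: "u0 \<noteq> 0 \<or> v0 \<noteq> 0"
  shows "limitin S2 (\<lambda>t. hom_point (u t) (v t)) (hom_point u0 v0) Fl"
  unfolding limitin_def
proof (intro conjI allI impI, simp, elim conjE)
  fix U assume U: "openin S2 U" "hom_point u0 v0 \<in> U"
  show "\<forall>\<^sub>F t in Fl. hom_point (u t) (v t) \<in> U"
  proof (cases "v0 = 0")
    case False
    have "\<forall>\<^sub>F t in Fl. v t \<noteq> 0" by (rule tendsto_imp_eventually_ne[OF v False])
    moreover have "((\<lambda>t. u t / v t) \<longlongrightarrow> u0 / v0) Fl" by (intro tendsto_intros u v False)
    then have "\<forall>\<^sub>F t in Fl. u t / v t \<in> {z. Some z \<in> U}"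
      by (rule topological_tendstoD) (use U False in \<open>auto simp: openin_S2 hom_point_def\<close>)
    ultimately show ?thesis by eventually_elim (simp add: hom_point_def)
  next
    case True
    then have N: "None \<in> U" and "u0 \<noteq> 0" using U nz by (auto simp: hom_point_def)
    then obtain R where R: "\<forall>z. norm z > R \<longrightarrow> Some z \<in> U" using U(1) unfolding openin_S2 by blast
    \<comment> \<open>Lying outside radius \<open>R\<close> is expressed without division, so that
      \<open>v t = 0\<close> needs no separate limit.\<close>
    have "((\<lambda>t. norm (u t) - R * norm (v t)) \<longlongrightarrow> norm u0 - R * norm (0::complex)) Fl"
      using True by (intro tendsto_intros u v) (use v in auto)
    then have "\<forall>\<^sub>F t in Fl. norm (u t) - R * norm (v t) > 0"
      by (rule order_tendstoD(1)) (use \<open>u0 \<noteq> 0\<close> in simp)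
    then show ?thesis
    proof eventually_elim
      case (elim t)
      then show ?case using N R by (auto simp: hom_point_def norm_divide field_simps)
    qed
  qed
qed

lemma limitin_eventually_mem:
  "limitin X f l Fl \<Longrightarrow> openin X U \<Longrightarrow> l \<in> U \<Longrightarrow> \<forall>\<^sub>F x in Fl. f x \<in> U"
  by (simp add: limitin_def)

lemma continuous_map_S2I:
  assumes 1: "\<And>z. limitin S2 (\<lambda>z. g (Some z)) (g (Some z)) (nhds z)"
    and 2: "limitin S2 (\<lambda>z. g (Some z)) (g None) at_infinity"
  shows "continuous_map S2 S2 g"
  unfolding continuous_map_def
proof (intro conjI allI impI)
  fix U assume U: "openin S2 U"
  have "open {z. g (Some z) \<in> U}"
  proof (subst open_subopen, rule ballI)
    fix z assume "z \<in> {z. g (Some z) \<in> U}"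
    then have gz: "g (Some z) \<in> U" by simp
    have "\<forall>\<^sub>F z in nhds z. g (Some z) \<in> U" by (rule limitin_eventually_mem[OF 1[of z] U gz])
    then show "\<exists>T. open T \<and> z \<in> T \<and> T \<subseteq> {z. g (Some z) \<in> U}"
      unfolding eventually_nhds by blast
  qed
  moreover have "\<exists>R. \<forall>z. norm z > R \<longrightarrow> g (Some z) \<in> U" if "g None \<in> U"
  proof -
    have "\<forall>\<^sub>F z in at_infinity. g (Some z) \<in> U" by (rule limitin_eventually_mem[OF 2 U that])
    then have "\<exists>b. \<forall>z. b \<le> norm z \<longrightarrow> g (Some z) \<in> U" by (simp only: eventually_at_infinity)
    then obtain b where b: "\<forall>z. b \<le> norm z \<longrightarrow> g (Some z) \<in> U" ..
    show ?thesis by (intro exI[of _ b] allI impI b[rule_format]) simp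
  qed
  ultimately show "openin S2 {x \<in> topspace S2. g x \<in> U}" by (simp add: openin_S2)
qed auto

lemma moebius_continuous:
  assumes "det A = 1" shows "continuous_map S2 S2 (moebius_mat A)"
proof (rule continuous_map_S2I)
  have eq: "moebius_mat A (Some z) = hom_point (A$1$1 * z + A$1$2) (A$2$1 * z + A$2$2)" for z
    using moebius_hom_point[of z 1 A] by (simp add: hom_point_simps)
  show "limitin S2 (\<lambda>z. moebius_mat A (Some z)) (moebius_mat A (Some z)) (nhds z)" for z
    unfolding eq using mat2_vec_nonzero[OF assms, of z 1]
    by (intro limitin_hom_point tendsto_intros filterlim_ident) auto
  have N: "moebius_mat A None = hom_point (A$1$1) (A$2$1)"
    using moebius_hom_point[of 1 0 A] by (simp add: hom_point_simps)
  have inv: "((\<lambda>z::complex. inverse z) \<longlongrightarrow> 0) at_infinity" by (rule tendsto_inverse_0)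
  \<comment> \<open>Dividing both homogeneous coordinates by \<open>z\<close> gives pairs that
    converge at infinity.\<close>
  have "limitin S2 (\<lambda>z. hom_point (A$1$1 + A$1$2 * inverse z) (A$2$1 + A$2$2 * inverse z))
     (hom_point (A$1$1 + A$1$2 * 0) (A$2$1 + A$2$2 * 0)) at_infinity"
    using mat2_vec_nonzero[OF assms, of 1 0] by (intro limitin_hom_point tendsto_intros inv) auto
  moreover have "\<forall>\<^sub>F z::complex in at_infinity. z \<noteq> 0"
    by (rule eventually_not_equal_at_infinity)
  then have "\<forall>\<^sub>F z in at_infinity. hom_point (A$1$1 + A$1$2 * inverse z) (A$2$1 + A$2$2 * inverse z) = moebius_mat A (Some z)"
  proof eventually_elim
    case (elim z)
    have "hom_point (z * (A$1$1 + A$1$2 * inverse z)) (z * (A$2$1 + A$2$2 * inverse z)) =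
      hom_point (A$1$1 + A$1$2 * inverse z) (A$2$1 + A$2$2 * inverse z)"
      using elim by (rule hom_point_scale)
    moreover have "z * (A$i$1 + A$i$2 * inverse z) = A$i$1 * z + A$i$2" for i
      using elim by (simp add: field_simps)
    ultimately show ?case by (simp add: eq)
  qed
  ultimately show "limitin S2 (\<lambda>z. moebius_mat A (Some z)) (moebius_mat A None) at_infinity"
    unfolding N by (simp add: limitin_transform_eventually)
qed

lemma continuous_map_S2_Some: "continuous_map euclidean S2 Some"
  unfolding S2_def by (rule continuous_map_Some)

section \<open>Circles as null sets of Hermitian forms\<close>

definition herm :: "real \<Rightarrow> complex \<Rightarrow> real \<Rightarrow> complex \<Rightarrow> complex \<Rightarrow> real"
  where "herm p b q x y = p * norm x ^ 2 + 2 * Re (cnj b * x * cnj y) + q * norm y ^ 2"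

lemma herm_scale: "herm p b q (s * x) (s * y) = norm s ^ 2 * herm p b q x y"
proof -
  have "cnj b * (s * x) * cnj (s * y) = of_real (norm s ^ 2) * (cnj b * x * cnj y)"
    unfolding complex_norm_square complex_cnj_mult complex_cnj_cnj by (simp only: mult_ac)
  moreover have "Re (of_real t * w) = t * Re w" for t w by simp
  ultimately have "Re (cnj b * (s * x) * cnj (s * y)) = norm s ^ 2 * Re (cnj b * x * cnj y)" by (simp only:)
  then show ?thesis unfolding herm_def norm_mult power_mult_distrib by (simp only: algebra_simps)
qed

definition hcircle :: "real \<Rightarrow> complex \<Rightarrow> real \<Rightarrow> complex option set"
  where "hcircle p b q = {\<xi>. \<exists>x y. (x \<noteq> 0 \<or> y \<noteq> 0) \<and> \<xi> = hom_point x y \<and> herm p b q x y = 0}"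

lemma hom_point_in_hcircle:
  assumes "x \<noteq> 0 \<or> y \<noteq> 0"
  shows "hom_point x y \<in> hcircle p b q \<longleftrightarrow> herm p b q x y = 0"
proof
  assume "hom_point x y \<in> hcircle p b q"
  then obtain u v where uv: "u \<noteq> 0 \<or> v \<noteq> 0" "hom_point x y = hom_point u v" "herm p b q u v = 0"
    by (auto simp: hcircle_def)
  have e: "x * v = u * y" using uv assms by (simp add: hom_point_eq_iff)
  have "\<exists>s. s \<noteq> 0 \<and> u = s * x \<and> v = s * y"
  proof (cases "x = 0")
    case True
    then show ?thesis using e assms uv by (intro exI[of _ "v / y"]) auto
  next
    case False
    then show ?thesis using e uv(1) by (intro exI[of _ "u / x"]) (auto simp: field_simps)
  qed
  then show "herm p b q x y = 0" using uv(3) by (auto simp: herm_scale)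
qed (use assms in \<open>auto simp: hcircle_def\<close>)

lemma Some_in_hcircle: "Some z \<in> hcircle p b q \<longleftrightarrow> p * norm z ^ 2 + 2 * Re (cnj b * z) + q = 0"
proof -
  have "hom_point z 1 \<in> hcircle p b q \<longleftrightarrow> herm p b q z 1 = 0" by (rule hom_point_in_hcircle) simp
  then show ?thesis
    unfolding hom_point_simps(1) herm_def by (simp only: complex_cnj_one mult_1_right norm_one power_one)
qed

lemma None_in_hcircle: "None \<in> hcircle p b q \<longleftrightarrow> p = 0"
proof -
  have "hom_point 1 0 \<in> hcircle p b q \<longleftrightarrow> herm p b q 1 0 = 0" by (rule hom_point_in_hcircle) simp
  moreover have "herm p b q 1 0 = p" by (simp add: herm_def)
  ultimately show ?thesis by (simp only: hom_point_simps(2)[OF one_neq_zero])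
qed

lemma circle_hcircle: "r > 0 \<Longrightarrow> circle c r = hcircle 1 (- c) (norm c ^ 2 - r ^ 2)"
proof -
  assume r: "r > 0"
  have *: "norm (c - z) = r \<longleftrightarrow> norm z ^ 2 + 2 * Re (cnj (- c) * z) + (norm c ^ 2 - r ^ 2) = 0" for z
  proof -
    have "norm (c - z) = r \<longleftrightarrow> norm (c - z) ^ 2 = r ^ 2"
      using r power2_eq_imp_eq[of "norm (c - z)" r] by auto
    moreover have "norm (c - z) ^ 2 = norm z ^ 2 + 2 * Re (cnj (- c) * z) + norm c ^ 2"
      unfolding cmod_power2 by (simp add: power2_eq_square algebra_simps)
    ultimately show ?thesis unfolding add_diff_eq eq_iff_diff_eq_0[symmetric] by simp
  qed
  have "\<xi> \<in> circle c r \<longleftrightarrow> \<xi> \<in> hcircle 1 (- c) (norm c ^ 2 - r ^ 2)" for \<xi>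
  proof (cases \<xi>)
    case None
    then show ?thesis by (auto simp: circle_def None_in_hcircle)
  next
    case (Some z)
    have "\<xi> \<in> circle c r \<longleftrightarrow> norm (c - z) = r" by (auto simp: Some circle_def dist_norm)
    then show ?thesis unfolding Some Some_in_hcircle * by (simp only: mult_1)
  qed
  then show ?thesis by blast
qed

lemma line_hcircle: "line a b = hcircle 0 (a / 2) (- b)"
proof -
  have *: "2 * Re (cnj (a / 2) * z) = a \<bullet> z" for z
    by (simp add: inner_complex_def field_simps)
  have "\<xi> \<in> line a b \<longleftrightarrow> \<xi> \<in> hcircle 0 (a / 2) (- b)" for \<xi>
  proof (cases \<xi>)
    case None
    then show ?thesis by (auto simp: line_def None_in_hcircle)
  next
    case (Some z)
    have "\<xi> \<in> line a b \<longleftrightarrow> a \<bullet> z = b" by (auto simp: Some line_def)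
    then show ?thesis unfolding Some Some_in_hcircle * by simp
  qed
  then show ?thesis by blast
qed

text \<open>The inequality says that the Hermitian form with diagonal entries \<open>p\<close>,
  \<open>q\<close> and off-diagonal entry \<open>b\<close> has negative determinant, that is, is
  indefinite; it excludes the null sets that are empty, a point or everything.\<close>

lemma circles_eq: "circles = {hcircle p b q |p b q. norm b ^ 2 > p * q}"
proof (intro equalityI subsetI)
  fix C assume "C \<in> circles"
  then consider c r where "r > 0" "C = circle c r" | a b where "a \<noteq> 0" "C = line a b"
    by (auto simp: circles_def)
  then show "C \<in> {hcircle p b q |p b q. norm b ^ 2 > p * q}"
  proof cases
    case 1
    then show ?thesis unfolding circle_hcircle[OF 1(1)] 1(2)
      by (intro CollectI exI[of _ 1] exI[of _ "- c"] exI[of _ "norm c ^ 2 - r ^ 2"]) auto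
  next
    case 2
    then show ?thesis unfolding line_hcircle
      by (intro CollectI exI[of _ 0] exI[of _ "a / 2"] exI[of _ "- b"]) auto
  qed
next
  fix C assume "C \<in> {hcircle p b q |p b q. norm b ^ 2 > p * q}"
  then obtain p b q where C: "C = hcircle p b q" "norm b ^ 2 > p * q" by blast
  show "C \<in> circles"
  proof (cases "p = 0")
    case True
    then have "C = line (2 * b) (- q)" "2 * b \<noteq> 0" using C by (auto simp: line_hcircle)
    then show ?thesis unfolding circles_def by blast
  next
    case False
    \<comment> \<open>Dividing the equation by \<open>p\<close> and completing the square gives the
      centre \<open>- b / p\<close> and this radius.\<close>
    define r where "r = sqrt ((norm b ^ 2 - p * q) / p ^ 2)"
    have r: "r > 0" "r ^ 2 = (norm b ^ 2 - p * q) / p ^ 2" using C False by (auto simp: r_def)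
    have e1: "p * (norm (b / of_real p) ^ 2 - r ^ 2) = q"
    proof -
      have "norm (b / of_real p) ^ 2 - r ^ 2 = norm b ^ 2 / p ^ 2 - (norm b ^ 2 - p * q) / p ^ 2"
        by (simp add: r(2) norm_divide power_divide)
      also have "\<dots> = q / p" using False by (simp add: field_simps power2_eq_square)
      finally show ?thesis using False by simp
    qed
    have "herm p b q x y = p * herm 1 (b / of_real p) (norm (b / of_real p) ^ 2 - r ^ 2) x y" for x y
    proof -
      have e: "of_real p * (cnj (b / of_real p) * x * cnj y) = cnj b * x * cnj y" using False by simp
      have re: "Re (of_real p * w) = p * Re w" for w by simp
      have "p * Re (cnj (b / of_real p) * x * cnj y) = Re (cnj b * x * cnj y)"
        unfolding re[symmetric] e ..
      then show ?thesis unfolding herm_def e1[symmetric] by (simp only: algebra_simps)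
    qed
    then have "C = circle (- (b / of_real p)) r"
      using False unfolding circle_hcircle[OF r(1)] C(1) hcircle_def by simp
    then show ?thesis using r(1) unfolding circles_def by blast
  qed
qed

text \<open>A linear substitution acts on the matrix of the form by congruence, which multiplies its
  determinant by the squared norm of the determinant of the substitution; invertible substitutions
  thus preserve indefiniteness.\<close>

lemma herm_linear:
  fixes \<alpha> \<beta> \<gamma> \<delta> b :: complex and p q :: real
  defines "p' \<equiv> herm p b q \<alpha> \<gamma>" and "q' \<equiv> herm p b q \<beta> \<delta>"
    and "b' \<equiv> cnj (p * \<alpha> * cnj \<beta> + cnj b * \<alpha> * cnj \<delta> + b * cnj \<beta> * \<gamma> + q * \<gamma> * cnj \<delta>)"
  shows "herm p b q (\<alpha> * x + \<beta> * y) (\<gamma> * x + \<delta> * y) = herm p' b' q' x y"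
    and "norm b' ^ 2 - p' * q' = norm (\<alpha> * \<delta> - \<beta> * \<gamma>) ^ 2 * (norm b ^ 2 - p * q)"
proof -
  show "herm p b q (\<alpha> * x + \<beta> * y) (\<gamma> * x + \<delta> * y) = herm p' b' q' x y"
    unfolding p'_def q'_def b'_def herm_def cmod_power2
    by (simp add: power2_eq_square algebra_simps)
  have of_herm: "of_real (herm p b q x y) = of_real p * x * cnj x + cnj b * x * cnj y + b * cnj x * y + of_real q * y * cnj y" for x y :: complex
  proof -
    have "of_real (2 * Re (cnj b * x * cnj y)) = cnj b * x * cnj y + cnj (cnj b * x * cnj y)"
      by (simp only: complex_add_cnj)
    then show ?thesis unfolding herm_def of_real_add complex_norm_square of_real_mult[of p] of_real_mult[of q] by (simp only:) (simp only: complex_cnj_mult complex_cnj_cnj algebra_simps)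
  qed
  have "of_real (norm b' ^ 2 - p' * q') = (of_real (norm (\<alpha> * \<delta> - \<beta> * \<gamma>) ^ 2 * (norm b ^ 2 - p * q)) :: complex)"
    unfolding of_real_diff of_real_mult complex_norm_square p'_def q'_def of_herm unfolding b'_def
    by (simp add: algebra_simps)
  then show "norm b' ^ 2 - p' * q' = norm (\<alpha> * \<delta> - \<beta> * \<gamma>) ^ 2 * (norm b ^ 2 - p * q)"
    by (simp only: of_real_eq_iff)
qed

lemma concyclic_moebius:
  assumes "concyclic X" "det M = 1" shows "concyclic (moebius_mat M ` X)"
proof -
  obtain p b q where pbq: "norm b ^ 2 > p * q" "X \<subseteq> hcircle p b q"
    using assms(1) unfolding concyclic_def circles_eq by blast
  \<comment> \<open>Coefficients of the form after substituting the inverse of \<open>M\<close>,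
    whose rows are \<open>(M$2$2, - M$1$2)\<close> and \<open>(- M$2$1, M$1$1)\<close>.\<close>
  define p' q' b' where "p' = herm p b q (M$2$2) (- M$2$1)" and "q' = herm p b q (- M$1$2) (M$1$1)"
    and "b' = cnj (p * M$2$2 * cnj (- M$1$2) + cnj b * M$2$2 * cnj (M$1$1) + b * cnj (- M$1$2) * (- M$2$1) + q * (- M$2$1) * cnj (M$1$1))"
  have h: "herm p b q (M$2$2 * x + - M$1$2 * y) (- M$2$1 * x + M$1$1 * y) = herm p' b' q' x y" for x y
    unfolding p'_def q'_def b'_def by (rule herm_linear(1))
  have "norm b' ^ 2 - p' * q' = norm (M$2$2 * M$1$1 - (- M$1$2) * (- M$2$1)) ^ 2 * (norm b ^ 2 - p * q)"
    unfolding p'_def q'_def b'_def by (rule herm_linear(2))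
  also have "M$2$2 * M$1$1 - (- M$1$2) * (- M$2$1) = det M" by (simp add: det_2 mult.commute)
  finally have "norm b' ^ 2 > p' * q'" using pbq assms(2) by simp
  moreover have "moebius_mat M ` X \<subseteq> hcircle p' b' q'"
  proof
    fix \<eta> assume "\<eta> \<in> moebius_mat M ` X"
    then obtain \<xi> where \<xi>: "\<xi> \<in> X" "\<eta> = moebius_mat M \<xi>" by blast
    obtain x y where xy: "\<xi> = hom_point x y" "x \<noteq> 0 \<or> y \<noteq> 0" by (rule hom_point_cases)
    have 0: "herm p b q x y = 0" using \<xi>(1) pbq(2) xy by (auto simp: hom_point_in_hcircle)
    have "M$2$2 * (M$1$1 * x + M$1$2 * y) + - M$1$2 * (M$2$1 * x + M$2$2 * y) = det M * x"
      "- M$2$1 * (M$1$1 * x + M$1$2 * y) + M$1$1 * (M$2$1 * x + M$2$2 * y) = det M * y"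
      by (simp_all add: det_2 algebra_simps)
    then have "herm p' b' q' (M$1$1 * x + M$1$2 * y) (M$2$1 * x + M$2$2 * y) = 0"
      unfolding h[symmetric] using 0 assms(2) by simp
    then show "\<eta> \<in> hcircle p' b' q'"
      unfolding \<xi>(2) xy(1) moebius_hom_point[OF xy(2)]
      by (simp only: hom_point_in_hcircle[OF mat2_vec_nonzero[OF assms(2) xy(2)]])
  qed
  ultimately show ?thesis unfolding concyclic_def circles_eq by blast
qed

lemma concyclic_line:
  assumes "x \<noteq> y" "Im ((y - x) * cnj (z - x)) = 0"
  shows "concyclic {None, Some x, Some y, Some z}"
proof -
  define a where "a = \<i> * (y - x)"
  have "a \<bullet> y = a \<bullet> x" "a \<bullet> z = a \<bullet> x"
    using assms(2) by (simp_all add: a_def inner_complex_def algebra_simps)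
  then have "{None, Some x, Some y, Some z} \<subseteq> line a (a \<bullet> x)" by (simp add: line_def)
  moreover have "a \<noteq> 0" using assms(1) by (simp add: a_def)
  ultimately show ?thesis unfolding concyclic_def circles_def by blast
qed

lemma concyclic_None_imp:
  assumes "concyclic {None, Some x, Some y, Some z}"
  shows "Im ((y - x) * cnj (z - x)) = 0"
proof -
  obtain p b q where pbq: "norm b ^ 2 > p * q" "{None, Some x, Some y, Some z} \<subseteq> hcircle p b q"
    using assms unfolding concyclic_def circles_eq by blast
  then have p: "p = 0" by (simp add: None_in_hcircle)
  then have b: "b \<noteq> 0" using pbq by auto
  have e: "2 * Re (cnj b * x) + q = 0" "2 * Re (cnj b * y) + q = 0" "2 * Re (cnj b * z) + q = 0"
    using pbq(2) p by (simp_all add: Some_in_hcircle)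
  have 0: "Re (cnj b * (y - x)) = 0" "Re (cnj b * (z - x)) = 0"
    using e by (simp_all only: right_diff_distrib minus_complex.sel)
  have "Im ((cnj b * (y - x)) * cnj (cnj b * (z - x))) = 0"
    unfolding times_complex.sel(2) complex_cnj 0 by (simp only: cnj.simps 0)
  moreover have "(cnj b * (y - x)) * cnj (cnj b * (z - x)) = of_real (norm b ^ 2) * ((y - x) * cnj (z - x))"
    unfolding complex_norm_square complex_cnj_mult complex_cnj_cnj by (simp only: mult_ac)
  moreover have "Im (of_real t * w) = t * Im w" for t w by simp
  ultimately have "norm b ^ 2 * Im ((y - x) * cnj (z - x)) = 0" by (simp only:)
  then show ?thesis using b by simp
qed

section \<open>Limit points as images of degenerate limits of matrices\<close>

definition matrices :: "(complex^2^2) set set \<Rightarrow> (complex^2^2) set"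
  where "matrices \<Gamma> = \<Union>\<Gamma>"

lemma PSL2C_elem:
  assumes "\<gamma> \<in> carrier PSL2C" "A \<in> \<gamma>" shows "\<gamma> = {A, - A}" "det A = 1"
proof -
  obtain C where C: "\<gamma> = {C, - C}" "det C = 1" using assms(1) unfolding carrier_PSL2C by blast
  then consider "A = C" | "A = - C" using assms(2) by blast
  then have "\<gamma> = {A, - A} \<and> det A = 1"
  proof cases
    case 2
    then show ?thesis using C by (simp add: insert_commute det_2)
  qed (use C in simp)
  then show "\<gamma> = {A, - A}" "det A = 1" by blast+
qed

lemma mult_PSL2C: "\<gamma> \<otimes>\<^bsub>PSL2C\<^esub> \<delta> = {A ** B |A B. A \<in> \<gamma> \<and> B \<in> \<delta>}"
  unfolding PSL2C_def FactGroup_def set_mult_def monoid.simps mult_SL2C by blast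

lemma one_PSL2C: "\<one>\<^bsub>PSL2C\<^esub> = {mat 1, - mat 1}"
  unfolding PSL2C_def FactGroup_def by simp

lemma mem_mult_PSL2C: "A \<in> \<gamma> \<Longrightarrow> B \<in> \<delta> \<Longrightarrow> A ** B \<in> \<gamma> \<otimes>\<^bsub>PSL2C\<^esub> \<delta>"
  unfolding mult_PSL2C by blast

lemma inverse_eq_inv2:
  assumes "det A = 1" "A ** C = mat 1" shows "C = inv2 A"
proof -
  have "inv2 A ** (A ** C) = C" using assms(1) by (simp add: matrix_mul_assoc inv2_inverse)
  then show ?thesis by (simp add: assms(2))
qed

lemma inv_PSL2C:
  assumes "\<gamma> \<in> carrier PSL2C" "A \<in> \<gamma>" shows "inv2 A \<in> inv\<^bsub>PSL2C\<^esub> \<gamma>"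
proof -
  interpret group PSL2C by (rule group_PSL2C)
  have inv: "inv\<^bsub>PSL2C\<^esub> \<gamma> \<in> carrier PSL2C" "\<gamma> \<otimes>\<^bsub>PSL2C\<^esub> inv\<^bsub>PSL2C\<^esub> \<gamma> = \<one>\<^bsub>PSL2C\<^esub>" using assms by simp_all
  then obtain C where C: "C \<in> inv\<^bsub>PSL2C\<^esub> \<gamma>" by (auto simp: carrier_PSL2C)
  have "A ** C \<in> \<one>\<^bsub>PSL2C\<^esub>" using mem_mult_PSL2C[OF assms(2) C] unfolding inv(2) .
  then have "A ** C = mat 1 \<or> A ** C = - mat 1" unfolding one_PSL2C by blast
  then have "A ** C = mat 1 \<or> A ** (- C) = mat 1" unfolding matrix_uminus_mult by (metis minus_minus)
  then have "C = inv2 A \<or> - C = inv2 A" using inverse_eq_inv2 PSL2C_elem(2)[OF assms] by blast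
  moreover have "- C \<in> inv\<^bsub>PSL2C\<^esub> \<gamma>" using PSL2C_elem(1)[OF inv(1) C] by blast
  ultimately show ?thesis using C by metis
qed

context
  fixes \<Gamma> assumes sub: "subgroup \<Gamma> PSL2C"
begin

lemma matrices_carrier: "\<gamma> \<in> \<Gamma> \<Longrightarrow> \<gamma> \<in> carrier PSL2C"
  using sub by (meson subgroup.mem_carrier)

lemma matrices_det: "A \<in> matrices \<Gamma> \<Longrightarrow> det A = 1"
  unfolding matrices_def using PSL2C_elem(2) matrices_carrier by blast

lemma matrices_mult: "A \<in> matrices \<Gamma> \<Longrightarrow> B \<in> matrices \<Gamma> \<Longrightarrow> A ** B \<in> matrices \<Gamma>"
  unfolding matrices_def using mem_mult_PSL2C subgroup.m_closed[OF sub] by blast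

lemma matrices_inv: "A \<in> matrices \<Gamma> \<Longrightarrow> inv2 A \<in> matrices \<Gamma>"
  unfolding matrices_def using inv_PSL2C matrices_carrier subgroup.m_inv_closed[OF sub] by blast

lemma matrices_one: "mat 1 \<in> matrices \<Gamma>"
  unfolding matrices_def using subgroup.one_closed[OF sub] one_PSL2C by blast

end

section \<open>The Poincare extension in terms of matrix entries\<close>

definition denom :: "complex^2^2 \<Rightarrow> complex \<times> real \<Rightarrow> real"
  where "denom A q = norm (A$2$1 * fst q + A$2$2) ^ 2 + norm (A$2$1) ^ 2 * snd q ^ 2"

definition numer :: "complex^2^2 \<Rightarrow> complex \<times> real \<Rightarrow> real"
  where "numer A q = norm (A$1$1 * fst q + A$1$2) ^ 2 + norm (A$1$1) ^ 2 * snd q ^ 2"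

definition cross :: "complex^2^2 \<Rightarrow> complex \<times> real \<Rightarrow> complex"
  where "cross A q = (A$1$1 * fst q + A$1$2) * cnj (A$2$1 * fst q + A$2$2) + A$1$1 * cnj (A$2$1) * of_real (snd q ^ 2)"

lemma poincare_mat_eq: "poincare_mat A q = (cross A q / of_real (denom A q), snd q / denom A q)"
  by (cases q) (simp add: poincare_mat_def Let_def cross_def denom_def)

text \<open>\<open>numer\<close>, \<open>denom\<close> and \<open>cross\<close> are the inner
  products of the rows of \<open>A\<close> for a Hermitian form of determinant
  \<open>snd q ^ 2\<close>, so this is the transformation rule of Gram determinants.\<close>

lemma numer_denom: "numer A q * denom A q - norm (cross A q) ^ 2 = norm (det A) ^ 2 * snd q ^ 2"
proof -
  have "of_real (numer A q * denom A q - norm (cross A q) ^ 2) = (of_real (norm (det A) ^ 2 * snd q ^ 2) :: complex)"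
    unfolding of_real_diff of_real_mult complex_norm_square numer_def denom_def cross_def det_2 of_real_add
    by (simp add: algebra_simps power2_eq_square)
  then show ?thesis by (simp only: of_real_eq_iff)
qed

lemma denom_pos: assumes "A$2$1 \<noteq> 0 \<or> A$2$2 \<noteq> 0" "snd q > 0" shows "denom A q > 0"
proof (cases "A$2$1 = 0")
  case False
  then have "norm (A$2$1) ^ 2 * snd q ^ 2 > 0" using assms by simp
  then show ?thesis unfolding denom_def by (simp add: add_nonneg_pos)
qed (use assms in \<open>simp add: denom_def\<close>)

lemma numer_pos: assumes "A$1$1 \<noteq> 0 \<or> A$1$2 \<noteq> 0" "snd q > 0" shows "numer A q > 0"
proof (cases "A$1$1 = 0")
  case False
  then have "norm (A$1$1) ^ 2 * snd q ^ 2 > 0" using assms by simp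
  then show ?thesis unfolding numer_def by (simp add: add_nonneg_pos)
qed (use assms in \<open>simp add: numer_def\<close>)

lemma rows_nonzero:
  fixes A :: "complex^2^2"
  assumes "det A = 1" shows "A$2$1 \<noteq> 0 \<or> A$2$2 \<noteq> 0" "A$1$1 \<noteq> 0 \<or> A$1$2 \<noteq> 0"
  using assms by (auto simp: det_2)

lemma poincare_in_H3: assumes "det A = 1" "q \<in> H3" shows "snd (poincare_mat A q) > 0"
  using denom_pos[of A q] rows_nonzero[OF assms(1)] assms(2) by (auto simp: poincare_mat_eq H3_def)

lemma norm_poincare:
  assumes "det A = 1" "snd q > 0" shows "norm (poincare_mat A q) ^ 2 = numer A q / denom A q"
proof -
  have D: "denom A q > 0" using denom_pos rows_nonzero assms by blast
  have "norm (poincare_mat A q) ^ 2 = (norm (cross A q) ^ 2 + snd q ^ 2) / denom A q ^ 2"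
    using D by (simp add: poincare_mat_eq norm_Pair norm_divide power_divide add_divide_distrib)
  also have "norm (cross A q) ^ 2 + snd q ^ 2 = numer A q * denom A q"
    using numer_denom[of A q] assms by simp
  finally show ?thesis using D by (simp add: power2_eq_square)
qed

lemma scaleR_entries: "denom (s *\<^sub>R A) q = s ^ 2 * denom A q" "numer (s *\<^sub>R A) q = s ^ 2 * numer A q"
  "cross (s *\<^sub>R A) q = of_real (s ^ 2) * cross A q"
proof -
  have *: "of_real s * x * z + of_real s * y = of_real s * (x * z + y)" for x y z :: complex
    by (simp add: algebra_simps)
  show "denom (s *\<^sub>R A) q = s ^ 2 * denom A q" "numer (s *\<^sub>R A) q = s ^ 2 * numer A q"
    unfolding denom_def numer_def vector_scaleR_component scaleR_conv_of_real[where 'a = complex] *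
    by (simp_all only: norm_mult norm_of_real power_mult_distrib power2_abs mult.assoc distrib_left[of "s ^ 2"])
  show "cross (s *\<^sub>R A) q = of_real (s ^ 2) * cross A q"
    unfolding cross_def vector_scaleR_component scaleR_conv_of_real[where 'a = complex] *
    by (simp add: power2_eq_square algebra_simps)
qed

lemma tendsto_entries:
  fixes A :: "'a \<Rightarrow> complex^2^2"
  assumes "(A \<longlongrightarrow> B) Fl"
  shows "((\<lambda>n. denom (A n) q) \<longlongrightarrow> denom B q) Fl" "((\<lambda>n. numer (A n) q) \<longlongrightarrow> numer B q) Fl"
    "((\<lambda>n. cross (A n) q) \<longlongrightarrow> cross B q) Fl" "((\<lambda>n. det (A n)) \<longlongrightarrow> det B) Fl"
  unfolding denom_def numer_def cross_def det_2 by (intro tendsto_intros assms)+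

lemma tendsto_mult2:
  fixes A B :: "'a \<Rightarrow> complex^2^2"
  assumes "(A \<longlongrightarrow> X) Fl" "(B \<longlongrightarrow> Y) Fl" shows "((\<lambda>n. A n ** B n) \<longlongrightarrow> X ** Y) Fl"
  by (intro vec_tendstoI, unfold mult2_nth) (intro tendsto_intros assms)

lemma tendsto_mat2:
  assumes "(a \<longlongrightarrow> a') Fl" "(b \<longlongrightarrow> b') Fl" "(c \<longlongrightarrow> c') Fl" "(d \<longlongrightarrow> d') Fl"
  shows "((\<lambda>n. mat2 (a n) (b n) (c n) (d n)) \<longlongrightarrow> mat2 a' b' c' d') Fl"
proof (intro vec_tendstoI)
  show "((\<lambda>n. mat2 (a n) (b n) (c n) (d n) $ i $ j) \<longlongrightarrow> mat2 a' b' c' d' $ i $ j) Fl" for i j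
    using exhaust_2[of i] exhaust_2[of j] assms by auto
qed

text \<open>\<open>B\<close> has rank one and its image is the line in \<open>\<complex>\<^sup>2\<close> that represents \<open>\<xi>\<close>.\<close>

definition collapses :: "complex^2^2 \<Rightarrow> complex option \<Rightarrow> bool"
  where "collapses B \<xi> \<longleftrightarrow> B \<noteq> 0 \<and> (\<forall>x y. B$1$1 * x + B$1$2 * y \<noteq> 0 \<or> B$2$1 * x + B$2$2 * y \<noteq> 0 \<longrightarrow>
    hom_point (B$1$1 * x + B$1$2 * y) (B$2$1 * x + B$2$2 * y) = \<xi>)"

definition tends_to_boundary :: "(nat \<Rightarrow> complex \<times> real) \<Rightarrow> complex option \<Rightarrow> bool"
  where "tends_to_boundary q \<xi> \<longleftrightarrow> (case \<xi> of Some z \<Rightarrow> q \<longlonglongrightarrow> (z, 0)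
    | None \<Rightarrow> filterlim (\<lambda>n. norm (q n)) at_top sequentially)"

lemma tends_to_boundary_unique:
  assumes "tends_to_boundary q \<xi>" "tends_to_boundary q \<eta>" shows "\<xi> = \<eta>"
proof -
  have *: False if "q \<longlonglongrightarrow> l" "filterlim (\<lambda>n. norm (q n)) at_top sequentially" for l
    using not_tendsto_and_filterlim_at_infinity[OF _ that(1)] that(2)
    by (simp add: filterlim_norm_at_top_imp_at_infinity)
  show ?thesis using assms * LIMSEQ_unique[of q]
    by (cases \<xi>; cases \<eta>) (fastforce simp: tends_to_boundary_def)+
qed

text \<open>The rescaled matrices have determinant \<open>(1 / s n)^2\<close>, so \<open>B\<close>
  is singular; not being zero, it has rank one and proportional rows. The factor of proportionality
  is the boundary point, with infinity for a vanishing second row.\<close>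

lemma collapse_limit:
  assumes A: "\<And>n. det (A n) = 1" and s: "filterlim s at_top sequentially"
    and lim: "(\<lambda>n. (1 / s n) *\<^sub>R A n) \<longlonglongrightarrow> B" and B: "B \<noteq> 0" and q: "snd q > 0"
  obtains \<xi> where "collapses B \<xi>" "tends_to_boundary (\<lambda>n. poincare_mat (A n) q) \<xi>"
proof -
  have inv_s: "(\<lambda>n. 1 / s n) \<longlonglongrightarrow> 0"
    by (intro tendsto_divide_0[OF tendsto_const] filterlim_at_top_imp_at_infinity s)
  have spos: "\<forall>\<^sub>F n in sequentially. s n > 0" using s by (simp add: filterlim_at_top_dense)
  have "(\<lambda>n. det ((1 / s n) *\<^sub>R A n)) \<longlonglongrightarrow> det B" by (intro tendsto_entries lim)
  moreover have "det ((1 / s n) *\<^sub>R A n) = of_real ((1 / s n) ^ 2) * det (A n)" for n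
    unfolding det_2 vector_scaleR_component by (simp add: scaleR_conv_of_real[where 'a = complex] power2_eq_square algebra_simps)
  moreover have "(\<lambda>n. of_real ((1 / s n) ^ 2) :: complex) \<longlonglongrightarrow> of_real (0 ^ 2)"
    by (intro tendsto_intros inv_s)
  ultimately have "det B = 0" using LIMSEQ_unique A by fastforce
  then have dB: "B$1$1 * B$2$2 = B$1$2 * B$2$1" by (simp add: det_2)
  note lims = tendsto_entries(1-3)[OF lim, of q, unfolded scaleR_entries]
  show thesis
  proof (cases "B$2$1 = 0 \<and> B$2$2 = 0")
    case True
    then have row: "B$1$1 \<noteq> 0 \<or> B$1$2 \<noteq> 0" using B by (auto simp: mat2_eq_iff)
    have "filterlim (\<lambda>n. norm (poincare_mat (A n) q)) at_top sequentially"
    proof -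
      have "filterlim (\<lambda>n. ((1 / s n) ^ 2 * numer (A n) q) * inverse ((1 / s n) ^ 2 * denom (A n) q)) at_top sequentially"
      proof (rule filterlim_tendsto_pos_mult_at_top)
        show "(\<lambda>n. (1 / s n) ^ 2 * numer (A n) q) \<longlonglongrightarrow> numer B q" by (rule lims)
        show "numer B q > 0" by (rule numer_pos[OF row q])
        have "denom B q = 0" using True by (simp add: denom_def)
        then have "(\<lambda>n. (1 / s n) ^ 2 * denom (A n) q) \<longlonglongrightarrow> 0" using lims(1) by simp
        moreover have "\<forall>\<^sub>F n in sequentially. (1 / s n) ^ 2 * denom (A n) q > 0"
          using spos by eventually_elim (use denom_pos rows_nonzero A q in \<open>auto intro!: mult_pos_pos\<close>)
        ultimately show "filterlim (\<lambda>n. inverse ((1 / s n) ^ 2 * denom (A n) q)) at_top sequentially"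
          by (intro filterlim_inverse_at_top)
      qed
      moreover have "\<forall>\<^sub>F n in sequentially. ((1 / s n) ^ 2 * numer (A n) q) * inverse ((1 / s n) ^ 2 * denom (A n) q) =
          norm (poincare_mat (A n) q) ^ 2"
        using spos by eventually_elim (simp add: norm_poincare A q flip: divide_inverse)
      ultimately have "filterlim (\<lambda>n. norm (poincare_mat (A n) q) ^ 2) at_top sequentially"
        by (simp add: filterlim_cong)
      then have "filterlim (\<lambda>n. sqrt (norm (poincare_mat (A n) q) ^ 2)) at_top sequentially"
        by (rule filterlim_compose[OF sqrt_at_top])
      then show ?thesis by simp
    qed
    then have "tends_to_boundary (\<lambda>n. poincare_mat (A n) q) None" by (simp add: tends_to_boundary_def)
    moreover have "collapses B None" using True B by (auto simp: collapses_def hom_point_def)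
    ultimately show thesis using that by blast
  next
    case False
    define \<kappa> where "\<kappa> = (if B$2$1 = 0 then B$1$2 / B$2$2 else B$1$1 / B$2$1)"
    have \<kappa>: "B$1$1 = \<kappa> * B$2$1" "B$1$2 = \<kappa> * B$2$2"
      using False dB by (auto simp: \<kappa>_def field_simps)
    have D: "denom B q > 0" using denom_pos[of B q] False q by blast
    have "cross B q = \<kappa> * of_real (denom B q)"
    proof -
      have "B$1$1 * fst q + B$1$2 = \<kappa> * (B$2$1 * fst q + B$2$2)" by (simp add: \<kappa> algebra_simps)
      then have "cross B q = \<kappa> * ((B$2$1 * fst q + B$2$2) * cnj (B$2$1 * fst q + B$2$2) + B$2$1 * cnj (B$2$1) * of_real (snd q ^ 2))"
        unfolding cross_def \<kappa>(1) by (simp add: \<kappa> algebra_simps)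
      also have "\<dots> = \<kappa> * of_real (denom B q)" unfolding denom_def of_real_add of_real_mult complex_norm_square by simp
      finally show ?thesis .
    qed
    then have cr: "cross B q / of_real (denom B q) = \<kappa>" using D by simp
    have "(\<lambda>n. (of_real ((1 / s n) ^ 2) * cross (A n) q) / of_real ((1 / s n) ^ 2 * denom (A n) q)) \<longlonglongrightarrow> cross B q / of_real (denom B q)"
      using D by (intro tendsto_intros lims) auto
    moreover have "\<forall>\<^sub>F n in sequentially. (of_real ((1 / s n) ^ 2) * cross (A n) q) / of_real ((1 / s n) ^ 2 * denom (A n) q) =
        fst (poincare_mat (A n) q)"
      using spos by eventually_elim (simp add: poincare_mat_eq)
    ultimately have 1: "(\<lambda>n. fst (poincare_mat (A n) q)) \<longlonglongrightarrow> \<kappa>"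
      unfolding cr by (rule Lim_transform_eventually)
    have "(\<lambda>n. ((1 / s n) ^ 2 * snd q) / ((1 / s n) ^ 2 * denom (A n) q)) \<longlonglongrightarrow> (0 ^ 2 * snd q) / denom B q"
      using D by (intro tendsto_intros lims inv_s) auto
    moreover have "\<forall>\<^sub>F n in sequentially. ((1 / s n) ^ 2 * snd q) / ((1 / s n) ^ 2 * denom (A n) q) = snd (poincare_mat (A n) q)"
      using spos by eventually_elim (simp add: poincare_mat_eq)
    ultimately have 2: "(\<lambda>n. snd (poincare_mat (A n) q)) \<longlonglongrightarrow> 0"
      by (auto dest: Lim_transform_eventually)
    have "(\<lambda>n. poincare_mat (A n) q) \<longlonglongrightarrow> (\<kappa>, 0)"
      using tendsto_Pair[OF 1 2] by simp
    then have "tends_to_boundary (\<lambda>n. poincare_mat (A n) q) (Some \<kappa>)" by (simp add: tends_to_boundary_def)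
    moreover have "collapses B (Some \<kappa>)"
    proof -
      have "B$1$1 * x + B$1$2 * y = \<kappa> * (B$2$1 * x + B$2$2 * y)" for x y by (simp add: \<kappa> algebra_simps)
      then show ?thesis using B by (auto simp: collapses_def hom_point_def)
    qed
    ultimately show thesis using that by blast
  qed
qed

text \<open>This description needs no base point in hyperbolic space, and it shows how the group
  acts on the sphere: the matrices push every point outside the kernel of \<open>B\<close> towards
  \<xi>.\<close>

definition limit_point :: "(complex^2^2) set \<Rightarrow> complex option \<Rightarrow> bool"
  where "limit_point M \<xi> \<longleftrightarrow> (\<exists>A s B. (\<forall>n::nat. A n \<in> M) \<and> filterlim s at_top sequentially \<and>
    (\<lambda>n. (1 / s n) *\<^sub>R A n) \<longlonglongrightarrow> B \<and> collapses B \<xi>)"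

lemma limit_pointI:
  assumes "\<And>n::nat. A n \<in> M" "filterlim s at_top sequentially" "(\<lambda>n. (1 / s n) *\<^sub>R A n) \<longlonglongrightarrow> B" "collapses B \<xi>"
  shows "limit_point M \<xi>"
  unfolding limit_point_def by (rule exI[of _ A], rule exI[of _ s], rule exI[of _ B]) (use assms in blast)

text \<open>One direction is \<open>collapse_limit\<close>. For the other, \<open>numer\<close> and
  \<open>denom\<close> are at most a constant times the squared norm of the matrix, so convergence
  to the boundary forces the norms to infinity; a subsequence of the normalised matrices converges
  on the unit sphere, and its collapse point is \<xi> by uniqueness of limits.\<close>

lemma limit_point_iff:
  assumes M: "\<And>A. A \<in> M \<Longrightarrow> det A = 1" and q: "snd q > 0"
  shows "limit_point M \<xi> \<longleftrightarrow> (\<exists>A. (\<forall>n. A n \<in> M) \<and> tends_to_boundary (\<lambda>n. poincare_mat (A n) q) \<xi>)"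
proof
  assume "limit_point M \<xi>"
  then obtain A s B where A: "\<And>n::nat. A n \<in> M" "filterlim s at_top sequentially"
    "(\<lambda>n. (1 / s n) *\<^sub>R A n) \<longlonglongrightarrow> B" "collapses B \<xi>" unfolding limit_point_def by blast
  have "B \<noteq> 0" using A(4) by (simp add: collapses_def)
  obtain \<eta> where \<eta>: "collapses B \<eta>" "tends_to_boundary (\<lambda>n. poincare_mat (A n) q) \<eta>"
    using collapse_limit[OF M[OF A(1)] A(2,3) \<open>B \<noteq> 0\<close> q] .
  have "\<exists>x y. B$1$1 * x + B$1$2 * y \<noteq> 0 \<or> B$2$1 * x + B$2$2 * y \<noteq> 0"
  proof (rule ccontr)
    assume *: "\<not> ?thesis"
    have "B$i$j = 0" if "i = 1 \<or> i = 2" "j = 1 \<or> j = 2" for i j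
      using * that spec[OF spec[OF *[unfolded not_ex], of 1], of 0] spec[OF spec[OF *[unfolded not_ex], of 0], of 1] by auto
    then show False using \<open>B \<noteq> 0\<close> by (simp add: mat2_eq_iff)
  qed
  then have "\<eta> = \<xi>" using A(4) \<eta>(1) unfolding collapses_def by metis
  then show "\<exists>A. (\<forall>n. A n \<in> M) \<and> tends_to_boundary (\<lambda>n. poincare_mat (A n) q) \<xi>" using A(1) \<eta>(2) by blast
next
  assume "\<exists>A. (\<forall>n. A n \<in> M) \<and> tends_to_boundary (\<lambda>n. poincare_mat (A n) q) \<xi>"
  then obtain A where A: "\<And>n. A n \<in> M" "tends_to_boundary (\<lambda>n. poincare_mat (A n) q) \<xi>" by blast
  have D: "denom (A n) q > 0" and N: "numer (A n) q > 0" for n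
    using denom_pos numer_pos rows_nonzero M[OF A(1)] q by blast+
  define K where "K = (norm (fst q) + 1) ^ 2 + snd q ^ 2"
  have nth: "norm (X $ i $ j) \<le> norm X" for X :: "complex^2^2" and i j
    using order_trans[OF Finite_Cartesian_Product.norm_nth_le Finite_Cartesian_Product.norm_nth_le] .
  have bound: "norm (x * fst q + y) ^ 2 + norm x ^ 2 * snd q ^ 2 \<le> K * r ^ 2" if "norm x \<le> r" "norm y \<le> r" for x y r
  proof -
    have r0: "0 \<le> r" using that norm_ge_zero order_trans by blast
    have "norm (x * fst q + y) \<le> norm x * norm (fst q) + norm y" by (metis norm_triangle_ineq norm_mult)
    also have "\<dots> \<le> r * norm (fst q) + r" using that by (intro add_mono mult_right_mono) auto
    finally have "norm (x * fst q + y) \<le> (norm (fst q) + 1) * r" by (simp add: algebra_simps)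
    then have "norm (x * fst q + y) ^ 2 \<le> ((norm (fst q) + 1) * r) ^ 2" by (intro power_mono) simp_all
    moreover have "norm x ^ 2 * snd q ^ 2 \<le> r ^ 2 * snd q ^ 2"
      using that by (intro mult_right_mono power_mono) auto
    ultimately show ?thesis unfolding K_def power_mult_distrib distrib_right[of _ _ "r ^ 2"] by (simp add: mult.commute)
  qed
  have Db: "denom X q \<le> K * norm X ^ 2" "numer X q \<le> K * norm X ^ 2" for X
    unfolding denom_def numer_def by (intro bound nth)+
  have K: "K > 0" using q by (simp add: K_def add_nonneg_pos)
  have unscale: "filterlim (\<lambda>n. norm (A n)) at_top sequentially"
    if "filterlim (\<lambda>n. norm (A n) ^ 2 * (K / snd q)) at_top sequentially"
  proof -
    have "filterlim (\<lambda>n. (snd q / K) * (norm (A n) ^ 2 * (K / snd q))) at_top sequentially"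
      using K q by (intro filterlim_tendsto_pos_mult_at_top[OF tendsto_const _ that]) simp
    moreover have "(snd q / K) * (norm (A n) ^ 2 * (K / snd q)) = norm (A n) ^ 2" for n
      using K q by (simp add: field_simps)
    ultimately have "filterlim (\<lambda>n. norm (A n) ^ 2) at_top sequentially" by simp
    then have "filterlim (\<lambda>n. sqrt (norm (A n) ^ 2)) at_top sequentially"
      by (rule filterlim_compose[OF sqrt_at_top])
    then show ?thesis by simp
  qed
  have inf: "filterlim (\<lambda>n. norm (A n)) at_top sequentially"
  proof (cases \<xi>)
    case (Some z)
    then have "(\<lambda>n. poincare_mat (A n) q) \<longlonglongrightarrow> (z, 0)" using A(2) by (simp add: tends_to_boundary_def)
    then have "(\<lambda>n. snd (poincare_mat (A n) q)) \<longlonglongrightarrow> 0" using tendsto_snd by fastforce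
    then have "filterlim (\<lambda>n. inverse (snd q / denom (A n) q)) at_top sequentially"
      using D q by (intro filterlim_inverse_at_top) (auto simp: poincare_mat_eq)
    then have "filterlim (\<lambda>n. norm (A n) ^ 2 * (K / snd q)) at_top sequentially"
    proof (rule filterlim_at_top_mono, intro always_eventually allI)
      show "inverse (snd q / denom (A n) q) \<le> norm (A n) ^ 2 * (K / snd q)" for n
        using divide_right_mono[OF Db(1)[of "A n"], of "snd q"] q by (simp add: mult.commute)
    qed
    then show ?thesis by (rule unscale)
  next
    case None
    then have "filterlim (\<lambda>n. norm (poincare_mat (A n) q)) at_top sequentially" using A(2) by (simp add: tends_to_boundary_def)
    then have "filterlim (\<lambda>n. norm (A n) ^ 2 * (K / snd q)) at_top sequentially"
    proof (rule filterlim_at_top_mono, intro always_eventually allI)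
      fix n
      \<comment> \<open>\<open>denom\<close> can be small only if \<open>numer\<close> is large, so
        large orbit points force a large \<open>numer\<close>.\<close>
      have "numer (A n) q * denom (A n) q \<ge> snd q ^ 2"
        using numer_denom[of "A n" q] M[OF A(1)[of n]] by (simp add: diff_eq_eq)
      then have "1 / denom (A n) q \<le> numer (A n) q / snd q ^ 2" using D[of n] q by (simp add: field_simps)
      then have "numer (A n) q / denom (A n) q \<le> numer (A n) q * (numer (A n) q / snd q ^ 2)"
        using N[of n] by (metis less_imp_le mult_left_mono times_divide_eq_right mult.right_neutral)
      then have "norm (poincare_mat (A n) q) ^ 2 \<le> (numer (A n) q / snd q) ^ 2"
        unfolding norm_poincare[OF M[OF A(1)] q] power_divide by (simp add: power2_eq_square mult.assoc)
      then have "norm (poincare_mat (A n) q) \<le> numer (A n) q / snd q"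
        using N[of n] q by (intro power2_le_imp_le[of "norm _"]) auto
      also have "\<dots> \<le> norm (A n) ^ 2 * (K / snd q)" using Db(2)[of "A n"] q by (simp add: divide_right_mono mult.commute)
      finally show "norm (poincare_mat (A n) q) \<le> norm (A n) ^ 2 * (K / snd q)" .
    qed
    then show ?thesis by (rule unscale)
  qed
  have nz: "A n \<noteq> 0" for n using M[OF A(1)[of n]] by (auto simp: det_2)
  have "seq_compact (sphere 0 1 :: (complex^2^2) set)" by (intro compact_imp_seq_compact) simp
  moreover have "\<forall>n. (1 / norm (A n)) *\<^sub>R A n \<in> sphere 0 1" using nz by simp
  ultimately obtain B g where B: "B \<in> sphere 0 1" "strict_mono (g :: nat \<Rightarrow> nat)"
      "((\<lambda>n. (1 / norm (A n)) *\<^sub>R A n) \<circ> g) \<longlonglongrightarrow> B"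
    by (rule seq_compactE)
  have g: "filterlim g at_top sequentially" by (rule filterlim_subseq[OF B(2)])
  have B3: "(\<lambda>n. (1 / norm (A (g n))) *\<^sub>R A (g n)) \<longlonglongrightarrow> B" using B(3) by (simp add: o_def)
  have s: "filterlim (\<lambda>n. norm (A (g n))) at_top sequentially" by (rule filterlim_compose[OF inf g])
  have "B \<noteq> 0" using B(1) by auto
  then obtain \<eta> where \<eta>: "collapses B \<eta>" "tends_to_boundary (\<lambda>n. poincare_mat (A (g n)) q) \<eta>"
    using collapse_limit[of "\<lambda>n. A (g n)", OF M[OF A(1)] s B3 _ q] by metis
  have "tends_to_boundary (\<lambda>n. poincare_mat (A (g n)) q) \<xi>"
    using A(2) LIMSEQ_subseq_LIMSEQ[OF _ B(2)] filterlim_compose[OF _ g]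
    unfolding tends_to_boundary_def by (auto split: option.splits simp: o_def)
  then have "\<eta> = \<xi>" using \<eta>(2) tends_to_boundary_unique by blast
  then show "limit_point M \<xi>" using limit_pointI[OF A(1) s B3] \<eta>(1) by blast
qed

section \<open>From the limit set to limit points of matrices\<close>

lemma topspace_H3_closure: "Some x \<in> topspace H3_closure \<longleftrightarrow> snd x \<ge> 0" "None \<in> topspace H3_closure"
  by (auto simp: H3_closure_def case_prod_beta)

lemma H3_closure_eq: "H3_closure = Alexandroff_compactification (top_of_set {x :: complex \<times> real. snd x \<ge> 0})"
proof -
  have "{(z :: complex, t :: real). t \<ge> 0} = {x. snd x \<ge> 0}" by auto
  then show ?thesis unfolding H3_closure_def by (rule arg_cong)
qed

lemma orbit_matrices:
  assumes sub: "subgroup \<Gamma> PSL2C"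
  shows "(\<lambda>\<gamma>. Some (poincare_action \<gamma> p)) ` \<Gamma> = (\<lambda>A. Some (poincare_mat A p)) ` matrices \<Gamma>"
proof (intro equalityI subsetI)
  fix x assume "x \<in> (\<lambda>\<gamma>. Some (poincare_action \<gamma> p)) ` \<Gamma>"
  then obtain \<gamma> where g: "\<gamma> \<in> \<Gamma>" "x = Some (poincare_action \<gamma> p)" by blast
  obtain A where "A \<in> \<gamma>" using matrices_carrier[OF sub g(1)] by (auto simp: carrier_PSL2C)
  then show "x \<in> (\<lambda>A. Some (poincare_mat A p)) ` matrices \<Gamma>"
    using poincare_eq[OF matrices_carrier[OF sub g(1)]] g unfolding matrices_def by blast
next
  fix x assume "x \<in> (\<lambda>A. Some (poincare_mat A p)) ` matrices \<Gamma>"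
  then obtain A \<gamma> where g: "\<gamma> \<in> \<Gamma>" "A \<in> \<gamma>" "x = Some (poincare_mat A p)" unfolding matrices_def by blast
  then show "x \<in> (\<lambda>\<gamma>. Some (poincare_action \<gamma> p)) ` \<Gamma>"
    using poincare_eq[OF matrices_carrier[OF sub g(1)] g(2), of p] by (intro image_eqI[of _ _ \<gamma>]) simp_all
qed

text \<open>Orbit points have positive height and never coincide with a boundary point, so
  accumulation is the same as approximation, without the demand of distinctness.\<close>

lemma limit_set_Some:
  assumes sub: "subgroup \<Gamma> PSL2C" and p: "p \<in> H3"
  shows "Some z \<in> limit_set \<Gamma> p \<longleftrightarrow> (\<forall>\<epsilon>>0. \<exists>A\<in>matrices \<Gamma>. dist (poincare_mat A p) (z, 0) < \<epsilon>)" (is "_ \<longleftrightarrow> ?r")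
proof -
  let ?C = "{x :: complex \<times> real. snd x \<ge> 0}"
  have HC: "H3_closure = Alexandroff_compactification (top_of_set ?C)" by (rule H3_closure_eq)
  note orbit = orbit_matrices[OF sub, of p]
  have pos: "snd (poincare_mat A p) > 0" if "A \<in> matrices \<Gamma>" for A
    using poincare_in_H3 matrices_det[OF sub that] p by blast
  show ?thesis
  proof
    assume "Some z \<in> limit_set \<Gamma> p"
    then have der: "Some (z, 0) \<in> H3_closure derived_set_of ((\<lambda>A. Some (poincare_mat A p)) ` matrices \<Gamma>)"
      by (simp add: limit_set_def at_infinity_point_def orbit)
    show ?r
    proof (intro allI impI)
      fix \<epsilon> :: real assume "\<epsilon> > 0"
      have "openin (top_of_set ?C) (?C \<inter> ball (z, 0) \<epsilon>)" by (simp add: openin_open_Int)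
      then have "openin H3_closure (Some ` (?C \<inter> ball (z, 0) \<epsilon>))" unfolding HC by simp
      moreover have "Some (z, 0) \<in> Some ` (?C \<inter> ball (z, 0) \<epsilon>)" using \<open>\<epsilon> > 0\<close> by auto
      ultimately have "\<exists>y. y \<noteq> Some (z, 0) \<and> y \<in> (\<lambda>A. Some (poincare_mat A p)) ` matrices \<Gamma> \<and>
          y \<in> Some ` (?C \<inter> ball (z, 0) \<epsilon>)"
        by (intro der[unfolded in_derived_set_of, THEN conjunct2, rule_format] conjI)
      then obtain A where "A \<in> matrices \<Gamma>" "Some (poincare_mat A p) \<in> Some ` (?C \<inter> ball (z, 0) \<epsilon>)"
        by blast
      then show "\<exists>A\<in>matrices \<Gamma>. dist (poincare_mat A p) (z, 0) < \<epsilon>"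
        by (intro bexI[of _ A]) (auto simp: dist_commute)
    qed
  next
    assume r: ?r
    have "Some (z, 0) \<in> H3_closure derived_set_of ((\<lambda>A. Some (poincare_mat A p)) ` matrices \<Gamma>)"
      unfolding derived_set_of_def
    proof (intro CollectI conjI allI impI)
      show "Some (z, 0) \<in> topspace H3_closure" by (simp add: topspace_H3_closure)
      fix T assume T: "Some (z, 0) \<in> T \<and> openin H3_closure T"
      then have T': "openin H3_closure T" "Some (z, 0) \<in> T" by auto
      have "openin (top_of_set ?C) {x \<in> topspace (top_of_set ?C). Some x \<in> T}"
        using T'(1) unfolding HC by (rule openin_continuous_map_preimage[OF continuous_map_Some])
      then have "openin (top_of_set ?C) {x \<in> ?C. Some x \<in> T}" by simp
      then have "\<forall>y\<in>{x \<in> ?C. Some x \<in> T}. \<exists>e>0. \<forall>x\<in>?C. dist x y < e \<longrightarrow> x \<in> {x \<in> ?C. Some x \<in> T}"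
        unfolding openin_euclidean_subtopology_iff by (rule conjunct2)
      from this[THEN bspec, of "(z, 0)"] T'(2) obtain \<epsilon> where e: "\<epsilon> > 0"
        "\<And>x. x \<in> ?C \<Longrightarrow> dist x (z, 0) < \<epsilon> \<Longrightarrow> Some x \<in> T" by auto
      obtain A where A: "A \<in> matrices \<Gamma>" "dist (poincare_mat A p) (z, 0) < \<epsilon>" using r e(1) by blast
      have "Some (poincare_mat A p) \<in> T" using e(2)[OF _ A(2)] pos[OF A(1)] by simp
      moreover have "Some (poincare_mat A p) \<noteq> Some (z, 0)" using pos[OF A(1)] by auto
      ultimately show "\<exists>y. y \<noteq> Some (z, 0) \<and> y \<in> (\<lambda>A. Some (poincare_mat A p)) ` matrices \<Gamma> \<and> y \<in> T" using A(1) by blast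
    qed
    then show "Some z \<in> limit_set \<Gamma> p" by (simp add: limit_set_def at_infinity_point_def orbit)
  qed
qed

text \<open>The complements of closed balls form a neighbourhood base of infinity in the closed
  half-space.\<close>

lemma limit_set_None:
  assumes sub: "subgroup \<Gamma> PSL2C" and p: "p \<in> H3"
  shows "None \<in> limit_set \<Gamma> p \<longleftrightarrow> (\<forall>R. \<exists>A\<in>matrices \<Gamma>. norm (poincare_mat A p) > R)" (is "_ \<longleftrightarrow> ?r")
proof -
  let ?C = "{x :: complex \<times> real. snd x \<ge> 0}"
  have HC: "H3_closure = Alexandroff_compactification (top_of_set ?C)" by (rule H3_closure_eq)
  have closedC: "closed ?C" by (intro closed_Collect_le continuous_intros)
  note orbit = orbit_matrices[OF sub, of p]
  have pos: "snd (poincare_mat A p) > 0" if "A \<in> matrices \<Gamma>" for A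
    using poincare_in_H3 matrices_det[OF sub that] p by blast
  show ?thesis
  proof
    assume "None \<in> limit_set \<Gamma> p"
    then have der: "None \<in> H3_closure derived_set_of ((\<lambda>A. Some (poincare_mat A p)) ` matrices \<Gamma>)"
      by (simp add: limit_set_def at_infinity_point_def orbit)
    show ?r
    proof
      fix R :: real
      have "compact (?C \<inter> cball 0 R)" using closedC by (intro closed_Int_compact) auto
      then have "openin H3_closure (insert None (Some ` (?C - (?C \<inter> cball 0 R))))"
        unfolding HC openin_Alexandroff_compactification
        by (intro disjI2 exI[of _ "?C \<inter> cball 0 R"]) (auto simp: compactin_subtopology closedin_closed_Int)
      then have "\<exists>y. y \<noteq> None \<and> y \<in> (\<lambda>A. Some (poincare_mat A p)) ` matrices \<Gamma> \<and>
          y \<in> insert None (Some ` (?C - (?C \<inter> cball 0 R)))"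
        by (intro der[unfolded in_derived_set_of, THEN conjunct2, rule_format] conjI insertI1)
      then obtain A where "A \<in> matrices \<Gamma>" "Some (poincare_mat A p) \<in> insert None (Some ` (?C - (?C \<inter> cball 0 R)))"
        by blast
      then show "\<exists>A\<in>matrices \<Gamma>. norm (poincare_mat A p) > R"
        by (intro bexI[of _ A]) auto
    qed
  next
    assume r: ?r
    have "None \<in> H3_closure derived_set_of ((\<lambda>A. Some (poincare_mat A p)) ` matrices \<Gamma>)"
      unfolding derived_set_of_def
    proof (intro CollectI conjI allI impI)
      show "None \<in> topspace H3_closure" by (rule topspace_H3_closure)
      fix T assume T: "None \<in> T \<and> openin H3_closure T"
      then obtain K where K: "compactin (top_of_set ?C) K" "T = insert None (Some ` (?C - K))"
        unfolding HC openin_Alexandroff_compactification by auto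
      then have "bounded K" by (auto simp: compactin_subtopology intro: compact_imp_bounded)
      then obtain R where R: "\<And>x. x \<in> K \<Longrightarrow> norm x \<le> R" unfolding bounded_iff by blast
      obtain A where A: "A \<in> matrices \<Gamma>" "norm (poincare_mat A p) > R" using r by blast
      have "Some (poincare_mat A p) \<in> T" using R[of "poincare_mat A p"] A pos[OF A(1)] K(2) by auto
      then show "\<exists>y. y \<noteq> None \<and> y \<in> (\<lambda>A. Some (poincare_mat A p)) ` matrices \<Gamma> \<and> y \<in> T" using A(1) by blast
    qed
    then show "None \<in> limit_set \<Gamma> p" by (simp add: limit_set_def at_infinity_point_def orbit)
  qed
qed

lemma limit_set_iff_limit_point:
  assumes sub: "subgroup \<Gamma> PSL2C" and p: "p \<in> H3"
  shows "\<xi> \<in> limit_set \<Gamma> p \<longleftrightarrow> limit_point (matrices \<Gamma>) \<xi>"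
proof -
  have pp: "snd p > 0" using p by (auto simp: H3_def)
  note iff = limit_point_iff[OF matrices_det[OF sub] pp, of "matrices \<Gamma>"]
  show ?thesis
  proof (cases \<xi>)
    case (Some z)
    have "(\<forall>\<epsilon>>0. \<exists>A\<in>matrices \<Gamma>. dist (poincare_mat A p) (z, 0) < \<epsilon>) \<longleftrightarrow>
      (\<exists>A. (\<forall>n. A n \<in> matrices \<Gamma>) \<and> (\<lambda>n. poincare_mat (A n) p) \<longlonglongrightarrow> (z, 0))" (is "?l \<longleftrightarrow> ?r")
    proof
      assume ?l
      then have "\<forall>n::nat. \<exists>A\<in>matrices \<Gamma>. dist (poincare_mat A p) (z, 0) < inverse (Suc n)" by simp
      then obtain A where A: "\<And>n::nat. A n \<in> matrices \<Gamma>" "\<And>n. dist (poincare_mat (A n) p) (z, 0) < inverse (Suc n)" by metis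
      have "(\<lambda>n. dist (poincare_mat (A n) p) (z, 0)) \<longlonglongrightarrow> 0"
        by (rule tendsto_sandwich[OF _ _ tendsto_const LIMSEQ_inverse_real_of_nat]) (use A(2) in \<open>auto simp: less_imp_le\<close>)
      then have "(\<lambda>n. poincare_mat (A n) p) \<longlonglongrightarrow> (z, 0)" using tendsto_dist_iff by blast
      then show ?r using A(1) by (intro exI[of _ A] conjI allI)
    next
      assume ?r
      then obtain A where A: "\<And>n. A n \<in> matrices \<Gamma>" "(\<lambda>n. poincare_mat (A n) p) \<longlonglongrightarrow> (z, 0)" by blast
      show ?l
      proof (intro allI impI)
        fix \<epsilon> :: real assume "\<epsilon> > 0"
        then show "\<exists>A\<in>matrices \<Gamma>. dist (poincare_mat A p) (z, 0) < \<epsilon>"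
          using tendstoD[OF A(2)] A(1) by (force simp: eventually_sequentially)
      qed
    qed
    then show ?thesis using limit_set_Some[OF assms] iff by (simp add: tends_to_boundary_def Some)
  next
    case None
    have "(\<forall>R. \<exists>A\<in>matrices \<Gamma>. norm (poincare_mat A p) > R) \<longleftrightarrow>
      (\<exists>A. (\<forall>n. A n \<in> matrices \<Gamma>) \<and> filterlim (\<lambda>n. norm (poincare_mat (A n) p)) at_top sequentially)" (is "?l \<longleftrightarrow> ?r")
    proof
      assume ?l
      then have "\<forall>n::nat. \<exists>A\<in>matrices \<Gamma>. norm (poincare_mat A p) > real n" by simp
      then obtain A where A: "\<And>n::nat. A n \<in> matrices \<Gamma>" "\<And>n. norm (poincare_mat (A n) p) > real n" by metis
      have "filterlim (\<lambda>n. norm (poincare_mat (A n) p)) at_top sequentially"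
        by (rule filterlim_at_top_mono[OF filterlim_real_sequentially]) (use A(2) in \<open>auto simp: less_imp_le\<close>)
      then show ?r using A(1) by blast
    next
      assume ?r
      then obtain A where A: "\<And>n. A n \<in> matrices \<Gamma>" "filterlim (\<lambda>n. norm (poincare_mat (A n) p)) at_top sequentially" by blast
      show ?l
      proof
        fix R
        have "\<forall>\<^sub>F n in sequentially. norm (poincare_mat (A n) p) > R" using A(2) by (simp add: filterlim_at_top_dense)
        then show "\<exists>A\<in>matrices \<Gamma>. norm (poincare_mat A p) > R" using A(1) by (force simp: eventually_sequentially)
      qed
    qed
    then show ?thesis using limit_set_None[OF assms] iff by (simp add: tends_to_boundary_def None)
  qed
qed

text \<open>In the plane the limit set is the slice at height 0 of the closure of the orbit, and
  infinity is missed only if the orbit is bounded.\<close>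

lemma limit_set_closed:
  assumes "subgroup \<Gamma> PSL2C" "p \<in> H3"
  shows "closedin S2 (limit_set \<Gamma> p)"
proof -
  define P where "P = (\<lambda>A. poincare_mat A p) ` matrices \<Gamma>"
  have Some: "Some z \<in> limit_set \<Gamma> p \<longleftrightarrow> (z, 0) \<in> closure P" for z
    unfolding limit_set_Some[OF assms] closure_approachable P_def by blast
  have "closed ((\<lambda>z :: complex. (z, 0 :: real)) -` closure P)"
    by (intro closed_vimage continuous_intros closed_closure)
  moreover have "{z. Some z \<in> - limit_set \<Gamma> p} = - ((\<lambda>z :: complex. (z, 0 :: real)) -` closure P)"
    using Some by auto
  ultimately have "open {z. Some z \<in> - limit_set \<Gamma> p}" by (simp add: open_Compl)
  moreover have "\<exists>R. \<forall>z. norm z > R \<longrightarrow> Some z \<in> - limit_set \<Gamma> p" if "None \<in> - limit_set \<Gamma> p"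
  proof -
    have "\<not> (\<forall>R. \<exists>A\<in>matrices \<Gamma>. norm (poincare_mat A p) > R)"
      using that unfolding limit_set_None[OF assms, symmetric] by simp
    then obtain R where R: "\<And>A. A \<in> matrices \<Gamma> \<Longrightarrow> norm (poincare_mat A p) \<le> R"
      unfolding not_all bex_simps(8) not_less by (metis not_less)
    have "P \<subseteq> cball 0 R" using R by (auto simp: P_def)
    then have "closure P \<subseteq> cball 0 R" by (simp add: closure_minimal)
    then have "(z, 0) \<notin> closure P" if "norm z > R" for z
      using that by (auto simp: norm_Pair)
    then show ?thesis using Some by auto
  qed
  ultimately have "openin S2 (- limit_set \<Gamma> p)" by (simp add: openin_S2)
  then show ?thesis by (simp add: closedin_def topspace_S2 Compl_eq_Diff_UNIV)
qed

section \<open>Dynamics of the group on its limit set\<close>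

context
  fixes \<Gamma> assumes sub: "subgroup \<Gamma> PSL2C"
begin

lemma limit_point_invariant:
  assumes "limit_point (matrices \<Gamma>) \<xi>" "C \<in> matrices \<Gamma>"
  shows "limit_point (matrices \<Gamma>) (moebius_mat C \<xi>)"
proof -
  obtain A s B where A: "\<And>n::nat. A n \<in> matrices \<Gamma>" "filterlim s at_top sequentially"
    "(\<lambda>n. (1 / s n) *\<^sub>R A n) \<longlonglongrightarrow> B" "collapses B \<xi>" using assms(1) unfolding limit_point_def by blast
  have dC: "det C = 1" using matrices_det[OF sub assms(2)] .
  have "(\<lambda>n. C ** ((1 / s n) *\<^sub>R A n)) \<longlonglongrightarrow> C ** B"
    by (intro tendsto_mult2 tendsto_const A(3))
  moreover have "C ** ((1 / s n) *\<^sub>R A n) = (1 / s n) *\<^sub>R (C ** A n)" for n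
    by (simp add: mat2_eq_iff mult2_nth scaleR_add_right)
  ultimately have 1: "(\<lambda>n. (1 / s n) *\<^sub>R (C ** A n)) \<longlonglongrightarrow> C ** B" by simp
  have "C ** B \<noteq> 0"
  proof
    assume "C ** B = 0"
    then have "inv2 C ** (C ** B) = 0" by (simp add: mat2_eq_iff mult2_nth)
    then show False using A(4) dC by (simp add: matrix_mul_assoc inv2_inverse collapses_def)
  qed
  moreover have "hom_point ((C ** B)$1$1 * x + (C ** B)$1$2 * y) ((C ** B)$2$1 * x + (C ** B)$2$2 * y) = moebius_mat C \<xi>"
    if "(C ** B)$1$1 * x + (C ** B)$1$2 * y \<noteq> 0 \<or> (C ** B)$2$1 * x + (C ** B)$2$2 * y \<noteq> 0" for x y
  proof -
    have e: "(C ** B)$i$1 * x + (C ** B)$i$2 * y = C$i$1 * (B$1$1 * x + B$1$2 * y) + C$i$2 * (B$2$1 * x + B$2$2 * y)" for i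
      by (simp add: mult2_nth algebra_simps)
    have "B$1$1 * x + B$1$2 * y \<noteq> 0 \<or> B$2$1 * x + B$2$2 * y \<noteq> 0" using that unfolding e by auto
    moreover from this have "hom_point (B$1$1 * x + B$1$2 * y) (B$2$1 * x + B$2$2 * y) = \<xi>"
      using A(4) unfolding collapses_def by blast
    ultimately show ?thesis unfolding e using moebius_hom_point by metis
  qed
  ultimately have "collapses (C ** B) (moebius_mat C \<xi>)" unfolding collapses_def by blast
  then show ?thesis using limit_pointI[OF matrices_mult[OF sub assms(2) A(1)] A(2) 1] by blast
qed

text \<open>Matrices that collapse to \<xi> move every point outside the one-dimensional kernel of
  their limit \<open>B\<close> towards \<xi>. If \<open>x0\<close> represents that kernel,
  \<open>moebius_mat k x0\<close> does not.\<close>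

lemma limit_point_minimal:
  assumes "limit_point (matrices \<Gamma>) \<xi>" "k \<in> matrices \<Gamma>" "moebius_mat k x0 \<noteq> x0" "openin S2 U" "\<xi> \<in> U"
  obtains C where "C \<in> matrices \<Gamma>" "moebius_mat C x0 \<in> U"
proof -
  obtain A s B where A: "\<And>n::nat. A n \<in> matrices \<Gamma>" "filterlim s at_top sequentially"
    "(\<lambda>n. (1 / s n) *\<^sub>R A n) \<longlonglongrightarrow> B" "collapses B \<xi>" using assms(1) unfolding limit_point_def by blast
  have *: "\<exists>C\<in>matrices \<Gamma>. moebius_mat C (hom_point x y) \<in> U"
    if xy: "x \<noteq> 0 \<or> y \<noteq> 0" and nz: "B$1$1 * x + B$1$2 * y \<noteq> 0 \<or> B$2$1 * x + B$2$2 * y \<noteq> 0" for x y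
  proof -
    have "limitin S2 (\<lambda>n. hom_point (((1 / s n) *\<^sub>R A n)$1$1 * x + ((1 / s n) *\<^sub>R A n)$1$2 * y)
       (((1 / s n) *\<^sub>R A n)$2$1 * x + ((1 / s n) *\<^sub>R A n)$2$2 * y))
       (hom_point (B$1$1 * x + B$1$2 * y) (B$2$1 * x + B$2$2 * y)) sequentially"
      by (intro limitin_hom_point tendsto_intros A(3) nz)
    moreover have "hom_point (B$1$1 * x + B$1$2 * y) (B$2$1 * x + B$2$2 * y) = \<xi>"
      using A(4) nz unfolding collapses_def by blast
    ultimately have ev: "\<forall>\<^sub>F n in sequentially. hom_point (((1 / s n) *\<^sub>R A n)$1$1 * x + ((1 / s n) *\<^sub>R A n)$1$2 * y)
       (((1 / s n) *\<^sub>R A n)$2$1 * x + ((1 / s n) *\<^sub>R A n)$2$2 * y) \<in> U"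
      using assms(4,5) unfolding limitin_def by auto
    have "\<forall>\<^sub>F n in sequentially. s n > 0" using A(2) by (simp add: filterlim_at_top_dense)
    with ev have "\<forall>\<^sub>F n in sequentially. moebius_mat (A n) (hom_point x y) \<in> U"
    proof eventually_elim
      case (elim n)
      have "((1 / s n) *\<^sub>R A n)$i$1 * x + ((1 / s n) *\<^sub>R A n)$i$2 * y = of_real (1 / s n) * (A n$i$1 * x + A n$i$2 * y)" for i
        unfolding vector_scaleR_component scaleR_conv_of_real[where 'a = complex] by (simp only: distrib_left mult.assoc)
      then show ?case using elim hom_point_scale[of "of_real (1 / s n)"] by (simp add: moebius_hom_point[OF xy])
    qed
    then show ?thesis using A(1) by (force simp: eventually_sequentially)
  qed
  obtain x y where xy: "x0 = hom_point x y" "x \<noteq> 0 \<or> y \<noteq> 0" by (rule hom_point_cases)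
  show thesis
  proof (cases "B$1$1 * x + B$1$2 * y = 0 \<and> B$2$1 * x + B$2$2 * y = 0")
    case False
    then show thesis using *[OF xy(2)] that xy(1) by blast
  next
    case True
    define x' y' where "x' = k$1$1 * x + k$1$2 * y" and "y' = k$2$1 * x + k$2$2 * y"
    have dk: "det k = 1" using matrices_det[OF sub assms(2)] .
    have nz': "x' \<noteq> 0 \<or> y' \<noteq> 0" unfolding x'_def y'_def by (rule mat2_vec_nonzero[OF dk xy(2)])
    have kx: "moebius_mat k x0 = hom_point x' y'" unfolding xy(1) x'_def y'_def by (rule moebius_hom_point[OF xy(2)])
    have det_nz: "x' * y - x * y' \<noteq> 0" using assms(3) kx xy nz' by (auto simp: hom_point_eq_iff)
    have "B$1$1 * x' + B$1$2 * y' \<noteq> 0 \<or> B$2$1 * x' + B$2$2 * y' \<noteq> 0"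
    proof (rule ccontr)
      assume "\<not> ?thesis"
      then have 0: "B$1$1 * x' + B$1$2 * y' = 0" "B$2$1 * x' + B$2$2 * y' = 0" by auto
      have 1: "B$1$1 * x + B$1$2 * y = 0" "B$2$1 * x + B$2$2 * y = 0" using True by auto
      have "B$i$1 * (x' * y - x * y') = y * (B$i$1 * x' + B$i$2 * y') - y' * (B$i$1 * x + B$i$2 * y)"
        "B$i$2 * (x' * y - x * y') = x' * (B$i$1 * x + B$i$2 * y) - x * (B$i$1 * x' + B$i$2 * y')" for i
        by (simp_all add: algebra_simps)
      then have "B$i$1 * (x' * y - x * y') = 0" "B$i$2 * (x' * y - x * y') = 0" if "i = 1 \<or> i = 2" for i
        using that 0 1 by auto
      then have "B = 0" using det_nz by (simp add: mat2_eq_iff)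
      then show False using A(4) by (simp add: collapses_def)
    qed
    then obtain C where C: "C \<in> matrices \<Gamma>" "moebius_mat C (hom_point x' y') \<in> U" using *[OF nz'] by blast
    have "moebius_mat (C ** k) x0 \<in> U" using C(2) kx moebius_mult[OF dk, of C x0] by simp
    then show thesis using that matrices_mult[OF sub C(1) assms(2)] by blast
  qed
qed

lemma matrices_power_conj:
  assumes "A \<in> matrices \<Gamma>" "A = M ** mat2 l 0 0 (1 / l) ** inv2 M" "det M = 1" "l \<noteq> 0"
  shows "M ** mat2 (l ^ n) 0 0 (1 / l ^ n) ** inv2 M \<in> matrices \<Gamma>"
proof (induction n)
  case 0
  have "mat2 1 0 0 1 = mat 1" by (simp add: mat2_eq_iff mat_1_nth2)
  then show ?case using matrices_one[OF sub] assms by (simp add: inv2_inverse)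
next
  case (Suc n)
  have "mat2 l 0 0 (1 / l) ** mat2 (l ^ n) 0 0 (1 / l ^ n) = mat2 (l ^ Suc n) 0 0 (1 / l ^ Suc n)"
    by (simp add: mat2_eq_iff mult2_nth)
  then have "M ** mat2 (l ^ Suc n) 0 0 (1 / l ^ Suc n) ** inv2 M =
     M ** mat2 l 0 0 (1 / l) ** (inv2 M ** M) ** mat2 (l ^ n) 0 0 (1 / l ^ n) ** inv2 M"
    using assms(3) by (simp add: inv2_inverse matrix_mul_assoc[symmetric])
  also have "\<dots> = A ** (M ** mat2 (l ^ n) 0 0 (1 / l ^ n) ** inv2 M)"
    by (simp only: assms(2) matrix_mul_assoc)
  finally show ?case using matrices_mult[OF sub assms(1) Suc] by simp
qed

lemma filterlim_pow_at_top_gt1: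
  fixes r :: real
  assumes "r > 1" shows "filterlim (\<lambda>n. r ^ n) at_top sequentially"
proof -
  have "filterlim (\<lambda>n. norm (r ^ n)) at_top sequentially"
    using filterlim_realpow_sequentially_gt1[of r] assms by (intro filterlim_at_infinity_imp_norm_at_top) simp
  then show ?thesis using assms by simp
qed

text \<open>Divided by \<open>norm l ^ n\<close>, the powers of \<open>A\<close> converge along
  recurrent exponents to the conjugate by \<open>M\<close> of the projection onto the first
  coordinate; its image is spanned by the first column of \<open>M\<close>.\<close>

lemma attracting_point:
  assumes "A \<in> matrices \<Gamma>" "A = M ** mat2 l 0 0 (1 / l) ** inv2 M" "det M = 1" "norm l > 1"
  shows "limit_point (matrices \<Gamma>) (moebius_mat M None)"
proof -
  have l: "l \<noteq> 0" using assms(4) by auto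
  obtain n :: "nat \<Rightarrow> nat" where n: "filterlim n at_top sequentially" "(\<lambda>k. sgn l ^ n k) \<longlonglongrightarrow> 1"
    using simultaneous_recurrence_seq[of "sgn l" "sgn l"] l by (auto simp: norm_sgn)
  define B where "B = M ** mat2 1 0 0 0 ** inv2 M"
  have inf: "filterlim (\<lambda>k. norm l ^ n k) at_top sequentially"
    by (rule filterlim_compose[OF filterlim_pow_at_top_gt1[OF assms(4)] n(1)])
  have D: "(\<lambda>k. mat2 (sgn l ^ n k) 0 0 (1 / (of_real (norm l ^ n k) * l ^ n k))) \<longlonglongrightarrow> mat2 1 0 0 0"
  proof -
    have i: "filterlim (\<lambda>k. l ^ n k) at_infinity sequentially"
      by (rule filterlim_compose[OF filterlim_realpow_sequentially_gt1[OF assms(4)] n(1)])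
    have "(\<lambda>k. of_real (1 / norm l ^ n k) * (1 / l ^ n k)) \<longlonglongrightarrow> of_real 0 * 0"
      by (intro tendsto_mult tendsto_of_real tendsto_divide_0[OF tendsto_const] filterlim_at_top_imp_at_infinity inf i)
    then have "(\<lambda>k. 1 / (of_real (norm l ^ n k) * l ^ n k)) \<longlonglongrightarrow> 0" by (simp add: field_simps)
    then show ?thesis using n(2) by (intro tendsto_mat2 tendsto_const)
  qed
  have "(\<lambda>k. M ** mat2 (sgn l ^ n k) 0 0 (1 / (of_real (norm l ^ n k) * l ^ n k)) ** inv2 M) \<longlonglongrightarrow> B"
    unfolding B_def by (intro tendsto_mult2 tendsto_const D)
  moreover have "M ** mat2 (sgn l ^ m) 0 0 (1 / (of_real (norm l ^ m) * l ^ m)) ** inv2 M =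
     (1 / norm l ^ m) *\<^sub>R (M ** mat2 (l ^ m) 0 0 (1 / l ^ m) ** inv2 M)" for m
    using l by (simp add: mat2_eq_iff mult2_nth scaleR_conv_of_real[where 'a = complex] sgn_eq field_simps)
  ultimately have lim: "(\<lambda>k. (1 / norm l ^ n k) *\<^sub>R (M ** mat2 (l ^ n k) 0 0 (1 / l ^ n k) ** inv2 M)) \<longlonglongrightarrow> B"
    by simp
  have "collapses B (moebius_mat M None)"
  proof -
    have e: "B$i$1 * x + B$i$2 * y = M$i$1 * (M$2$2 * x - M$1$2 * y)" for i x y
      by (simp add: B_def mult2_nth algebra_simps)
    have "B \<noteq> 0"
    proof
      assume "B = 0"
      then have "M$1$1 * (M$2$2 * M$1$1 - M$1$2 * M$2$1) = 0" "M$2$1 * (M$2$2 * M$1$1 - M$1$2 * M$2$1) = 0"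
        using e[of 1 "M$1$1" "M$2$1"] e[of 2 "M$1$1" "M$2$1"] by simp_all
      then show False using assms(3) by (auto simp: det_2 mult.commute)
    qed
    moreover have "moebius_mat M None = hom_point (M$1$1) (M$2$1)"
      using moebius_hom_point[of 1 0 M] by (simp add: hom_point_simps)
    moreover have "hom_point (M$1$1 * s) (M$2$1 * s) = hom_point (M$1$1) (M$2$1)" if "s \<noteq> 0" for s
      using hom_point_scale[OF that, of "M$1$1" "M$2$1"] by (simp add: mult.commute)
    ultimately show ?thesis unfolding collapses_def e by simp
  qed
  then show ?thesis using limit_pointI[OF matrices_power_conj[OF assms(1-3) l] inf lim] by blast
qed

text \<open>\<open>J\<close> exchanges 0 and infinity, so the repelling point of \<open>A\<close> is
  the attracting point of its inverse, which \<open>M ** J\<close> diagonalises.\<close>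

lemma repelling_point:
  assumes "A \<in> matrices \<Gamma>" "A = M ** mat2 l 0 0 (1 / l) ** inv2 M" "det M = 1" "norm l > 1"
  shows "limit_point (matrices \<Gamma>) (moebius_mat M (Some 0))"
proof -
  define J where "J = mat2 0 (- 1) 1 0"
  have dJ: "det J = 1" by (simp add: J_def det_2)
  have "l \<noteq> 0" using assms(4) by auto
  have e: "inv2 A = (M ** J) ** mat2 l 0 0 (1 / l) ** inv2 (M ** J)"
  proof -
    have "inv2 (mat2 l 0 0 (1 / l)) = J ** mat2 l 0 0 (1 / l) ** inv2 J"
      by (simp add: J_def mat2_eq_iff mult2_nth)
    then show ?thesis by (simp add: assms(2) inv2_mult matrix_mul_assoc)
  qed
  have "moebius_mat J None = Some 0" by (simp add: J_def moebius_mat_def)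
  then have "moebius_mat (M ** J) None = moebius_mat M (Some 0)" using moebius_mult[OF dJ, of M None] by simp
  then show ?thesis
    using attracting_point[OF matrices_inv[OF sub assms(1)] e _ assms(4)] assms(3) dJ by (simp add: det_mul)
qed

end

section \<open>Moebius transformations as products of inversions\<close>

lemma BijGroup_mult: "f \<in> carrier (BijGroup UNIV) \<Longrightarrow> g \<in> carrier (BijGroup UNIV) \<Longrightarrow> f \<otimes>\<^bsub>BijGroup UNIV\<^esub> g = f \<circ> g"
  by (auto simp: BijGroup_def compose_def fun_eq_iff)

lemma Moeb_S2_carrier: "f \<in> Moeb_S2 \<Longrightarrow> f \<in> carrier (BijGroup UNIV)"
  unfolding Moeb_S2_def
  by (meson group.generate_in_carrier group_BijGroup inversions_subset_BijGroup)

lemma Moeb_S2_comp: assumes "f \<in> Moeb_S2" "g \<in> Moeb_S2" shows "f \<circ> g \<in> Moeb_S2"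
proof -
  have "f \<otimes>\<^bsub>BijGroup UNIV\<^esub> g \<in> Moeb_S2" using assms unfolding Moeb_S2_def by (rule generate.eng)
  then show ?thesis using BijGroup_mult[OF assms[THEN Moeb_S2_carrier]] by simp
qed

lemma Moeb_S2_bij: "f \<in> Moeb_S2 \<Longrightarrow> bij f"
  using Moeb_S2_carrier by (auto simp: BijGroup_def Bij_def)

lemma inversions_Moeb_S2: "r > 0 \<Longrightarrow> circle_inversion c r \<in> Moeb_S2" "a \<noteq> 0 \<Longrightarrow> line_inversion a b \<in> Moeb_S2"
  unfolding Moeb_S2_def inversions_def by (auto intro!: generate.incl)

lemma id_Moeb_S2: "(\<lambda>x. x) \<in> Moeb_S2"
proof -
  have "\<one>\<^bsub>BijGroup UNIV\<^esub> = (\<lambda>x::complex option. x)" by (auto simp: BijGroup_def)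
  then show ?thesis using generate.one[of "BijGroup UNIV" inversions] unfolding Moeb_S2_def by simp
qed

lemma reflection_Moeb_S2: assumes "norm u = 1" shows "map_option (\<lambda>z. u * cnj z) \<in> Moeb_S2"
proof -
  define v where "v = csqrt u"
  have v: "v * v = u" "norm v = 1" using assms by (simp_all add: v_def norm_csqrt flip: power2_eq_square)
  have vv: "v * cnj v = 1" using v(2) complex_norm_square[of v] by simp
  \<comment> \<open>Normal vector of the line through 0 in the direction of \<open>v\<close>, a
    square root of \<open>u\<close>; reflection in this line is
    \<open>z \<mapsto> u * cnj z\<close>.\<close>
  define a where "a = \<i> * v"
  have "z - (2 * (a \<bullet> z - 0) / (a \<bullet> a)) *\<^sub>R a = u * cnj z" for z
  proof -
    have aa: "a \<bullet> a = 1" using v(2) by (simp add: a_def dot_square_norm norm_mult)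
    have "of_real (2 * (a \<bullet> z)) = cnj a * z + a * cnj z"
      by (simp add: inner_complex_def complex_eq_iff)
    then have "z - (2 * (a \<bullet> z - 0) / (a \<bullet> a)) *\<^sub>R a = z - (cnj a * z + a * cnj z) * a"
      unfolding aa by (simp only: scaleR_conv_of_real div_by_1 diff_0_right)
    also have "\<dots> = z - (v * cnj v) * z + v * v * cnj z" by (simp add: a_def algebra_simps)
    finally show ?thesis by (simp add: v vv)
  qed
  then have "map_option (\<lambda>z. u * cnj z) = line_inversion a 0" unfolding line_inversion_def by simp
  moreover have "a \<noteq> 0" using v(2) by (auto simp: a_def)
  ultimately show ?thesis by (simp add: inversions_Moeb_S2)
qed

lemma conj_Moeb_S2: "map_option cnj \<in> Moeb_S2"
  using reflection_Moeb_S2[of 1] by simp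

lemma mult_Moeb_S2: assumes "\<mu> \<noteq> 0" shows "map_option (\<lambda>z. \<mu> * z) \<in> Moeb_S2"
proof -
  \<comment> \<open>Two concentric inversions compose to the dilation by the squared ratio of the
    radii; two reflections supply the rotation.\<close>
  have "circle_inversion 0 (sqrt (norm \<mu>)) \<circ> circle_inversion 0 1 \<in> Moeb_S2"
    using assms by (intro Moeb_S2_comp inversions_Moeb_S2) auto
  moreover have "circle_inversion 0 (sqrt (norm \<mu>)) \<circ> circle_inversion 0 1 = map_option (\<lambda>z. of_real (norm \<mu>) * z)"
    by (auto simp: circle_inversion_def fun_eq_iff split: option.split)
  ultimately have 1: "map_option (\<lambda>z. of_real (norm \<mu>) * z) \<in> Moeb_S2" by simp
  have "map_option (\<lambda>z. sgn \<mu> * cnj z) \<circ> map_option cnj \<circ> map_option (\<lambda>z. of_real (norm \<mu>) * z) \<in> Moeb_S2"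
    using assms by (intro Moeb_S2_comp 1 conj_Moeb_S2 reflection_Moeb_S2) (simp add: norm_sgn)
  moreover have "map_option (\<lambda>z. sgn \<mu> * cnj z) \<circ> map_option cnj \<circ> map_option (\<lambda>z. of_real (norm \<mu>) * z) = map_option (\<lambda>z. \<mu> * z)"
    using assms by (auto simp: fun_eq_iff option.map_comp o_def sgn_eq intro!: option.map_cong)
  ultimately show ?thesis by simp
qed

lemma translation_Moeb_S2: "map_option (\<lambda>z. z + t) \<in> Moeb_S2"
proof (cases "t = 0")
  case True
  then have "map_option (\<lambda>z. z + t) = (\<lambda>x. x)" by (simp add: fun_eq_iff option.map_ident)
  then show ?thesis using id_Moeb_S2 by simp
next
  case False
  \<comment> \<open>The reflections are in parallel lines at distance half of
    \<open>norm t\<close>.\<close>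
  have "line_inversion t ((t \<bullet> t) / 2) \<circ> line_inversion t 0 \<in> Moeb_S2"
    using False by (intro Moeb_S2_comp inversions_Moeb_S2)
  moreover have "line_inversion t ((t \<bullet> t) / 2) \<circ> line_inversion t 0 = map_option (\<lambda>z. z + t)"
  proof -
    have "w - (2 * (t \<bullet> w - (t \<bullet> t) / 2) / (t \<bullet> t)) *\<^sub>R t = z + t" if w: "w = z - (2 * (t \<bullet> z - 0) / (t \<bullet> t)) *\<^sub>R t" for z w
    proof -
      have "t \<bullet> t \<noteq> 0" using False by simp
      then have "t \<bullet> w = - (t \<bullet> z)" by (simp add: w inner_diff_right)
      then have "2 * (t \<bullet> w - (t \<bullet> t) / 2) / (t \<bullet> t) = - (2 * (t \<bullet> z - 0) / (t \<bullet> t)) - 1"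
        using \<open>t \<bullet> t \<noteq> 0\<close> by (simp add: field_simps)
      then show ?thesis unfolding w by (simp add: scaleR_left_diff_distrib)
    qed
    then show ?thesis unfolding line_inversion_def by (auto simp: fun_eq_iff option.map_comp o_def intro!: option.map_cong)
  qed
  ultimately show ?thesis by simp
qed

text \<open>If the lower left entry \<open>c\<close> is not 0, the map is
  \<open>z \<mapsto> a / c - (1 / c^2) / (z + d / c)\<close>, and \<open>1 / z\<close> is the
  inversion in the unit circle followed by conjugation.\<close>

lemma moebius_Moeb_S2: assumes "det A = 1" shows "moebius_mat A \<in> Moeb_S2"
proof (cases "A$2$1 = 0")
  case True
  then have ad: "A$1$1 * A$2$2 = 1" using assms by (simp add: det_2)
  then have nz: "A$1$1 \<noteq> 0" "A$2$2 \<noteq> 0" by auto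
  have "moebius_mat A = map_option (\<lambda>z. z + A$1$2 / A$2$2) \<circ> map_option (\<lambda>z. (A$1$1 / A$2$2) * z)"
    using True nz by (auto simp: fun_eq_iff moebius_mat_def Let_def field_simps split: option.split)
  moreover have "map_option (\<lambda>z. z + A$1$2 / A$2$2) \<circ> map_option (\<lambda>z. (A$1$1 / A$2$2) * z) \<in> Moeb_S2"
    by (intro Moeb_S2_comp translation_Moeb_S2 mult_Moeb_S2) (use nz in simp)
  ultimately show ?thesis by (simp only:)
next
  case False
  define c d a where "c = A$2$1" and "d = A$2$2" and "a = A$1$1"
  have c: "c \<noteq> 0" using False by (simp add: c_def)
  have b: "A$1$2 = (a * d - 1) / c" using assms c by (simp add: det_2 a_def c_def d_def field_simps)
  have J: "map_option cnj \<circ> circle_inversion 0 1 \<in> Moeb_S2" by (intro Moeb_S2_comp conj_Moeb_S2 inversions_Moeb_S2) simp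
  have "moebius_mat A = map_option (\<lambda>z. z + a / c) \<circ> map_option (\<lambda>z. (- 1 / c^2) * z) \<circ>
     (map_option cnj \<circ> circle_inversion 0 1) \<circ> map_option (\<lambda>z. z + d / c)"
  proof
    fix \<xi>
    show "moebius_mat A \<xi> = (map_option (\<lambda>z. z + a / c) \<circ> map_option (\<lambda>z. (- 1 / c^2) * z) \<circ>
     (map_option cnj \<circ> circle_inversion 0 1) \<circ> map_option (\<lambda>z. z + d / c)) \<xi>"
    proof (cases \<xi>)
      case None
      then show ?thesis using c by (simp add: moebius_mat_def Let_def circle_inversion_def a_def[symmetric] c_def[symmetric])
    next
      case (Some z)
      have zc: "z + d / c = (c * z + d) / c" using c by (simp add: field_simps)
      show ?thesis
      proof (cases "c * z + d = 0")
        case True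
        then show ?thesis by (simp add: Some zc moebius_mat_def Let_def circle_inversion_def a_def[symmetric] c_def[symmetric] d_def[symmetric])
      next
        case False
        have "(a * z + (a * d - 1) / c) / (c * z + d) = - 1 / c^2 * (1 / ((c * z + d) / c)) + a / c"
        proof -
          have "a * z + (a * d - 1) / c = (a * (c * z + d) - 1) / c" using c by (simp add: field_simps)
          then show ?thesis using False c by (simp add: divide_simps power2_eq_square) (simp add: algebra_simps)?
        qed
        then show ?thesis using False c
          by (simp add: Some zc moebius_mat_def Let_def circle_inversion_def b a_def[symmetric] c_def[symmetric] d_def[symmetric])
      qed
    qed
  qed
  moreover have "map_option (\<lambda>z. z + a / c) \<circ> map_option (\<lambda>z. (- 1 / c^2) * z) \<circ>
     (map_option cnj \<circ> circle_inversion 0 1) \<circ> map_option (\<lambda>z. z + d / c) \<in> Moeb_S2"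
    by (intro Moeb_S2_comp[OF Moeb_S2_comp[OF Moeb_S2_comp]] J translation_Moeb_S2 mult_Moeb_S2) (use c in simp)
  ultimately show ?thesis by (simp only:)
qed

section \<open>Normal forms: three points and eigenvectors\<close>

lemma three_points:
  assumes "distinct [\<xi>, \<eta>, \<zeta>]"
  obtains M where "det M = 1" "moebius_mat M (Some 0) = \<xi>" "moebius_mat M (Some 1) = \<eta>" "moebius_mat M None = \<zeta>"
proof -
  obtain x1 x2 where x: "\<xi> = hom_point x1 x2" "x1 \<noteq> 0 \<or> x2 \<noteq> 0" by (rule hom_point_cases)
  obtain y1 y2 where y: "\<eta> = hom_point y1 y2" "y1 \<noteq> 0 \<or> y2 \<noteq> 0" by (rule hom_point_cases)
  obtain z1 z2 where z: "\<zeta> = hom_point z1 z2" "z1 \<noteq> 0 \<or> z2 \<noteq> 0" by (rule hom_point_cases)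
  have xy: "x1 * y2 - y1 * x2 \<noteq> 0" and yz: "y1 * z2 - z1 * y2 \<noteq> 0" and xz: "x1 * z2 - z1 * x2 \<noteq> 0"
    using assms x y z hom_point_eq_iff by auto
  \<comment> \<open>Coefficients of the linear relation among three vectors in the plane:
    \<open>s * z + t * x\<close> is \<open>x1 * z2 - z1 * x2\<close> times \<open>y\<close>. The
    columns of \<open>M\<close> are multiples of \<open>s * z\<close> and \<open>t * x\<close> by a
    common factor, so infinity, 0 and 1 go to the three points.\<close>
  define s t where "s = x1 * y2 - y1 * x2" and "t = y1 * z2 - z1 * y2"
  have nz: "s \<noteq> 0" "t \<noteq> 0" using xy yz by (auto simp: s_def t_def)
  define D where "D = s * z1 * (t * x2) - (t * x1) * (s * z2)"
  have D: "D \<noteq> 0"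
  proof -
    have "D = - (s * t * (x1 * z2 - z1 * x2))" by (simp add: D_def algebra_simps)
    then show ?thesis using nz xz by simp
  qed
  define k where "k = 1 / csqrt D"
  have "csqrt D * csqrt D = D" by (simp flip: power2_eq_square)
  then have k: "k * k * D = 1" "k \<noteq> 0" using D by (simp_all add: k_def)
  define M where "M = mat2 (k * (s * z1)) (k * (t * x1)) (k * (s * z2)) (k * (t * x2))"
  have 1: "det M = 1"
  proof -
    have "det M = k * k * D" by (simp add: M_def det_2 D_def algebra_simps)
    then show ?thesis by (simp add: k)
  qed
  have 2: "moebius_mat M (Some 0) = \<xi>"
  proof -
    have "moebius_mat M (hom_point 0 1) = hom_point (k * t * x1) (k * t * x2)"
      by (subst moebius_hom_point) (simp_all add: M_def mult_ac)
    then show ?thesis using hom_point_scale[of "k * t" x1 x2] k nz by (simp add: x hom_point_simps)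
  qed
  have 3: "moebius_mat M None = \<zeta>"
  proof -
    have "moebius_mat M (hom_point 1 0) = hom_point (k * s * z1) (k * s * z2)"
      by (subst moebius_hom_point) (simp_all add: M_def mult_ac)
    then show ?thesis using hom_point_scale[of "k * s" z1 z2] k nz by (simp add: z hom_point_simps)
  qed
  have 4: "moebius_mat M (Some 1) = \<eta>"
  proof -
    have "moebius_mat M (hom_point 1 1) = hom_point (k * (s * z1 + t * x1)) (k * (s * z2 + t * x2))"
      by (subst moebius_hom_point) (simp_all add: M_def algebra_simps)
    also have "s * z1 + t * x1 = (x1 * z2 - z1 * x2) * y1" by (simp add: s_def t_def algebra_simps)
    also have "s * z2 + t * x2 = (x1 * z2 - z1 * x2) * y2" by (simp add: s_def t_def algebra_simps)
    also have "hom_point (k * ((x1 * z2 - z1 * x2) * y1)) (k * ((x1 * z2 - z1 * x2) * y2)) = hom_point y1 y2"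
      using hom_point_scale[of "k * (x1 * z2 - z1 * x2)" y1 y2] k xz by (simp add: mult.assoc)
    finally show ?thesis by (simp add: y hom_point_simps)
  qed
  show thesis by (rule that[OF 1 2 4 3])
qed

lemma two_points:
  assumes "\<xi> \<noteq> \<zeta>"
  obtains M where "det M = 1" "moebius_mat M (Some 0) = \<xi>" "moebius_mat M None = \<zeta>"
proof -
  have "infinite (Some ` (UNIV :: complex set))" by (simp add: finite_image_iff infinite_UNIV_char_0)
  then have "\<not> Some ` (UNIV :: complex set) \<subseteq> {\<xi>, \<zeta>}" by (metis finite.emptyI finite_insert finite_subset)
  then obtain \<eta> where "\<eta> \<notin> {\<xi>, \<zeta>}" by blast
  then have "distinct [\<xi>, \<eta>, \<zeta>]" using assms by auto
  then obtain M where "det M = 1" "moebius_mat M (Some 0) = \<xi>" "moebius_mat M None = \<zeta>"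
    by (rule three_points)
  then show thesis by (rule that)
qed

lemma moebius_fixes_three:
  assumes "det Z = 1" "moebius_mat Z (Some 0) = Some 0" "moebius_mat Z (Some 1) = Some 1" "moebius_mat Z None = None"
  shows "moebius_mat Z \<xi> = \<xi>"
proof -
  have c: "Z$2$1 = 0" using assms(4) by (simp add: moebius_mat_def Let_def split: if_splits)
  have "Z$1$1 * Z$2$2 = 1" using assms(1) c by (simp add: det_2)
  then have d: "Z$2$2 \<noteq> 0" by auto
  have b: "Z$1$2 = 0" using assms(2) c d by (simp add: moebius_mat_def Let_def)
  have "Z$1$1 = Z$2$2" using assms(3) b c d by (simp add: moebius_mat_def Let_def)
  then show ?thesis using b c d by (cases \<xi>) (simp_all add: moebius_mat_def Let_def)
qed

lemma moebius_agree:
  assumes det: "det X = 1" "det Y = 1" and dist: "distinct [x, y, z]"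
    and eq: "moebius_mat X x = moebius_mat Y x" "moebius_mat X y = moebius_mat Y y" "moebius_mat X z = moebius_mat Y z"
  shows "moebius_mat X \<xi> = moebius_mat Y \<xi>"
proof -
  obtain M where M: "det M = 1" "moebius_mat M (Some 0) = x" "moebius_mat M (Some 1) = y" "moebius_mat M None = z"
    using three_points[OF dist] .
  define Z where "Z = inv2 M ** (inv2 Y ** (X ** M))"
  have Z: "det Z = 1" using M det by (simp add: Z_def det_mul)
  have act: "moebius_mat Z \<eta> = moebius_mat (inv2 M) (moebius_mat (inv2 Y) (moebius_mat X (moebius_mat M \<eta>)))" for \<eta>
    using M det by (simp add: Z_def moebius_mult det_mul)
  have "moebius_mat Z (moebius_mat (inv2 M) \<xi>) = moebius_mat (inv2 M) \<xi>"
    by (rule moebius_fixes_three[OF Z]) (use M eq det in \<open>simp_all add: act\<close>, (metis moebius_inv2(2))+)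
  then have "moebius_mat (inv2 M) (moebius_mat (inv2 Y) (moebius_mat X \<xi>)) = moebius_mat (inv2 M) \<xi>"
    using M by (simp add: act)
  then have "moebius_mat (inv2 Y) (moebius_mat X \<xi>) = \<xi>" using M by (simp add: moebius_eq_iff)
  then show ?thesis using moebius_inv2(1)[OF det(2)] by metis
qed

text \<open>A non-zero row of \<open>A - l\<close> determines the vector, and singularity of
  \<open>A - l\<close> makes the other row vanish on it.\<close>

lemma eigenvector:
  fixes A :: "complex^2^2"
  assumes "det A = 1" "l ^ 2 - (A$1$1 + A$2$2) * l + 1 = 0"
  obtains x y where "x \<noteq> 0 \<or> y \<noteq> 0" "A$1$1 * x + A$1$2 * y = l * x" "A$2$1 * x + A$2$2 * y = l * y"
proof -
  have d: "A$1$1 * A$2$2 - A$1$2 * A$2$1 = 1" using assms(1) by (simp add: det_2)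
  have e: "(l - A$1$1) * (l - A$2$2) = A$1$2 * A$2$1"
  proof -
    have "(l - A$1$1) * (l - A$2$2) = (l ^ 2 - (A$1$1 + A$2$2) * l + 1) + A$1$1 * A$2$2 - 1"
      by (simp add: algebra_simps power2_eq_square)
    also have "\<dots> = A$1$1 * A$2$2 - 1" by (simp add: assms(2))
    also have "\<dots> = A$1$2 * A$2$1" using d by (simp add: algebra_simps)
    finally show ?thesis .
  qed
  consider "A$1$2 \<noteq> 0 \<or> l \<noteq> A$1$1" | "A$1$2 = 0" "l = A$1$1" "l \<noteq> A$2$2 \<or> A$2$1 \<noteq> 0" | "A$1$2 = 0" "l = A$1$1" "l = A$2$2" "A$2$1 = 0"
    by blast
  then show thesis
  proof cases
    case 1
    have "A$2$1 * A$1$2 + A$2$2 * (l - A$1$1) = l * (l - A$1$1)" using e by (simp add: algebra_simps)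
    then show thesis using that[of "A$1$2" "l - A$1$1"] 1 by (simp add: algebra_simps)
  next
    case 2
    then show thesis using that[of "l - A$2$2" "A$2$1"] by (auto simp: algebra_simps)
  next
    case 3
    then show thesis using that[of 1 0] by simp
  qed
qed

text \<open>The trace is \<open>l + 1 / l\<close>. It would be real if \<open>norm l = 1\<close>,
  and real or purely imaginary if \<open>l^2\<close> were real; the hypothesis excludes
  both.\<close>

lemma diagonalise:
  fixes A :: "complex^2^2"
  assumes "det A = 1" "Re (A$1$1 + A$2$2) * Im (A$1$1 + A$2$2) \<noteq> 0"
  obtains M l where "det M = 1" "A = M ** mat2 l 0 0 (1 / l) ** inv2 M" "norm l > 1" "Im (l ^ 2) \<noteq> 0"
proof -
  define \<tau> where "\<tau> = A$1$1 + A$2$2"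
  have quad: "\<exists>l. l ^ 2 - \<tau> * l + 1 = 0"
  proof -
    define l where "l = (\<tau> + csqrt (\<tau> ^ 2 - 4)) / 2"
    have "2 * (x / 2) = x" for x :: complex by simp
    then have "2 * l - \<tau> = csqrt (\<tau> ^ 2 - 4)" by (simp only: l_def) simp
    then have "(2 * l - \<tau>) ^ 2 = \<tau> ^ 2 - 4" by simp
    then have "4 * (l ^ 2 - \<tau> * l + 1) = 0" by (simp add: power2_eq_square algebra_simps)
    then show ?thesis by (metis mult_eq_0_iff zero_neq_numeral)
  qed
  then obtain k where k: "k ^ 2 - \<tau> * k + 1 = 0" by blast
  have props: "l \<noteq> 0 \<and> \<tau> = l + 1 / l \<and> norm l \<noteq> 1 \<and> Im (l ^ 2) \<noteq> 0" if "l ^ 2 - \<tau> * l + 1 = 0" for l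
  proof -
    have l: "l \<noteq> 0" using that by auto
    then have t: "\<tau> = l + 1 / l" using that by (simp add: field_simps power2_eq_square)
    have ri: "Re \<tau> * Im \<tau> \<noteq> 0" using assms(2) by (simp add: \<tau>_def)
    have "norm l \<noteq> 1"
    proof
      assume "norm l = 1"
      then have "l * cnj l = 1" using complex_norm_square[of l] by simp
      then have "1 / l = cnj l" using l by (simp add: field_simps)
      then show False using ri t by simp
    qed
    moreover have "Im (l ^ 2) \<noteq> 0"
    proof
      assume "Im (l ^ 2) = 0"
      then have "Re l * Im l = 0" by (auto simp: power2_eq_square)
      moreover have "Im (1 / l) = - Im l / (norm l)^2" "Re (1 / l) = Re l / (norm l)^2"
        by (simp_all add: Im_divide Re_divide cmod_power2)
      ultimately have "Re \<tau> = 0 \<or> Im \<tau> = 0" unfolding t by auto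
      then show False using ri by auto
    qed
    ultimately show ?thesis using l t by blast
  qed
  obtain l where l: "l ^ 2 - \<tau> * l + 1 = 0" "norm l > 1"
  proof (cases "norm k > 1")
    case False
    have "k \<noteq> 0" "norm k \<noteq> 1" using props[OF k] by auto
    have "(1 / k) ^ 2 - \<tau> * (1 / k) + 1 = (k ^ 2 - \<tau> * k + 1) / k ^ 2"
      using \<open>k \<noteq> 0\<close> by (simp add: field_simps power2_eq_square)
    then have "(1 / k) ^ 2 - \<tau> * (1 / k) + 1 = 0" using k by simp
    moreover have "norm (1 / k) > 1" using \<open>norm k \<noteq> 1\<close> False \<open>k \<noteq> 0\<close> by (simp add: norm_divide field_simps)
    ultimately show thesis using that by blast
  qed (use k that in blast)
  have p: "l \<noteq> 0" "\<tau> = l + 1 / l" "Im (l ^ 2) \<noteq> 0" using props[OF l(1)] by auto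
  have l': "(1 / l) ^ 2 - \<tau> * (1 / l) + 1 = 0" using p(1) unfolding p(2) by (simp add: field_simps power2_eq_square)
  obtain x y where xy: "x \<noteq> 0 \<or> y \<noteq> 0" "A$1$1 * x + A$1$2 * y = l * x" "A$2$1 * x + A$2$2 * y = l * y"
    using eigenvector[OF assms(1), of l] l(1) by (auto simp: \<tau>_def)
  obtain u v where uv: "u \<noteq> 0 \<or> v \<noteq> 0" "A$1$1 * u + A$1$2 * v = (1 / l) * u" "A$2$1 * u + A$2$2 * v = (1 / l) * v"
    using eigenvector[OF assms(1), of "1 / l"] l' by (auto simp: \<tau>_def)
  define D where "D = x * v - u * y"
  have D: "D \<noteq> 0"
  proof
    assume "D = 0"
    then have par: "x * v = u * y" by (simp add: D_def)
    have "l ^ 2 \<noteq> 1" using p(3) by auto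
    then have ne: "l - 1 / l \<noteq> 0" using p(1) by (simp add: field_simps power2_eq_square)
    have "(l - 1 / l) * (x * u) = 0"
    proof -
      have "(l - 1 / l) * (x * u) = (l * x) * u - x * ((1 / l) * u)" by (simp add: algebra_simps)
      also have "\<dots> = A$1$2 * (u * y - x * v)" unfolding xy(2)[symmetric] uv(2)[symmetric] by (simp add: algebra_simps)
      finally show ?thesis using par by simp
    qed
    moreover have "(l - 1 / l) * (y * v) = 0"
    proof -
      have "(l - 1 / l) * (y * v) = (l * y) * v - y * ((1 / l) * v)" by (simp add: algebra_simps)
      also have "\<dots> = A$2$1 * (x * v - u * y)" unfolding xy(3)[symmetric] uv(3)[symmetric] by (simp add: algebra_simps)
      finally show ?thesis using par by simp
    qed
    ultimately have "x * u = 0" "y * v = 0" using ne by auto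
    then show False using xy(1) uv(1) par by auto
  qed
  define M where "M = mat2 x (u / D) y (v / D)"
  have dM: "det M = 1" using D by (simp add: M_def det_2 D_def diff_divide_distrib[symmetric] mult.commute)
  have "A ** M = M ** mat2 l 0 0 (1 / l)"
    using xy uv by (simp add: mat2_eq_iff mult2_nth M_def add_divide_distrib[symmetric] mult.commute)
  then have "A ** M ** inv2 M = M ** mat2 l 0 0 (1 / l) ** inv2 M" by simp
  then have "A = M ** mat2 l 0 0 (1 / l) ** inv2 M" by (simp add: matrix_mul_assoc[symmetric] inv2_inverse dM)
  then show thesis using that dM l(2) p(3) by blast
qed

section \<open>Arcs that cross between components of the ordinary set\<close>

text \<open>Cut the circle at the missing point \<open>v\<close>. On \<open>U\<close> the rotation
  adds \<phi> or \<open>\<phi> - 2 * pi\<close> to the angle; by connectedness it is always the same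
  of the two, and iterating it leaves the bounded range of angles.\<close>

lemma connected_rotation_false:
  fixes U :: "complex set"
  assumes U: "connected U" "\<And>x. x \<in> U \<Longrightarrow> norm x = 1" "u \<in> U"
    and inv: "\<And>x. x \<in> U \<Longrightarrow> \<zeta> * x \<in> U" and \<zeta>: "norm \<zeta> = 1" "\<zeta> \<noteq> 1"
    and v: "norm v = 1" "v \<notin> U"
  shows False
proof -
  have v0: "v \<noteq> 0" and z0: "\<zeta> \<noteq> 0" using v \<zeta> by auto
  define \<theta> where "\<theta> x = Arg2pi (x / v)" for x
  have unit: "z = cis (Arg2pi z)" if "norm z = 1" for z :: complex
    using Arg2pi_eq[of z] that by (simp add: cis_conv_exp)
  have rec: "x = v * cis (\<theta> x)" if "x \<in> U" for x
    using unit[of "x / v"] U(2)[OF that] v v0 by (simp add: \<theta>_def norm_divide field_simps)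
  have nonneg: "x / v \<notin> \<real>\<^sub>\<ge>\<^sub>0" if "x \<in> U" for x
  proof
    assume "x / v \<in> \<real>\<^sub>\<ge>\<^sub>0"
    then obtain r where r: "r \<ge> 0" "x / v = of_real r" by (auto simp: nonneg_Reals_def)
    then have "norm (x / v) = r" by simp
    then have "r = 1" using U(2)[OF that] v by (simp add: norm_divide)
    then have "x = v" using r v0 by simp
    then show False using v that by simp
  qed
  have range: "0 < \<theta> x" "\<theta> x < 2 * pi" if "x \<in> U" for x
  proof -
    show "\<theta> x < 2 * pi" using Arg2pi[of "x / v"] by (simp add: \<theta>_def)
    have "\<theta> x \<noteq> 0"
    proof
      assume "\<theta> x = 0"
      then have "x = v" using rec[OF that] by simp
      then show False using v that by simp
    qed
    then show "0 < \<theta> x" using Arg2pi[of "x / v"] by (simp add: \<theta>_def)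
  qed
  have "continuous_on U \<theta>"
  proof (rule continuous_at_imp_continuous_on, rule ballI)
    fix x assume "x \<in> U"
    have "continuous (at x) (Arg2pi \<circ> (\<lambda>x. x / v))"
      using nonneg[OF \<open>x \<in> U\<close>] v0 by (intro continuous_at_compose continuous_at_Arg2pi continuous_intros) auto
    then show "isCont \<theta> x" by (simp add: \<theta>_def[abs_def] o_def)
  qed
  then have conn: "connected (\<theta> ` U)" using U(1) by (rule connected_continuous_image)
  define \<phi> where "\<phi> = Arg2pi \<zeta>"
  have zphi: "\<zeta> = cis \<phi>" unfolding \<phi>_def by (rule unit[OF \<zeta>(1)])
  have phi: "0 < \<phi>" "\<phi> < 2 * pi"
  proof -
    have "\<phi> \<noteq> 0" using zphi \<zeta>(2) by auto
    then show "0 < \<phi>" "\<phi> < 2 * pi" using Arg2pi[of \<zeta>] by (simp_all add: \<phi>_def)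
  qed
  have step: "\<theta> (\<zeta> * x) = \<theta> x + \<phi> \<or> \<theta> (\<zeta> * x) = \<theta> x + \<phi> - 2 * pi" if "x \<in> U" for x
  proof -
    have "cis (\<theta> (\<zeta> * x)) = cis (\<theta> x + \<phi>)"
    proof -
      have "v * cis (\<theta> (\<zeta> * x)) = \<zeta> * x" using rec[OF inv[OF that]] by simp
      also have "\<dots> = v * cis (\<theta> x + \<phi>)" by (subst rec[OF that]) (simp add: zphi cis_mult algebra_simps)
      finally show ?thesis using v0 by simp
    qed
    then have "cis (\<theta> (\<zeta> * x) - (\<theta> x + \<phi>)) = 1" by (simp add: cis_divide[symmetric])
    then obtain n :: int where n: "\<theta> (\<zeta> * x) - (\<theta> x + \<phi>) = 2 * pi * of_int n" by (rule cis_eq_1_imp)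
    have "2 * pi * of_int n < 2 * pi * 1" "2 * pi * (- 2) < 2 * pi * of_int n"
      using n range[OF that] range[OF inv[OF that]] phi by linarith+
    then have "of_int n < (1 :: real)" "(- 2 :: real) < of_int n" using pi_gt_zero by (simp_all only: mult_less_cancel_left_pos mult_pos_pos zero_less_numeral)
    then have "n = 0 \<or> n = - 1" by linarith
    then show ?thesis using n by auto
  qed
  \<comment> \<open>A point at this angle would be rotated to \<open>v\<close>. The missing value
    separates the two kinds of shift.\<close>
  have miss: "2 * pi - \<phi> \<notin> \<theta> ` U"
  proof
    assume "2 * pi - \<phi> \<in> \<theta> ` U"
    then obtain x where x: "x \<in> U" "\<theta> x = 2 * pi - \<phi>" by auto
    then show False using step[OF x(1)] range[OF inv[OF x(1)]] by auto
  qed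
  have pow: "(\<zeta> ^ n) * u \<in> U" for n
  proof (induction n)
    case (Suc n)
    then show ?case using inv[OF Suc] by (simp add: mult.assoc)
  qed (simp add: U(3))
  consider "\<forall>x\<in>U. \<theta> x < 2 * pi - \<phi>" | "\<forall>x\<in>U. \<theta> x > 2 * pi - \<phi>"
  proof -
    have "\<not> (\<exists>x\<in>U. \<exists>y\<in>U. \<theta> x < 2 * pi - \<phi> \<and> 2 * pi - \<phi> < \<theta> y)"
    proof
      assume "\<exists>x\<in>U. \<exists>y\<in>U. \<theta> x < 2 * pi - \<phi> \<and> 2 * pi - \<phi> < \<theta> y"
      then obtain x y where "x \<in> U" "y \<in> U" "\<theta> x \<le> 2 * pi - \<phi>" "2 * pi - \<phi> \<le> \<theta> y" by force
      then have "2 * pi - \<phi> \<in> \<theta> ` U" using connectedD_interval[OF conn] by blast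
      then show False using miss by simp
    qed
    then show thesis using that miss by (metis imageI linorder_neqE_linordered_idom)
  qed
  then show False
  proof cases
    case 1
    have "\<theta> ((\<zeta> ^ n) * u) = \<theta> u + n * \<phi>" for n :: nat
    proof (induction n)
      case (Suc n)
      have "\<theta> (\<zeta> * ((\<zeta> ^ n) * u)) = \<theta> ((\<zeta> ^ n) * u) + \<phi>"
        using step[OF pow[of n]] bspec[OF 1 pow[of n]] range(1)[OF inv[OF pow[of n]]] by linarith
      then show ?case using Suc by (simp add: mult.assoc algebra_simps)
    qed simp
    moreover obtain n :: nat where "2 * pi < real n * \<phi>" using phi(1) reals_Archimedean3 by blast
    ultimately show False using range[OF pow[of n]] range(1)[OF U(3)] by (metis add_strict_increasing less_asym less_imp_le)
  next
    case 2
    have "\<theta> ((\<zeta> ^ n) * u) = \<theta> u - n * (2 * pi - \<phi>)" for n :: nat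
    proof (induction n)
      case (Suc n)
      have "\<theta> (\<zeta> * ((\<zeta> ^ n) * u)) = \<theta> ((\<zeta> ^ n) * u) - (2 * pi - \<phi>)"
        using step[OF pow[of n]] bspec[OF 2 pow[of n]] range(2)[OF inv[OF pow[of n]]] by linarith
      then show ?case using Suc by (simp add: mult.assoc algebra_simps)
    qed simp
    moreover obtain n :: nat where "2 * pi < real n * (2 * pi - \<phi>)" using phi(2) reals_Archimedean3[of "2 * pi - \<phi>"] by auto
    ultimately show False using range(1)[OF pow[of n]] range(2)[OF U(3)] by (metis diff_gt_0_iff_gt less_trans less_asym)
  qed
qed

text \<open>What the choice of the ray has to know about \<Lambda>: it is closed and invariant, it
  contains the fixed points of loxodromic elements, and every orbit without a common fixed point
  comes close to each of its points.\<close>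

locale limit_set_components =
  fixes M :: "(complex^2^2) set" and \<Lambda> :: "complex option set"
  assumes M_det: "\<And>A. A \<in> M \<Longrightarrow> det A = 1"
    and M_mult: "\<And>A B. A \<in> M \<Longrightarrow> B \<in> M \<Longrightarrow> A ** B \<in> M"
    and M_inv: "\<And>A. A \<in> M \<Longrightarrow> inv2 A \<in> M"
    and M_generic: "zariski_generic M"
    and closed: "closedin S2 \<Lambda>"
    and invariant: "\<And>A \<xi>. A \<in> M \<Longrightarrow> \<xi> \<in> \<Lambda> \<Longrightarrow> moebius_mat A \<xi> \<in> \<Lambda>"
    and minimal: "\<And>\<xi> k x U. \<xi> \<in> \<Lambda> \<Longrightarrow> k \<in> M \<Longrightarrow> moebius_mat k x \<noteq> x \<Longrightarrow> openin S2 U \<Longrightarrow> \<xi> \<in> U \<Longrightarrow>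
      \<exists>C\<in>M. moebius_mat C x \<in> U"
    and attracting: "\<And>A N l. A \<in> M \<Longrightarrow> A = N ** mat2 l 0 0 (1 / l) ** inv2 N \<Longrightarrow> det N = 1 \<Longrightarrow> norm l > 1 \<Longrightarrow>
      moebius_mat N None \<in> \<Lambda>"
    and repelling: "\<And>A N l. A \<in> M \<Longrightarrow> A = N ** mat2 l 0 0 (1 / l) ** inv2 N \<Longrightarrow> det N = 1 \<Longrightarrow> norm l > 1 \<Longrightarrow>
      moebius_mat N (Some 0) \<in> \<Lambda>"
begin

definition joined :: "complex option \<Rightarrow> complex option \<Rightarrow> bool"
  where "joined \<xi> \<eta> \<longleftrightarrow> connected_component_of (subtopology S2 (- \<Lambda>)) \<xi> \<eta>"

lemma joined_connected:
  assumes "connectedin S2 K" "K \<subseteq> - \<Lambda>" "\<xi> \<in> K" "\<eta> \<in> K" shows "joined \<xi> \<eta>"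
  unfolding joined_def connected_component_of_def
  using assms by (intro exI[of _ K]) (simp add: connectedin_subtopology)

lemma joined_sym: "joined \<xi> \<eta> \<longleftrightarrow> joined \<eta> \<xi>"
  unfolding joined_def by (rule connected_component_of_sym)

lemma joined_trans: "joined \<xi> \<eta> \<Longrightarrow> joined \<eta> \<zeta> \<Longrightarrow> joined \<xi> \<zeta>"
  unfolding joined_def by (rule connected_component_of_trans)

lemma joined_refl: "\<xi> \<notin> \<Lambda> \<Longrightarrow> joined \<xi> \<xi>"
  unfolding joined_def by (simp add: connected_component_of_refl)

lemma joined_notin: "joined \<xi> \<eta> \<Longrightarrow> \<xi> \<notin> \<Lambda> \<and> \<eta> \<notin> \<Lambda>"
  unfolding joined_def using connected_component_in_topspace by fastforce

lemma joined_chart: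
  assumes "det P = 1" "connected K" "\<And>z. z \<in> K \<Longrightarrow> moebius_mat P (Some z) \<notin> \<Lambda>" "z \<in> K" "w \<in> K"
  shows "joined (moebius_mat P (Some z)) (moebius_mat P (Some w))"
proof (rule joined_connected)
  have "connectedin euclidean K" using assms(2) by simp
  then have "connectedin S2 (Some ` K)" by (rule connectedin_continuous_map_image[OF continuous_map_S2_Some])
  then show "connectedin S2 (moebius_mat P ` Some ` K)"
    by (rule connectedin_continuous_map_image[OF moebius_continuous[OF assms(1)]])
qed (use assms in auto)

lemma invariant_iff: assumes "A \<in> M" shows "moebius_mat A \<xi> \<in> \<Lambda> \<longleftrightarrow> \<xi> \<in> \<Lambda>"
  using invariant[OF assms] invariant[OF M_inv[OF assms], of "moebius_mat A \<xi>"] M_det[OF assms] by auto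

lemma joined_image:
  assumes "A \<in> M" "joined \<xi> \<eta>" shows "joined (moebius_mat A \<xi>) (moebius_mat A \<eta>)"
proof -
  obtain K where K: "connectedin (subtopology S2 (- \<Lambda>)) K" "\<xi> \<in> K" "\<eta> \<in> K"
    using assms(2) unfolding joined_def connected_component_of_def by blast
  then have K': "connectedin S2 K" "K \<subseteq> - \<Lambda>" by (auto simp: connectedin_subtopology)
  have "connectedin S2 (moebius_mat A ` K)"
    by (rule connectedin_continuous_map_image[OF moebius_continuous[OF M_det[OF assms(1)]] K'(1)])
  then show ?thesis
    by (rule joined_connected) (use K K' invariant_iff[OF assms(1)] in auto)
qed

lemma chart_open: assumes "det P = 1" shows "open {z. moebius_mat P (Some z) \<notin> \<Lambda>}"
proof -
  have "openin S2 (- \<Lambda>)" using closed openin_diff[OF openin_topspace closed] by (simp add: Compl_eq_Diff_UNIV)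
  moreover have "continuous_map euclidean S2 (moebius_mat P \<circ> Some)"
    by (rule continuous_map_compose[OF continuous_map_S2_Some moebius_continuous[OF assms]])
  ultimately have "openin euclidean {z \<in> topspace euclidean. (moebius_mat P \<circ> Some) z \<in> - \<Lambda>}"
    using openin_continuous_map_preimage by blast
  then show ?thesis by simp
qed

lemma segment_meets:
  assumes P: "det P = 1" and nj: "\<not> joined (moebius_mat P (Some 0)) (moebius_mat P (Some 1))"
    and ends: "moebius_mat P (Some 0) \<notin> \<Lambda>" "moebius_mat P (Some 1) \<notin> \<Lambda>"
  obtains s :: real where "0 < s" "s < 1" "moebius_mat P (Some (of_real s)) \<in> \<Lambda>"
proof (rule ccontr)
  assume no: "\<not> thesis"
  note ob = that
  have "moebius_mat P (Some (of_real s)) \<notin> \<Lambda>" if s: "s \<in> {0..1}" for s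
  proof
    assume c: "moebius_mat P (Some (of_real s)) \<in> \<Lambda>"
    then have "s \<noteq> 0" "s \<noteq> 1" using ends by auto
    then show False using ob[OF _ _ c] no s by auto
  qed
  then have "moebius_mat P (Some z) \<notin> \<Lambda>" if "z \<in> of_real ` {0..1 :: real}" for z using that by auto
  moreover have "connected ((of_real :: real \<Rightarrow> complex) ` {0..1})"
    by (intro connected_continuous_image continuous_intros) auto
  moreover have "(0 :: complex) \<in> of_real ` {0..1 :: real}" "(1 :: complex) \<in> of_real ` {0..1 :: real}"
    by (auto simp: image_iff intro: bexI[of _ 0] bexI[of _ 1])
  ultimately have "joined (moebius_mat P (Some 0)) (moebius_mat P (Some 1))"
    by (intro joined_chart[OF P, of "of_real ` {0..1 :: real}" 0 1])
  then show False using nj by blast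
qed

text \<open>The arc is the image under \<open>P\<close> of the positive real axis; it ends at \<open>P \<infinity>\<close>.\<close>

definition good_arc :: "complex^2^2 \<Rightarrow> real \<Rightarrow> real \<Rightarrow> bool"
  where "good_arc P r\<^sub>1 r\<^sub>2 \<longleftrightarrow> det P = 1 \<and> moebius_mat P (Some 0) \<in> \<Lambda> \<and> 0 < r\<^sub>1 \<and> 0 < r\<^sub>2 \<and>
    moebius_mat P (Some (of_real r\<^sub>1)) \<notin> \<Lambda> \<and> moebius_mat P (Some (of_real r\<^sub>2)) \<notin> \<Lambda> \<and>
    \<not> joined (moebius_mat P (Some (of_real r\<^sub>1))) (moebius_mat P (Some (of_real r\<^sub>2)))"

text \<open>Otherwise the product of real and imaginary part of the trace would vanish on the group
  and hence on all of SL2, which the diagonal matrix with entry \<open>1 + \<i>\<close>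
  refutes.\<close>

lemma loxodromic:
  obtains A N l where "A \<in> M" "A = N ** mat2 l 0 0 (1 / l) ** inv2 N" "det N = 1" "norm l > 1" "Im (l ^ 2) \<noteq> 0"
proof -
  have "\<exists>A\<in>M. Re (A$1$1 + A$2$2) * Im (A$1$1 + A$2$2) \<noteq> 0"
  proof (rule ccontr)
    assume "\<not> ?thesis"
    then have 0: "\<forall>A\<in>M. Re (A$1$1 + A$2$2) * Im (A$1$1 + A$2$2) = 0" by blast
    have "real_polynomial_function (\<lambda>A :: complex^2^2. Re (A$1$1 + A$2$2) * Im (A$1$1 + A$2$2))"
      by (intro rpf_mult cpoly_Re cpoly_Im cpoly_add cpoly_nth)
    moreover have "det (mat2 (1 + \<i>) 0 0 (1 / (1 + \<i>))) = 1" by (simp add: det_2 complex_eq_iff)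
    ultimately have "Re ((1 + \<i>) + 1 / (1 + \<i>)) * Im ((1 + \<i>) + 1 / (1 + \<i>)) = 0"
      using M_generic 0 unfolding zariski_generic_def by (metis (mono_tags, lifting) mat2_nth(1,4))
    then show False by (simp add: Re_divide Im_divide)
  qed
  then obtain A where A: "A \<in> M" "Re (A$1$1 + A$2$2) * Im (A$1$1 + A$2$2) \<noteq> 0" by blast
  show thesis using diagonalise[OF M_det[OF A(1)] A(2)] that A(1) by metis
qed

text \<open>Fixing \<open>x\<close> is a linear equation in the matrix entries; Zariski density
  would extend it to all of SL2, but the upper and the lower unipotent matrix have no common fixed
  point.\<close>

lemma exists_moving: obtains k where "k \<in> M" "moebius_mat k x \<noteq> x"
proof (rule ccontr)
  assume "\<not> thesis"
  then have fix_x: "\<And>k. k \<in> M \<Longrightarrow> moebius_mat k x = x" using that by blast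
  obtain a b where ab: "x = hom_point a b" "a \<noteq> 0 \<or> b \<noteq> 0" by (rule hom_point_cases)
  have eqn: "(A$1$1 * a + A$1$2 * b) * b = a * (A$2$1 * a + A$2$2 * b)" if "A \<in> M" for A
    using fix_x[OF that] moebius_hom_point[OF ab(2), of A] mat2_vec_nonzero[OF M_det[OF that] ab(2)] ab
    by (simp add: hom_point_eq_iff)
  have all: "(A$1$1 * a + A$1$2 * b) * b = a * (A$2$1 * a + A$2$2 * b)" if "det A = 1" for A :: "complex^2^2"
  proof -
    define h where "h A = (A$1$1 * a + A$1$2 * b) * b - a * (A$2$1 * a + A$2$2 * b)" for A :: "complex^2^2"
    have "cpoly h" unfolding h_def by (intro cpoly_diff cpoly_mult cpoly_add cpoly_nth cpoly_const)
    then have "real_polynomial_function (\<lambda>A. Re (h A))" "real_polynomial_function (\<lambda>A. Im (h A))"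
      by (auto intro: cpoly_Re cpoly_Im)
    moreover have "\<forall>A\<in>M. Re (h A) = 0" "\<forall>A\<in>M. Im (h A) = 0" using eqn by (auto simp: h_def)
    ultimately have "Re (h A) = 0" "Im (h A) = 0" using M_generic that unfolding zariski_generic_def by blast+
    then have "h A = 0" by (simp add: complex_eq_iff)
    then show ?thesis by (simp add: h_def)
  qed
  have "det (mat2 0 (- 1) 1 0) = 1" "det (mat2 1 1 0 1) = 1" "det (mat2 1 0 1 1) = 1" by (simp_all add: det_2)
  then have "b * b = 0" "a * a = 0" using all[of "mat2 1 1 0 1"] all[of "mat2 1 0 1 1"] by (simp_all add: algebra_simps)
  then show False using ab by simp
qed

text \<open>Put the three points at 0, 1 and infinity. The real axis changes components on either
  side of infinity, so it meets \<Lambda> at some \<open>q < 0\<close> and some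
  \<open>p > 1\<close>; the arc from \<open>q\<close> through 0 and 1 to \<open>p\<close> is
  good.\<close>

lemma good_arc_three_components:
  assumes "a \<notin> \<Lambda>" "b \<notin> \<Lambda>" "c \<notin> \<Lambda>" "\<not> joined a b" "\<not> joined b c" "\<not> joined a c"
  obtains P r\<^sub>1 r\<^sub>2 where "good_arc P r\<^sub>1 r\<^sub>2" "moebius_mat P None \<in> \<Lambda>"
proof -
  have "distinct [a, b, c]" using assms joined_refl by auto
  then obtain X where X: "det X = 1" "moebius_mat X (Some 0) = a" "moebius_mat X (Some 1) = b" "moebius_mat X None = c"
    by (rule three_points)
  \<comment> \<open>\<open>Y1\<close> maps the unit interval to the real axis from infinity down to
    1, and \<open>Y2\<close> maps it to the real axis from 0 through the negative numbers to
    infinity.\<close>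
  define Y1 Y2 where "Y1 = mat2 0 \<i> \<i> 0" and "Y2 = mat2 (- \<i>) 0 (- \<i>) \<i>"
  have Y: "det Y1 = 1" "det Y2 = 1" by (simp_all add: Y1_def Y2_def det_2)
  have XY: "det (X ** Y1) = 1" "det (X ** Y2) = 1" using X Y by (simp_all add: det_mul)
  have Y1_Some: "moebius_mat Y1 (Some z) = (if z = 0 then None else Some (1 / z))" for z
    by (simp add: Y1_def moebius_mat_def Let_def)
  have Y2_Some: "moebius_mat Y2 (Some z) = (if z = 1 then None else Some (- z / (1 - z)))" for z
  proof -
    have "- (\<i> * z) + \<i> = \<i> * (1 - z)" by (simp add: algebra_simps)
    then show ?thesis by (auto simp: Y2_def moebius_mat_def Let_def)
  qed
  obtain s where s: "0 < s" "s < 1" "moebius_mat (X ** Y1) (Some (of_real s)) \<in> \<Lambda>"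
    by (rule segment_meets[OF XY(1)])
      (use assms X joined_sym in \<open>auto simp: moebius_mult[OF Y(1), symmetric] Y1_Some\<close>)
  obtain t where t: "0 < t" "t < 1" "moebius_mat (X ** Y2) (Some (of_real t)) \<in> \<Lambda>"
    by (rule segment_meets[OF XY(2)])
      (use assms X joined_sym in \<open>auto simp: moebius_mult[OF Y(2), symmetric] Y2_Some\<close>)
  define p q where "p = 1 / s" and "q = - t / (1 - t)"
  have p: "p > 1" "moebius_mat X (Some (of_real p)) \<in> \<Lambda>"
    using s by (auto simp: p_def moebius_mult[OF Y(1), symmetric] Y1_Some)
  have q: "q < 0" "moebius_mat X (Some (of_real q)) \<in> \<Lambda>"
  proof -
    have "of_real t \<noteq> (1 :: complex)" using t by auto
    then show "moebius_mat X (Some (of_real q)) \<in> \<Lambda>"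
      using t(3) by (simp add: q_def moebius_mult[OF Y(2), symmetric] Y2_Some)
  qed (use t in \<open>auto simp: q_def divide_neg_pos\<close>)
  define k where "k = 1 / sqrt (p - q)"
  have kk: "k * k * (p - q) = 1" "k \<noteq> 0" using p q by (auto simp: k_def)
  \<comment> \<open>\<open>Z\<close> sends 0 to \<open>q\<close> and infinity to \<open>p\<close>,
    so that the positive reals parametrise the arc; \<open>k\<close> normalises the
    determinant.\<close>
  define Z where "Z = mat2 (of_real (k * p)) (of_real (k * q)) (of_real k) (of_real k)"
  have Z: "det Z = 1"
  proof -
    have "det Z = of_real (k * k * (p - q))" by (simp add: Z_def det_2 algebra_simps)
    then show ?thesis by (simp add: kk)
  qed
  have Z_Some: "moebius_mat Z (Some (of_real r)) = Some (of_real ((p * r + q) / (r + 1)))" if "r + 1 \<noteq> 0" for r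
  proof -
    have "of_real k * of_real r + of_real k = (of_real (k * (r + 1)) :: complex)" by (simp add: algebra_simps)
    moreover have "of_real (k * p) * of_real r + of_real (k * q) = (of_real (k * (p * r + q)) :: complex)" by (simp add: algebra_simps)
    ultimately show ?thesis using kk that unfolding moebius_mat_def Let_def Z_def mat2_nth option.case
      by (simp only: of_real_eq_0_iff of_real_divide[symmetric]) simp
  qed
  have Z_None: "moebius_mat Z None = Some (of_real p)"
    using kk by (simp add: Z_def moebius_mat_def)
  \<comment> \<open>The parameters at which the arc passes through 0 and 1.\<close>
  define r\<^sub>1 r\<^sub>2 where "r\<^sub>1 = - q / p" and "r\<^sub>2 = (1 - q) / (p - 1)"
  have r: "r\<^sub>1 > 0" "r\<^sub>2 > 0" using p q by (auto simp: r\<^sub>1_def r\<^sub>2_def divide_neg_pos)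
  have "p * r\<^sub>1 + q = 0" using p by (simp add: r\<^sub>1_def)
  moreover have "(p * r\<^sub>2 + q) / (r\<^sub>2 + 1) = 1"
  proof -
    have "p * r\<^sub>2 + q = r\<^sub>2 + 1" using p by (simp add: r\<^sub>2_def field_simps)
    then show ?thesis using r by simp
  qed
  ultimately have "moebius_mat Z (Some (of_real r\<^sub>1)) = Some 0" "moebius_mat Z (Some (of_real r\<^sub>2)) = Some 1"
    using Z_Some[of r\<^sub>1] Z_Some[of r\<^sub>2] r by simp_all
  moreover have "moebius_mat Z (Some 0) = Some (of_real q)" using Z_Some[of 0] by simp
  ultimately have "good_arc (X ** Z) r\<^sub>1 r\<^sub>2" "moebius_mat (X ** Z) None \<in> \<Lambda>"
    using X Z r p q assms Z_None by (simp_all add: good_arc_def det_mul moebius_mult[OF Z, symmetric])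
  then show thesis using that by blast
qed

text \<open>\<open>E \<epsilon>\<close> fixes 0 and moves infinity to \<open>1 / \<epsilon>\<close>;
  for small \<epsilon> the two marked points stay in their components. By \<open>minimal\<close>,
  the orbit of \<open>x\<close> comes close enough to the old end point to supply the new
  one.\<close>

lemma good_arc_perturb:
  assumes P: "good_arc P r\<^sub>1 r\<^sub>2" "moebius_mat P None \<in> \<Lambda>"
  obtains C P' where "C \<in> M" "good_arc P' r\<^sub>1 r\<^sub>2" "moebius_mat P' None = moebius_mat C x"
proof -
  note P' = P(1)[unfolded good_arc_def]
  have dP: "det P = 1" using P' by blast
  define E where "E \<epsilon> = mat2 1 0 \<epsilon> 1" for \<epsilon> :: complex
  have E: "det (E \<epsilon>) = 1" for \<epsilon> by (simp add: E_def det_2)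
  have near: "\<exists>\<delta>>0. \<forall>\<epsilon>. norm \<epsilon> < \<delta> \<longrightarrow> joined (moebius_mat P (Some (of_real r))) (moebius_mat (P ** E \<epsilon>) (Some (of_real r)))"
    if r: "moebius_mat P (Some (of_real r)) \<notin> \<Lambda>" for r :: real
  proof -
    obtain \<eta> where \<eta>: "\<eta> > 0" "ball (of_real r) \<eta> \<subseteq> {z. moebius_mat P (Some z) \<notin> \<Lambda>}"
      using chart_open[OF dP] r open_contains_ball by (metis (no_types, lifting) mem_Collect_eq)
    have "((\<lambda>\<epsilon> :: complex. of_real r / (\<epsilon> * of_real r + 1)) \<longlongrightarrow> of_real r / (0 * of_real r + 1)) (at 0)"
      by (intro tendsto_intros) auto
    then have "\<forall>\<^sub>F \<epsilon> :: complex in at 0. dist (of_real r / (\<epsilon> * of_real r + 1)) (of_real r / (0 * of_real r + 1)) < \<eta>"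
      using \<eta>(1) by (rule tendstoD)
    moreover have "((\<lambda>\<epsilon> :: complex. \<epsilon> * of_real r + 1) \<longlongrightarrow> 0 * of_real r + 1) (at 0)" by (intro tendsto_intros)
    from tendsto_imp_eventually_ne[OF this, of 0] have "\<forall>\<^sub>F \<epsilon> :: complex in at 0. \<epsilon> * of_real r + 1 \<noteq> 0" by simp
    ultimately have "\<forall>\<^sub>F \<epsilon> :: complex in at 0. dist (of_real r / (\<epsilon> * of_real r + 1)) (of_real r) < \<eta> \<and> \<epsilon> * of_real r + 1 \<noteq> 0"
      by eventually_elim simp
    then obtain \<delta> where \<delta>: "\<delta> > 0" "\<And>\<epsilon> :: complex. \<epsilon> \<noteq> 0 \<Longrightarrow> dist \<epsilon> 0 < \<delta> \<Longrightarrow>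
        dist (of_real r / (\<epsilon> * of_real r + 1)) (of_real r) < \<eta> \<and> \<epsilon> * of_real r + 1 \<noteq> 0"
      unfolding eventually_at by blast
    have *: "joined (moebius_mat P (Some (of_real r))) (moebius_mat (P ** E \<epsilon>) (Some (of_real r)))" if "norm \<epsilon> < \<delta>" for \<epsilon>
    proof -
      define z where "z = of_real r / (\<epsilon> * of_real r + 1)"
      have z: "dist z (of_real r) < \<eta>" "\<epsilon> * of_real r + 1 \<noteq> 0"
        using \<delta>(2)[of \<epsilon>] that \<eta>(1) by (cases "\<epsilon> = 0"; auto simp: z_def)+
      have "moebius_mat (E \<epsilon>) (Some (of_real r)) = Some z"
        using z(2) by (simp add: E_def moebius_mat_def Let_def z_def)
      then have "moebius_mat (P ** E \<epsilon>) (Some (of_real r)) = moebius_mat P (Some z)"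
        by (simp add: moebius_mult[OF E, symmetric])
      moreover have "joined (moebius_mat P (Some (of_real r))) (moebius_mat P (Some z))"
        by (rule joined_chart[OF dP, of "ball (of_real r) \<eta>"]) (use \<eta> z in \<open>auto simp: dist_commute subset_eq\<close>)
      ultimately show ?thesis by simp
    qed
    then show ?thesis using \<delta>(1) by blast
  qed
  obtain \<delta>1 where d1: "\<delta>1 > 0" "\<And>\<epsilon>. norm \<epsilon> < \<delta>1 \<Longrightarrow> joined (moebius_mat P (Some (of_real r\<^sub>1))) (moebius_mat (P ** E \<epsilon>) (Some (of_real r\<^sub>1)))"
    using near[of r\<^sub>1] P' by blast
  obtain \<delta>2 where d2: "\<delta>2 > 0" "\<And>\<epsilon>. norm \<epsilon> < \<delta>2 \<Longrightarrow> joined (moebius_mat P (Some (of_real r\<^sub>2))) (moebius_mat (P ** E \<epsilon>) (Some (of_real r\<^sub>2)))"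
    using near[of r\<^sub>2] P' by blast
  define \<delta> where "\<delta> = min \<delta>1 \<delta>2"
  have \<delta>: "\<delta> > 0" using d1(1) d2(1) by (simp add: \<delta>_def)
  \<comment> \<open>The neighbourhood of infinity that consists of the points
    \<open>1 / \<epsilon>\<close> with \<open>norm \<epsilon> < \<delta>\<close>.\<close>
  define V :: "complex option set" where "V = insert None (Some ` {z. norm z > 1 / \<delta>})"
  have "openin S2 V" unfolding openin_S2
  proof
    have "{z. Some z \<in> V} = {z. norm z > 1 / \<delta>}" by (auto simp: V_def)
    then show "open {z. Some z \<in> V}" by (simp add: open_Collect_less continuous_intros)
  qed (auto simp: V_def)
  then have U: "openin S2 {\<xi> \<in> topspace S2. moebius_mat (inv2 P) \<xi> \<in> V}"
    using dP by (intro openin_continuous_map_preimage[OF moebius_continuous]) simp_all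
  obtain k where k: "k \<in> M" "moebius_mat k x \<noteq> x" by (rule exists_moving)
  obtain C where C: "C \<in> M" "moebius_mat (inv2 P) (moebius_mat C x) \<in> V"
    using minimal[OF P(2) k U] dP by (auto simp: V_def)
  obtain \<epsilon> where \<epsilon>: "norm \<epsilon> < \<delta>" "moebius_mat (inv2 P) (moebius_mat C x) = hom_point 1 \<epsilon>"
  proof (cases "moebius_mat (inv2 P) (moebius_mat C x)")
    case None
    then show thesis using that[of 0] \<delta> by (simp add: hom_point_def)
  next
    case (Some z)
    then have "norm z > 1 / \<delta>" using C(2) by (auto simp: V_def)
    moreover from this have "z \<noteq> 0" using \<delta> by auto
    ultimately show thesis using that[of "1 / z"] \<delta> Some by (simp add: hom_point_def norm_divide field_simps)
  qed
  have "moebius_mat (E \<epsilon>) None = hom_point 1 \<epsilon>"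
    using moebius_hom_point[of 1 0 "E \<epsilon>"] by (simp add: E_def hom_point_simps)
  then have 1: "moebius_mat (P ** E \<epsilon>) None = moebius_mat C x"
    using \<epsilon>(2) dP by (simp add: moebius_mult[OF E, symmetric]) (metis moebius_inv2(1))
  have "moebius_mat (E \<epsilon>) (Some 0) = Some 0" by (simp add: E_def moebius_mat_def)
  then have 0: "moebius_mat (P ** E \<epsilon>) (Some 0) = moebius_mat P (Some 0)" by (simp add: moebius_mult[OF E, symmetric])
  have j1: "joined (moebius_mat P (Some (of_real r\<^sub>1))) (moebius_mat (P ** E \<epsilon>) (Some (of_real r\<^sub>1)))"
    and j2: "joined (moebius_mat P (Some (of_real r\<^sub>2))) (moebius_mat (P ** E \<epsilon>) (Some (of_real r\<^sub>2)))"
    using d1(2) d2(2) \<epsilon>(1) by (auto simp: \<delta>_def)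
  have "\<not> joined (moebius_mat (P ** E \<epsilon>) (Some (of_real r\<^sub>1))) (moebius_mat (P ** E \<epsilon>) (Some (of_real r\<^sub>2)))"
    using P' j1 j2 joined_trans joined_sym by metis
  then have "good_arc (P ** E \<epsilon>) r\<^sub>1 r\<^sub>2"
    using P' 0 joined_notin[OF j1] joined_notin[OF j2] unfolding good_arc_def by (simp add: det_mul E)
  then show thesis using that C(1) 1 by blast
qed

text \<open>\<open>A\<close> may exchange the two components, so its square is used; in the chart
  \<open>N\<close> it multiplies by \<open>l^4\<close>, and this rotates non-trivially because
  \<open>l^2\<close> is not real.\<close>

lemma good_arc_two_components:
  assumes A: "A \<in> M" "A = N ** mat2 l 0 0 (1 / l) ** inv2 N" "det N = 1" "norm l > 1" "Im (l ^ 2) \<noteq> 0"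
    and ab: "a \<notin> \<Lambda>" "b \<notin> \<Lambda>" "\<not> joined a b" and two: "\<And>c. c \<notin> \<Lambda> \<Longrightarrow> joined a c \<or> joined b c"
  obtains P r\<^sub>1 r\<^sub>2 where "good_arc P r\<^sub>1 r\<^sub>2" "moebius_mat P None = moebius_mat N None"
proof (rule ccontr)
  assume no: "\<not> thesis"
  have l: "l \<noteq> 0" using A(4) by auto
  have ends: "moebius_mat N None \<in> \<Lambda>" "moebius_mat N (Some 0) \<in> \<Lambda>"
    using attracting[OF A(1-4)] repelling[OF A(1-4)] by auto
  note ob = that
  \<comment> \<open>Two points of one ray in different components would make that ray, onto which
    \<open>D\<close> turns the positive axis, a good arc.\<close>
  have same_ray: "joined (moebius_mat N (Some z)) (moebius_mat N (Some w))"
    if zw: "moebius_mat N (Some z) \<notin> \<Lambda>" "moebius_mat N (Some w) \<notin> \<Lambda>" "sgn z = sgn w" for z w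
  proof (rule ccontr)
    assume nj: "\<not> joined (moebius_mat N (Some z)) (moebius_mat N (Some w))"
    have nz: "z \<noteq> 0" "w \<noteq> 0" using zw ends by auto
    define v where "v = csqrt (sgn z)"
    have v: "v * v = sgn z" "v \<noteq> 0" using nz by (simp_all add: v_def sgn_zero_iff flip: power2_eq_square)
    define D where "D = mat2 v 0 0 (1 / v)"
    have D: "det D = 1" using v by (simp add: D_def det_2)
    have D_Some: "moebius_mat D (Some (of_real r)) = Some (of_real r * sgn z)" for r
      using v by (simp add: D_def moebius_mat_def Let_def flip: v(1)) (simp add: mult_ac)?
    have "x = of_real (norm x) * sgn x" for x :: complex by (cases "x = 0") (simp_all add: sgn_eq)
    then have "z = of_real (norm z) * sgn z" "w = of_real (norm w) * sgn z" using zw(3) by metis+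
    then have "good_arc (N ** D) (norm z) (norm w)"
      using zw nj nz ends A(3) D D_Some[of "norm z"] D_Some[of "norm w"] D_Some[of 0]
      by (simp add: good_arc_def det_mul moebius_mult[OF D, symmetric])
    moreover have "moebius_mat (N ** D) None = moebius_mat N None"
      by (simp add: moebius_mult[OF D, symmetric]) (simp add: D_def moebius_mat_def)
    ultimately show False using no ob by blast
  qed
  have N_surj: "\<exists>z. z \<noteq> 0 \<and> \<xi> = moebius_mat N (Some z)" if "\<xi> \<notin> \<Lambda>" for \<xi>
  proof -
    have N: "moebius_mat N (moebius_mat (inv2 N) \<xi>) = \<xi>" using A(3) by simp
    show ?thesis
    proof (cases "moebius_mat (inv2 N) \<xi>")
      case None
      then show ?thesis using that ends N by simp
    next
      case (Some z)
      then have "\<xi> = moebius_mat N (Some z)" using N by simp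
      moreover from this have "z \<noteq> 0" using that ends by auto
      ultimately show ?thesis by blast
    qed
  qed
  have inj: "joined (moebius_mat A x) (moebius_mat A y) \<longleftrightarrow> joined x y" for x y
  proof
    assume "joined (moebius_mat A x) (moebius_mat A y)"
    from joined_image[OF M_inv[OF A(1)] this] show "joined x y" using M_det[OF A(1)] by simp
  qed (rule joined_image[OF A(1)])
  \<comment> \<open>There are only two components, and \<open>A\<close> permutes them.\<close>
  have AA: "joined a (moebius_mat A (moebius_mat A a))"
  proof -
    have nA: "moebius_mat A a \<notin> \<Lambda>" "moebius_mat A b \<notin> \<Lambda>" using ab invariant_iff[OF A(1)] by auto
    consider "joined a (moebius_mat A a)" | "joined b (moebius_mat A a)" using two nA(1) by blast
    then show ?thesis
    proof cases
      case 1
      then show ?thesis using joined_trans inj by blast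
    next
      case 2
      have "\<not> joined b (moebius_mat A b)"
        using 2 inj[of a b] ab(3) joined_trans joined_sym by blast
      then have "joined a (moebius_mat A b)" using two nA(2) by blast
      then show ?thesis using 2 inj joined_trans by blast
    qed
  qed
  define V where "V = {z. joined a (moebius_mat N (Some z))}"
  have V0: "z \<noteq> 0" if "z \<in> V" for z using that joined_notin ends by (auto simp: V_def)
  have "connected V"
  proof -
    have "connectedin (subtopology S2 (- \<Lambda>)) (connected_component_of_set (subtopology S2 (- \<Lambda>)) a)"
      by (rule connectedin_connected_component_of)
    then have "connectedin S2 {\<xi>. joined a \<xi>}" by (simp add: connectedin_subtopology joined_def)
    then have c: "connectedin S2 (moebius_mat (inv2 N) ` {\<xi>. joined a \<xi>})"
      using A(3) by (intro connectedin_continuous_map_image[OF moebius_continuous]) simp_all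
    have "moebius_mat (inv2 N) ` {\<xi>. joined a \<xi>} = Some ` V"
    proof (intro equalityI subsetI)
      fix x assume "x \<in> moebius_mat (inv2 N) ` {\<xi>. joined a \<xi>}"
      then obtain \<xi> where \<xi>: "joined a \<xi>" "x = moebius_mat (inv2 N) \<xi>" by blast
      obtain z where "\<xi> = moebius_mat N (Some z)" using N_surj joined_notin[OF \<xi>(1)] by blast
      then show "x \<in> Some ` V" using \<xi> A(3) by (auto simp: V_def)
    next
      fix x assume "x \<in> Some ` V"
      then obtain z where z: "x = Some z" "joined a (moebius_mat N (Some z))" by (auto simp: V_def)
      then show "x \<in> moebius_mat (inv2 N) ` {\<xi>. joined a \<xi>}"
        using A(3) by (intro image_eqI[of _ _ "moebius_mat N (Some z)"]) simp_all
    qed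
    then have "connectedin S2 (Some ` V)" using c by simp
    then have "connectedin (subtopology S2 (range Some)) (Some ` V)" by (simp add: connectedin_subtopology image_mono)
    moreover have "homeomorphic_map euclidean (subtopology S2 (range Some)) (Some :: complex \<Rightarrow> _)"
      using embedding_map_Some[of "euclidean :: complex topology"] unfolding embedding_map_def S2_def by simp
    ultimately show ?thesis using homeomorphic_map_connectedness_eq[of euclidean "subtopology S2 (range Some)" Some V] by simp
  qed
  then have connU: "connected (sgn ` V)"
    using V0 by (intro connected_continuous_image continuous_on_sgn continuous_on_id) auto
  obtain za where za: "za \<noteq> 0" "a = moebius_mat N (Some za)" using N_surj ab(1) by blast
  obtain zb where zb: "zb \<noteq> 0" "b = moebius_mat N (Some zb)" using N_surj ab(2) by blast
  have "za \<in> V" using joined_refl[OF ab(1)] za by (simp add: V_def)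
  have zbV: "sgn zb \<notin> sgn ` V"
  proof
    assume "sgn zb \<in> sgn ` V"
    then obtain z where z: "z \<in> V" "sgn z = sgn zb" by auto
    then have j: "joined a (moebius_mat N (Some z))" by (simp add: V_def)
    then have "joined (moebius_mat N (Some z)) (moebius_mat N (Some zb))"
      using same_ray joined_notin ab(2) zb z by blast
    then show False using j ab(3) joined_trans zb by blast
  qed
  have A_act: "moebius_mat A (moebius_mat N (Some z)) = moebius_mat N (Some (l ^ 2 * z))" for z
  proof -
    have dl: "det (mat2 l 0 0 (1 / l)) = 1" using l by (simp add: det_2)
    have "moebius_mat A (moebius_mat N (Some z)) = moebius_mat N (moebius_mat (mat2 l 0 0 (1 / l)) (Some z))"
      using A(3) dl by (simp add: A(2) moebius_mult[symmetric] det_mul)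
    moreover have "moebius_mat (mat2 l 0 0 (1 / l)) (Some z) = Some (l ^ 2 * z)"
      using l by (simp add: moebius_mat_def Let_def power2_eq_square mult_ac)
    ultimately show ?thesis by simp
  qed
  have V_inv: "l ^ 4 * z \<in> V" if "z \<in> V" for z
  proof -
    have "joined a (moebius_mat N (Some z))" using that by (simp add: V_def)
    then have "joined (moebius_mat A (moebius_mat A a)) (moebius_mat A (moebius_mat A (moebius_mat N (Some z))))"
      by (simp add: inj)
    then have "joined a (moebius_mat N (Some (l ^ 2 * (l ^ 2 * z))))" using AA joined_trans by (simp add: A_act)
    moreover have "l ^ 2 * (l ^ 2 * z) = l ^ 4 * z" by (simp add: power_numeral_reduce)
    ultimately show ?thesis by (simp add: V_def)
  qed
  show False
  proof (rule connected_rotation_false[OF connU])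
    show "norm x = 1" if "x \<in> sgn ` V" for x using that V0 by (auto simp: norm_sgn)
    show "sgn za \<in> sgn ` V" using \<open>za \<in> V\<close> by blast
    show "sgn (l ^ 4) * x \<in> sgn ` V" if "x \<in> sgn ` V" for x
      using that V_inv by (auto simp: sgn_mult[symmetric])
    show "norm (sgn (l ^ 4)) = 1" using l by (simp add: norm_sgn)
    show "sgn (l ^ 4) \<noteq> 1"
    proof
      assume "sgn (l ^ 4) = 1"
      moreover have "l ^ 4 = (l ^ 2) ^ 2" by (simp add: power_numeral_reduce)
      ultimately have "sgn (l ^ 2) ^ 2 = 1" by (metis sgn_complex_power)
      then have "sgn (l ^ 2) = 1 \<or> sgn (l ^ 2) = - 1" by (simp add: power2_eq_1_iff)
      moreover have "l ^ 2 = of_real (norm (l ^ 2)) * sgn (l ^ 2)" using l by (simp add: sgn_eq)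
      ultimately have "l ^ 2 = of_real (norm (l ^ 2)) \<or> l ^ 2 = - of_real (norm (l ^ 2))" by auto
      then have "Im (l ^ 2) = 0" by (metis Im_complex_of_real uminus_complex.sel(2) neg_equal_0_iff_equal)
      then show False using A(5) by simp
    qed
    show "norm (sgn zb) = 1" using zb by (simp add: norm_sgn)
    show "sgn zb \<notin> sgn ` V" by (rule zbV)
  qed
qed

lemma good_arc_exists:
  assumes ab: "a \<notin> \<Lambda>" "b \<notin> \<Lambda>" "\<not> joined a b"
  obtains A N l P r\<^sub>1 r\<^sub>2 where "A \<in> M" "A = N ** mat2 l 0 0 (1 / l) ** inv2 N" "det N = 1" "norm l > 1"
    "good_arc P r\<^sub>1 r\<^sub>2" "moebius_mat P None = moebius_mat N None"
proof -
  obtain A N l where A: "A \<in> M" "A = N ** mat2 l 0 0 (1 / l) ** inv2 N" "det N = 1" "norm l > 1" "Im (l ^ 2) \<noteq> 0"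
    by (rule loxodromic)
  show thesis
  proof (cases "\<forall>c. c \<notin> \<Lambda> \<longrightarrow> joined a c \<or> joined b c")
    case True
    then obtain P r\<^sub>1 r\<^sub>2 where "good_arc P r\<^sub>1 r\<^sub>2" "moebius_mat P None = moebius_mat N None"
      using good_arc_two_components[OF A ab] by blast
    then show thesis using that A by blast
  next
    case False
    then obtain c where c: "c \<notin> \<Lambda>" "\<not> joined a c" "\<not> joined b c" by blast
    obtain P0 r\<^sub>1 r\<^sub>2 where P0: "good_arc P0 r\<^sub>1 r\<^sub>2" "moebius_mat P0 None \<in> \<Lambda>"
      by (rule good_arc_three_components[OF ab(1,2) c(1) ab(3) c(3,2)])
    obtain C P where C: "C \<in> M" "good_arc P r\<^sub>1 r\<^sub>2" "moebius_mat P None = moebius_mat C (moebius_mat N None)"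
      by (rule good_arc_perturb[OF P0])
    \<comment> \<open>The conjugate by \<open>C\<close> is diagonalised by \<open>C ** N\<close>, so
      its attracting point is the end point of the perturbed arc.\<close>
    have "C ** A ** inv2 C = (C ** N) ** mat2 l 0 0 (1 / l) ** inv2 (C ** N)"
      by (simp add: A(2) inv2_mult matrix_mul_assoc)
    moreover have "C ** A ** inv2 C \<in> M" using C(1) A(1) M_mult M_inv by blast
    moreover have "det (C ** N) = 1" using M_det[OF C(1)] A(3) by (simp add: det_mul)
    moreover have "moebius_mat P None = moebius_mat (C ** N) None" using C(3) moebius_mult[OF A(3)] by simp
    ultimately show thesis using that A(4) C(2) by blast
  qed
qed

end

section \<open>Assembling the conjugacy\<close>

lemma moebius_Some: "moebius_mat A (Some z) = (if A$2$1 * z + A$2$2 = 0 then None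
    else Some ((A$1$1 * z + A$1$2) / (A$2$1 * z + A$2$2)))"
  by (simp add: moebius_mat_def Let_def)

lemma zariski_generic_comp:
  assumes "zariski_generic M" "linear h" "\<And>A. det A = 1 \<Longrightarrow> \<exists>A'. det A' = 1 \<and> h A' = A"
  shows "zariski_generic (h ` M)"
  unfolding zariski_generic_def
proof (intro allI impI, elim conjE)
  fix p and A :: "complex^2^2"
  assume p: "real_polynomial_function p" "\<forall>A\<in>h ` M. p A = 0" "det A = 1"
  have "bounded_linear h" using assms(2) by (simp add: linear_conv_bounded_linear)
  then have "real_polynomial_function (p \<circ> h)"
    by (intro real_polynomial_function_compose polynomial_function_bounded_linear p(1))
  moreover have "\<forall>A\<in>M. (p \<circ> h) A = 0" using p(2) by simp
  ultimately have "(p \<circ> h) A' = 0" if "det A' = 1" for A'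
    using assms(1) that unfolding zariski_generic_def by blast
  then show "p A = 0" using assms(3)[OF p(3)] by auto
qed

lemma zariski_generic_conj:
  assumes "zariski_generic M" "det N = 1" shows "zariski_generic ((\<lambda>A. inv2 N ** A ** N) ` M)"
proof (rule zariski_generic_comp[OF assms(1)])
  show "linear (\<lambda>A. inv2 N ** A ** N)"
    by (rule linearI) (simp_all add: mat2_eq_iff mult2_nth algebra_simps scaleR_add_right)
  fix A :: "complex^2^2" assume "det A = 1"
  then have "det (N ** A ** inv2 N) = 1" using assms(2) by (simp add: det_mul)
  moreover have "inv2 N ** (N ** A ** inv2 N) ** N = A"
  proof -
    have "inv2 N ** (N ** A ** inv2 N) ** N = (inv2 N ** N) ** A ** (inv2 N ** N)" by (simp only: matrix_mul_assoc)
    then show ?thesis by (simp add: inv2_inverse assms(2))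
  qed
  ultimately show "\<exists>A'. det A' = 1 \<and> inv2 N ** A' ** N = A" by blast
qed

text \<open>A closed set in the quotient has to be a union of classes \<open>{A, - A}\<close>;
  imposing \<open>p\<close> together with its composition with \<open>A \<mapsto> - A\<close>
  achieves this, and both vanish on the classes in \<open>S\<close>.\<close>

lemma zariski_dense_generic:
  assumes "zariski_dense S" "S \<subseteq> carrier PSL2C" shows "zariski_generic (\<Union>S)"
  unfolding zariski_generic_def
proof (intro allI impI, elim conjE)
  fix p and A :: "complex^2^2"
  assume p: "real_polynomial_function p" "\<forall>A\<in>\<Union>S. p A = 0" "det A = 1"
  define Z where "Z = (\<lambda>A. {A, - A}) ` {A. det A = 1 \<and> p A = 0 \<and> p (- A) = 0}"
  have det_minus: "det (- A) = det A" for A :: "complex^2^2" by (simp add: det_2)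
  have "bounded_linear (\<lambda>A :: complex^2^2. - A)" by (intro bounded_linear_minus bounded_linear_ident)
  then have "real_polynomial_function (p \<circ> (\<lambda>A. - A))"
    by (intro real_polynomial_function_compose polynomial_function_bounded_linear p(1))
  moreover have "\<Union>Z = {A \<in> carrier SL2C. \<forall>q\<in>{p, p \<circ> (\<lambda>A. - A)}. q A = 0}"
    by (auto simp: Z_def det_minus)
  moreover have "Z \<subseteq> carrier PSL2C" by (auto simp: Z_def carrier_PSL2C)
  ultimately have "zariski_closed Z" unfolding zariski_closed_def using p(1)
    by (intro conjI exI[of _ "{p, p \<circ> (\<lambda>A. - A)}"]) auto
  moreover have "S \<subseteq> Z"
  proof
    fix \<gamma> assume "\<gamma> \<in> S"
    then obtain B where B: "\<gamma> = {B, - B}" "det B = 1" using assms(2) by (auto simp: carrier_PSL2C)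
    then have "p B = 0" "p (- B) = 0" using p(2) \<open>\<gamma> \<in> S\<close> by auto
    then show "\<gamma> \<in> Z" using B by (auto simp: Z_def)
  qed
  ultimately have "Z = carrier PSL2C" using assms(1) unfolding zariski_dense_def by blast
  then have "{A, - A} \<in> Z" using p(3) by (auto simp: carrier_PSL2C)
  then obtain B where B: "{A, - A} = {B, - B}" "p B = 0" "p (- B) = 0" by (auto simp: Z_def)
  then show "p A = 0" by (metis doubleton_eq_iff)
qed

text \<open>All lifts of \<gamma> and of its image are paired, with independent signs. So no lift of
  \<rho> to a homomorphism into SL2 has to be chosen, and products and inverses of pairs are again
  pairs.\<close>

definition matrix_pairs :: "(complex^2^2) set set \<Rightarrow> ((complex^2^2) set \<Rightarrow> (complex^2^2) set) \<Rightarrow> ((complex^2^2) \<times> (complex^2^2)) set"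
  where "matrix_pairs \<Gamma> \<rho> = {(A, B). \<exists>\<gamma>\<in>\<Gamma>. A \<in> \<gamma> \<and> B \<in> \<rho> \<gamma>}"

context
  fixes \<Gamma> \<rho> assumes sub: "subgroup \<Gamma> PSL2C" and hom: "\<rho> \<in> hom (PSL2C\<lparr>carrier := \<Gamma>\<rparr>) PSL2C"
begin

lemma rho_carrier: "\<gamma> \<in> \<Gamma> \<Longrightarrow> \<rho> \<gamma> \<in> carrier PSL2C"
  using hom by (auto simp: hom_def)

lemma rho_mult: "\<gamma> \<in> \<Gamma> \<Longrightarrow> \<delta> \<in> \<Gamma> \<Longrightarrow> \<rho> (\<gamma> \<otimes>\<^bsub>PSL2C\<^esub> \<delta>) = \<rho> \<gamma> \<otimes>\<^bsub>PSL2C\<^esub> \<rho> \<delta>"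
  using hom by (auto simp: hom_def)

lemma matrix_pairs_mult:
  assumes "(A, B) \<in> matrix_pairs \<Gamma> \<rho>" "(A', B') \<in> matrix_pairs \<Gamma> \<rho>"
  shows "(A ** A', B ** B') \<in> matrix_pairs \<Gamma> \<rho>"
proof -
  obtain \<gamma> \<delta> where *: "\<gamma> \<in> \<Gamma>" "A \<in> \<gamma>" "B \<in> \<rho> \<gamma>" "\<delta> \<in> \<Gamma>" "A' \<in> \<delta>" "B' \<in> \<rho> \<delta>"
    using assms unfolding matrix_pairs_def by blast
  have "A ** A' \<in> \<gamma> \<otimes>\<^bsub>PSL2C\<^esub> \<delta>" "B ** B' \<in> \<rho> (\<gamma> \<otimes>\<^bsub>PSL2C\<^esub> \<delta>)" "\<gamma> \<otimes>\<^bsub>PSL2C\<^esub> \<delta> \<in> \<Gamma>"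
    using * mem_mult_PSL2C subgroup.m_closed[OF sub] by (simp_all add: rho_mult)
  then show ?thesis unfolding matrix_pairs_def by blast
qed

lemma matrix_pairs_det: "(A, B) \<in> matrix_pairs \<Gamma> \<rho> \<Longrightarrow> det A = 1 \<and> det B = 1"
  unfolding matrix_pairs_def using PSL2C_elem(2) matrices_carrier[OF sub] rho_carrier by blast

lemma matrix_pairs_inv:
  assumes "(A, B) \<in> matrix_pairs \<Gamma> \<rho>" shows "(inv2 A, inv2 B) \<in> matrix_pairs \<Gamma> \<rho>"
proof -
  interpret group PSL2C by (rule group_PSL2C)
  obtain \<gamma> where \<gamma>: "\<gamma> \<in> \<Gamma>" "A \<in> \<gamma>" "B \<in> \<rho> \<gamma>" using assms by (auto simp: matrix_pairs_def)
  have gc: "\<gamma> \<in> carrier PSL2C" using matrices_carrier[OF sub \<gamma>(1)] .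
  have ginv: "inv\<^bsub>PSL2C\<^esub> \<gamma> \<in> \<Gamma>" by (rule subgroup.m_inv_closed[OF sub \<gamma>(1)])
  have "\<rho> \<gamma> \<otimes>\<^bsub>PSL2C\<^esub> \<rho> (inv\<^bsub>PSL2C\<^esub> \<gamma>) = \<rho> \<one>\<^bsub>PSL2C\<^esub>" using rho_mult[OF \<gamma>(1) ginv] gc by simp
  moreover have one: "\<rho> \<one>\<^bsub>PSL2C\<^esub> = \<one>\<^bsub>PSL2C\<^esub>"
  proof -
    have "\<one>\<^bsub>PSL2C\<^esub> \<in> \<Gamma>" by (rule subgroup.one_closed[OF sub])
    then have "\<rho> \<one>\<^bsub>PSL2C\<^esub> \<otimes>\<^bsub>PSL2C\<^esub> \<rho> \<one>\<^bsub>PSL2C\<^esub> = \<rho> \<one>\<^bsub>PSL2C\<^esub>" "\<rho> \<one>\<^bsub>PSL2C\<^esub> \<in> carrier PSL2C"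
      using rho_mult[of "\<one>\<^bsub>PSL2C\<^esub>" "\<one>\<^bsub>PSL2C\<^esub>"] rho_carrier by simp_all
    then show ?thesis by (simp add: l_cancel_one)
  qed
  ultimately have "inv\<^bsub>PSL2C\<^esub> (\<rho> \<gamma>) = \<rho> (inv\<^bsub>PSL2C\<^esub> \<gamma>)"
    using rho_carrier[OF \<gamma>(1)] rho_carrier[OF ginv] by (metis inv_equality inv_inv inv_closed)
  then have "inv2 B \<in> \<rho> (inv\<^bsub>PSL2C\<^esub> \<gamma>)" using inv_PSL2C[OF rho_carrier[OF \<gamma>(1)] \<gamma>(3)] by simp
  moreover have "inv2 A \<in> inv\<^bsub>PSL2C\<^esub> \<gamma>" by (rule inv_PSL2C[OF gc \<gamma>(2)])
  ultimately show ?thesis using ginv by (auto simp: matrix_pairs_def)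
qed

lemma matrix_pairs_fst: "fst ` matrix_pairs \<Gamma> \<rho> = \<Union>\<Gamma>"
proof -
  have "\<exists>B. B \<in> \<rho> \<gamma>" if "\<gamma> \<in> \<Gamma>" for \<gamma> using rho_carrier[OF that] by (auto simp: carrier_PSL2C)
  then show ?thesis by (force simp: matrix_pairs_def)
qed

lemma matrix_pairs_snd: "snd ` matrix_pairs \<Gamma> \<rho> = \<Union>(\<rho> ` \<Gamma>)"
proof -
  have "\<exists>A. A \<in> \<gamma>" if "\<gamma> \<in> \<Gamma>" for \<gamma> using matrices_carrier[OF sub that] by (auto simp: carrier_PSL2C)
  then show ?thesis by (force simp: matrix_pairs_def)
qed

end

lemma conj_moebius:
  "map_option cnj (moebius_mat A \<xi>) = moebius_mat (mat2 (cnj (A$1$1)) (cnj (A$1$2)) (cnj (A$2$1)) (cnj (A$2$2))) (map_option cnj \<xi>)"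
proof -
  have "cnj a * cnj z + cnj b = 0 \<longleftrightarrow> a * z + b = 0" for a b z
    by (metis complex_cnj_add complex_cnj_mult complex_cnj_zero_iff)
  then show ?thesis by (cases \<xi>) (simp_all add: moebius_mat_def Let_def)
qed

lemma det_conj: "det (mat2 (cnj (A$1$1)) (cnj (A$1$2)) (cnj (A$2$1)) (cnj (A$2$2))) = cnj (det A)"
  for A :: "complex^2^2"
  by (simp add: det_2)

text \<open>Both sides of the equation are Moebius matrices applied to
  \<open>\<kappa> \<xi>\<close>: the conjugation, if present, moves past a matrix by conjugating its
  entries. Two such maps that agree at three points are equal.\<close>

lemma Moeb_S2_conjugates:
  assumes det: "det N = 1" "det N' = 1" and \<mu>: "\<mu> \<noteq> 0"
    and \<tau>: "\<tau> = (\<lambda>z. \<mu> * z) \<or> \<tau> = (\<lambda>z. \<mu> * cnj z)"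
  defines "g \<equiv> moebius_mat N' \<circ> map_option \<tau> \<circ> moebius_mat (inv2 N)"
  shows "g \<in> Moeb_S2"
    and "\<lbrakk>det A = 1; det B = 1; distinct [x, y, z]; \<And>\<xi>. \<xi> \<in> {x, y, z} \<Longrightarrow> g (moebius_mat A \<xi>) = moebius_mat B (g \<xi>)\<rbrakk>
      \<Longrightarrow> g (moebius_mat A \<xi>) = moebius_mat B (g \<xi>)"
proof -
  define \<kappa> :: "complex option \<Rightarrow> complex option" where "\<kappa> = (if \<tau> = (\<lambda>z. \<mu> * z) then (\<lambda>x. x) else map_option cnj)"
  define D where "D = mat2 (csqrt \<mu>) 0 0 (1 / csqrt \<mu>)"
  have D: "det D = 1" using \<mu> by (simp add: D_def det_2)
  have "csqrt \<mu> * csqrt \<mu> = \<mu>" by (simp flip: power2_eq_square)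
  then have D_Some: "moebius_mat D (Some z) = Some (\<mu> * z)" "moebius_mat D None = None" for z
    using \<mu> by (simp_all add: D_def moebius_mat_def Let_def mult.left_commute[of z] mult.commute[of _ z])
  have g1: "map_option \<tau> x = moebius_mat D (\<kappa> x)" for x
    using \<tau> by (cases x) (auto simp: \<kappa>_def D_Some)
  have "map_option \<tau> = moebius_mat D \<circ> \<kappa>" using g1 by auto
  moreover have "\<kappa> \<in> Moeb_S2" unfolding \<kappa>_def using id_Moeb_S2 conj_Moeb_S2 by simp
  ultimately have "map_option \<tau> \<in> Moeb_S2" using Moeb_S2_comp moebius_Moeb_S2[OF D] by simp
  then show "g \<in> Moeb_S2" unfolding g_def using det by (intro Moeb_S2_comp moebius_Moeb_S2) simp_all
  define c where "c A = (if \<tau> = (\<lambda>z. \<mu> * z) then A else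
    mat2 (cnj (A$1$1)) (cnj (A$1$2)) (cnj (A$2$1)) (cnj (A$2$2)))" for A :: "complex^2^2"
  have kc: "\<kappa> (moebius_mat A x) = moebius_mat (c A) (\<kappa> x)" for A x
    by (simp add: \<kappa>_def c_def conj_moebius)
  have dc: "det (c A) = 1" if "det A = 1" for A using that by (simp add: c_def det_conj)
  define X where "X = N' ** (D ** c (inv2 N))"
  have dX: "det X = 1" using det D dc[of "inv2 N"] by (simp add: X_def det_mul)
  have gX: "g x = moebius_mat X (\<kappa> x)" for x
    using D dc[of "inv2 N"] det by (simp add: g_def g1 kc X_def moebius_mult det_mul)
  have inj_k: "\<kappa> x = \<kappa> y \<longleftrightarrow> x = y" for x y
    unfolding \<kappa>_def by (auto simp: inj_eq[OF option.inj_map] inj_on_def)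
  assume AB: "det A = 1" "det B = 1" "distinct [x, y, z]"
    "\<And>\<xi>. \<xi> \<in> {x, y, z} \<Longrightarrow> g (moebius_mat A \<xi>) = moebius_mat B (g \<xi>)"
  have l: "g (moebius_mat A \<xi>) = moebius_mat (X ** c A) (\<kappa> \<xi>)" for \<xi>
    using dc[OF AB(1)] by (simp add: gX kc moebius_mult)
  have r: "moebius_mat B (g \<xi>) = moebius_mat (B ** X) (\<kappa> \<xi>)" for \<xi>
    using dX by (simp add: gX moebius_mult)
  have "moebius_mat (X ** c A) (\<kappa> \<xi>) = moebius_mat (B ** X) (\<kappa> \<xi>)" for \<xi>
    by (rule moebius_agree[of _ _ "\<kappa> x" "\<kappa> y" "\<kappa> z"])
      (use AB dX dc[OF AB(1)] in \<open>auto simp: det_mul inj_k l[symmetric] r[symmetric]\<close>)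
  then show "g (moebius_mat A \<xi>) = moebius_mat B (g \<xi>)" by (simp add: l r)
qed

theorem theorem1p3:
  fixes \<Gamma> :: "(complex^2^2) set set"
    and p :: "complex \<times> real"
    and \<Lambda> \<Omega> :: "complex option set"
    and \<rho> :: "(complex^2^2) set \<Rightarrow> (complex^2^2) set"
    and f :: "complex option \<Rightarrow> complex option"
  assumes "kleinian_group \<Gamma>"
    and "finitely_generated PSL2C \<Gamma>"
    and "zariski_dense \<Gamma>"
    and "p \<in> H3" and "\<Lambda> = limit_set \<Gamma> p"
    and "\<Omega> = topspace S2 - \<Lambda>"
    and "\<exists>C\<^sub>1 \<in> connected_components_of (subtopology S2 \<Omega>).
         \<exists>C\<^sub>2 \<in> connected_components_of (subtopology S2 \<Omega>). C\<^sub>1 \<noteq> C\<^sub>2"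
    and "\<rho> \<in> hom (PSL2C\<lparr>carrier := \<Gamma>\<rparr>) PSL2C"
    and "inj_on \<rho> \<Gamma>"
    and "discrete_in_PSL2C (\<rho> ` \<Gamma>)"
    and "zariski_dense (\<rho> ` \<Gamma>)"
    and "boundary_map \<Gamma> \<Lambda> \<rho> f"
    and "\<And>x\<^sub>1 x\<^sub>2 x\<^sub>3 x\<^sub>4. \<lbrakk>{x\<^sub>1, x\<^sub>2, x\<^sub>3, x\<^sub>4} \<subseteq> \<Lambda>; distinct [x\<^sub>1, x\<^sub>2, x\<^sub>3, x\<^sub>4];
           concyclic {x\<^sub>1, x\<^sub>2, x\<^sub>3, x\<^sub>4}\<rbrakk>
         \<Longrightarrow> concyclic {f x\<^sub>1, f x\<^sub>2, f x\<^sub>3, f x\<^sub>4}"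
  shows "\<exists>g \<in> Moeb_S2. (\<forall>\<xi>\<in>\<Lambda>. f \<xi> = g \<xi>) \<and>
           (\<forall>\<gamma>\<in>\<Gamma>. moebius_action (\<rho> \<gamma>) = g \<circ> moebius_action \<gamma> \<circ> inv_into UNIV g)"
proof -
  have sub: "subgroup \<Gamma> PSL2C" using assms(1) by (simp add: kleinian_group_def)
  note hom = assms(8)
  note limit_iff = limit_set_iff_limit_point[OF sub assms(4), folded assms(5)]
  interpret lc: limit_set_components "matrices \<Gamma>" \<Lambda>
  proof
    show "zariski_generic (matrices \<Gamma>)"
      unfolding matrices_def using zariski_dense_generic[OF assms(3)] matrices_carrier[OF sub] by blast
    show "closedin S2 \<Lambda>" unfolding assms(5) by (rule limit_set_closed[OF sub assms(4)])
    show "moebius_mat A \<xi> \<in> \<Lambda>" if "A \<in> matrices \<Gamma>" "\<xi> \<in> \<Lambda>" for A \<xi>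
      using limit_point_invariant[OF sub _ that(1)] that(2) unfolding limit_iff by blast
    show "\<exists>C\<in>matrices \<Gamma>. moebius_mat C x \<in> U"
      if "\<xi> \<in> \<Lambda>" "k \<in> matrices \<Gamma>" "moebius_mat k x \<noteq> x" "openin S2 U" "\<xi> \<in> U" for \<xi> k x U
      using limit_point_minimal[OF sub _ that(2-5)] that(1) unfolding limit_iff by blast
    show "moebius_mat N None \<in> \<Lambda>"
      if "A \<in> matrices \<Gamma>" "A = N ** mat2 l 0 0 (1 / l) ** inv2 N" "det N = 1" "norm l > 1" for A N l
      using attracting_point[OF sub that] unfolding limit_iff .
    show "moebius_mat N (Some 0) \<in> \<Lambda>"
      if "A \<in> matrices \<Gamma>" "A = N ** mat2 l 0 0 (1 / l) ** inv2 N" "det N = 1" "norm l > 1" for A N l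
      using repelling_point[OF sub that] unfolding limit_iff .
  qed (use matrices_det[OF sub] matrices_mult[OF sub] matrices_inv[OF sub] in blast)+
  have emb: "homeomorphic_map (subtopology S2 \<Lambda>) (subtopology S2 (f ` topspace (subtopology S2 \<Lambda>))) f"
    using assms(12) unfolding boundary_map_def embedding_map_def by blast
  have f_cont: "continuous_map (subtopology S2 \<Lambda>) S2 f"
    using homeomorphic_imp_continuous_map[OF emb] unfolding continuous_map_in_subtopology by blast
  have f_inj: "inj_on f \<Lambda>" using homeomorphic_imp_injective_map[OF emb] by simp
  have f_eq: "f \<xi> = f \<eta> \<longleftrightarrow> \<xi> = \<eta>" if "\<xi> \<in> \<Lambda>" "\<eta> \<in> \<Lambda>" for \<xi> \<eta>
    using f_inj that by (auto dest: inj_onD)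
  have equivariant: "f (moebius_mat A \<xi>) = moebius_mat B (f \<xi>)" if AB: "(A, B) \<in> matrix_pairs \<Gamma> \<rho>" and \<xi>: "\<xi> \<in> \<Lambda>" for A B \<xi>
  proof -
    obtain \<gamma> where \<gamma>: "\<gamma> \<in> \<Gamma>" "A \<in> \<gamma>" "B \<in> \<rho> \<gamma>" using AB by (auto simp: matrix_pairs_def)
    have "f (moebius_action \<gamma> \<xi>) = moebius_action (\<rho> \<gamma>) (f \<xi>)"
      using assms(12) \<gamma>(1) \<xi> unfolding boundary_map_def by blast
    then show ?thesis
      using moebius_eq[OF matrices_carrier[OF sub \<gamma>(1)] \<gamma>(2)] moebius_eq[OF rho_carrier[OF sub hom \<gamma>(1)] \<gamma>(3)] by simp
  qed
  obtain a b where ab: "a \<notin> \<Lambda>" "b \<notin> \<Lambda>" "\<not> lc.joined a b"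
  proof -
    have Om: "\<Omega> = - \<Lambda>" using assms(6) by auto
    obtain a b where 1: "a \<in> topspace (subtopology S2 \<Omega>)" "b \<in> topspace (subtopology S2 \<Omega>)"
      "connected_component_of_set (subtopology S2 \<Omega>) a \<noteq> connected_component_of_set (subtopology S2 \<Omega>) b"
      using assms(7) unfolding connected_components_of_def by blast
    have "\<not> connected_component_of (subtopology S2 \<Omega>) a b"
      using 1(3) connected_component_of_trans connected_component_of_sym by (metis (no_types, lifting) Collect_cong)
    then show thesis using that 1 by (simp add: lc.joined_def Om)
  qed
  obtain A0 N l P r\<^sub>1 r\<^sub>2 where A0: "A0 \<in> matrices \<Gamma>" "A0 = N ** mat2 l 0 0 (1 / l) ** inv2 N" "det N = 1" "norm l > 1"
    and arc: "lc.good_arc P r\<^sub>1 r\<^sub>2" "moebius_mat P None = moebius_mat N None" and r12: "r\<^sub>1 < r\<^sub>2"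
  proof -
    obtain A0 N l P r\<^sub>1 r\<^sub>2 where 1: "A0 \<in> matrices \<Gamma>" "A0 = N ** mat2 l 0 0 (1 / l) ** inv2 N" "det N = 1" "norm l > 1"
      "lc.good_arc P r\<^sub>1 r\<^sub>2" "moebius_mat P None = moebius_mat N None"
      by (rule lc.good_arc_exists[OF ab])
    \<comment> \<open>The arc condition is symmetric in the two radii, so they can be put in
      order.\<close>
    have "lc.good_arc P r\<^sub>2 r\<^sub>1" "r\<^sub>1 \<noteq> r\<^sub>2"
      using 1(5) lc.joined_sym lc.joined_refl unfolding lc.good_arc_def by blast+
    then show thesis using that 1 by (metis linorder_neqE_linordered_idom)
  qed
  note N = A0(3)
  have ends: "moebius_mat N None \<in> \<Lambda>" "moebius_mat N (Some 0) \<in> \<Lambda>"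
    using lc.attracting[OF A0] lc.repelling[OF A0] by auto
  have "moebius_mat N (Some 0) \<noteq> moebius_mat N None" using moebius_eq_iff[OF N] by simp
  then have "f (moebius_mat N (Some 0)) \<noteq> f (moebius_mat N None)" using f_eq ends by blast
  then obtain N' where N': "det N' = 1" "moebius_mat N' (Some 0) = f (moebius_mat N (Some 0))"
    "moebius_mat N' None = f (moebius_mat N None)" by (rule two_points)
  define L where "L = {z. moebius_mat N (Some z) \<in> \<Lambda>}"
  define f' where "f' \<xi> = moebius_mat (inv2 N') (f (moebius_mat N \<xi>))" for \<xi>
  \<comment> \<open>\<open>f'\<close> fixes infinity and is injective on the limit set in the chart,
    so on \<open>L\<close> its value is never \<open>None\<close>.\<close>
  define F where "F z = the (f' (Some z))" for z
  have f'_None: "f' None = None" and f'_0: "f' (Some 0) = Some 0"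
    using N' by (simp_all add: f'_def flip: N'(2,3))
  have f'_eq: "f' \<xi> = f' \<eta> \<longleftrightarrow> \<xi> = \<eta>" if "moebius_mat N \<xi> \<in> \<Lambda>" "moebius_mat N \<eta> \<in> \<Lambda>" for \<xi> \<eta>
    using f_eq that N N'(1) by (simp add: f'_def moebius_eq_iff)
  have f'_Some: "f' (Some z) = Some (F z)" if "z \<in> L" for z
    using f'_eq[of "Some z" None] that ends f'_None by (cases "f' (Some z)") (auto simp: F_def L_def)
  define G where "G = (\<lambda>(A, B). (inv2 N ** A ** N, inv2 N' ** B ** N')) ` matrix_pairs \<Gamma> \<rho>"
  have conj_mult: "(inv2 X ** A ** X) ** (inv2 X ** B ** X) = inv2 X ** (A ** B) ** X" if "det X = 1" for A B X :: "complex^2^2"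
  proof -
    have "(inv2 X ** A ** X) ** (inv2 X ** B ** X) = inv2 X ** A ** (X ** inv2 X) ** B ** X" by (simp only: matrix_mul_assoc)
    then show ?thesis by (simp add: inv2_inverse that matrix_mul_assoc)
  qed
  have conj_inv: "inv2 (inv2 X ** A ** X) = inv2 X ** inv2 A ** X" for A X :: "complex^2^2"
    by (simp add: inv2_mult matrix_mul_assoc)
  have conj_det: "det (inv2 X ** A ** X) = det A" if "det X = 1" for A X :: "complex^2^2"
    using that by (simp add: det_mul)
  have conj_act: "moebius_mat (inv2 X ** A ** X) \<xi> = moebius_mat (inv2 X) (moebius_mat A (moebius_mat X \<xi>))"
    if "det X = 1" "det A = 1" for A X \<xi>
    using that by (simp add: moebius_mult det_mul matrix_mul_assoc)
  have G_act: "moebius_mat N (moebius_mat A \<xi>) \<in> \<Lambda> \<and> f' (moebius_mat A \<xi>) = moebius_mat B (f' \<xi>)"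
    if AB: "(A, B) \<in> G" and \<xi>: "moebius_mat N \<xi> \<in> \<Lambda>" for A B \<xi>
  proof -
    obtain A1 B1 where 1: "(A1, B1) \<in> matrix_pairs \<Gamma> \<rho>" "A = inv2 N ** A1 ** N" "B = inv2 N' ** B1 ** N'"
      using AB by (auto simp: G_def)
    have d: "det A1 = 1" "det B1 = 1" using matrix_pairs_det[OF sub hom 1(1)] by auto
    have "A1 \<in> matrices \<Gamma>" using 1(1) by (auto simp: matrix_pairs_def matrices_def)
    then have "moebius_mat A1 (moebius_mat N \<xi>) \<in> \<Lambda>" by (rule lc.invariant[OF _ \<xi>])
    then show ?thesis
      using equivariant[OF 1(1) \<xi>] N N'(1) d by (simp add: 1(2,3) conj_act f'_def)
  qed
  \<comment> \<open>\<open>P\<close> and \<open>N\<close> agree at infinity, so \<open>Q\<close>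
    fixes infinity and is affine: in the chart \<open>N\<close> the arc is a Euclidean ray from
    \<alpha>.\<close>
  define Q where "Q = inv2 N ** P"
  have dP: "det P = 1" using arc(1) by (simp add: lc.good_arc_def)
  have Q: "det Q = 1" using N dP by (simp add: Q_def det_mul)
  have NQ: "moebius_mat N (moebius_mat Q \<xi>) = moebius_mat P \<xi>" for \<xi>
    using N dP by (simp add: Q_def moebius_mult[symmetric])
  have "moebius_mat N (moebius_mat Q None) = moebius_mat N None" using NQ arc(2) by simp
  then have "moebius_mat Q None = None" using moebius_eq_iff[OF N] by blast
  then have Q21: "Q$2$1 = 0" by (simp add: moebius_mat_def Let_def split: if_splits)
  then have Qd: "Q$1$1 * Q$2$2 = 1" using Q by (simp add: det_2)
  define \<alpha> e where "\<alpha> = Q$1$2 / Q$2$2" and "e = Q$1$1 / Q$2$2"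
  have e: "e \<noteq> 0" using Qd by (auto simp: e_def)
  have P_Some: "moebius_mat P (Some z) = moebius_mat N (Some (\<alpha> + z * e))" for z
  proof -
    have "Q$2$2 \<noteq> 0" using Qd by auto
    then have "moebius_mat Q (Some z) = Some (\<alpha> + z * e)"
      using Q21 by (simp add: moebius_Some \<alpha>_def e_def field_simps)
    then show ?thesis using NQ[of "Some z"] by simp
  qed
  \<comment> \<open>Rescaling the radii by \<open>norm e\<close> makes the direction a unit
    vector.\<close>
  define e\<^sub>0 s\<^sub>1 s\<^sub>2 where "e\<^sub>0 = sgn e" and "s\<^sub>1 = r\<^sub>1 * norm e" and "s\<^sub>2 = r\<^sub>2 * norm e"
  have e0: "norm e\<^sub>0 = 1" "of_real (norm e) * e\<^sub>0 = e" using e by (simp_all add: e\<^sub>0_def norm_sgn) (simp add: sgn_eq)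
  have s: "0 < s\<^sub>1" "s\<^sub>1 \<le> s\<^sub>2" using arc(1) r12 e by (simp_all add: s\<^sub>1_def s\<^sub>2_def lc.good_arc_def)
  define c\<^sub>1 c\<^sub>2 where "c\<^sub>1 = \<alpha> + of_real s\<^sub>1 * e\<^sub>0" and "c\<^sub>2 = \<alpha> + of_real s\<^sub>2 * e\<^sub>0"
  have c: "c\<^sub>1 = \<alpha> + of_real r\<^sub>1 * e" "c\<^sub>2 = \<alpha> + of_real r\<^sub>2 * e"
    using e0(2) by (simp_all add: c\<^sub>1_def c\<^sub>2_def s\<^sub>1_def s\<^sub>2_def mult.assoc)
  have c_arc: "moebius_mat N (Some c\<^sub>1) \<notin> \<Lambda>" "moebius_mat N (Some c\<^sub>2) \<notin> \<Lambda>"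
    "\<not> lc.joined (moebius_mat N (Some c\<^sub>1)) (moebius_mat N (Some c\<^sub>2))"
    using arc(1) by (simp_all add: lc.good_arc_def P_Some c)
  have openC: "open (- L)"
  proof -
    have "- L = {z. moebius_mat N (Some z) \<notin> \<Lambda>}" by (auto simp: L_def)
    then show ?thesis using lc.chart_open[OF N] by simp
  qed
  obtain \<epsilon> where \<epsilon>: "\<epsilon> > 0" "ball c\<^sub>1 \<epsilon> \<subseteq> - L" "ball c\<^sub>2 \<epsilon> \<subseteq> - L"
  proof -
    obtain \<epsilon>1 where 1: "\<epsilon>1 > 0" "ball c\<^sub>1 \<epsilon>1 \<subseteq> - L" using openC c_arc(1) open_contains_ball by (metis (mono_tags) ComplI L_def mem_Collect_eq)
    obtain \<epsilon>2 where 2: "\<epsilon>2 > 0" "ball c\<^sub>2 \<epsilon>2 \<subseteq> - L" using openC c_arc(2) open_contains_ball by (metis (mono_tags) ComplI L_def mem_Collect_eq)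
    show thesis by (rule that[of "min \<epsilon>1 \<epsilon>2"]) (use 1 2 in auto)
  qed
  have G_I: "(inv2 N ** A ** N, inv2 N' ** B ** N') \<in> G" if "(A, B) \<in> matrix_pairs \<Gamma> \<rho>" for A B
    unfolding G_def by (rule image_eqI[OF _ that]) simp
  have G_mult: "(A ** A', B ** B') \<in> G" if in_G: "(A, B) \<in> G" "(A', B') \<in> G" for A B A' B'
  proof -
    obtain A1 B1 where 1: "(A1, B1) \<in> matrix_pairs \<Gamma> \<rho>" "A = inv2 N ** A1 ** N" "B = inv2 N' ** B1 ** N'"
      using in_G(1) by (auto simp: G_def)
    obtain A2 B2 where 2: "(A2, B2) \<in> matrix_pairs \<Gamma> \<rho>" "A' = inv2 N ** A2 ** N" "B' = inv2 N' ** B2 ** N'"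
      using in_G(2) by (auto simp: G_def)
    show ?thesis unfolding 1(2,3) 2(2,3) conj_mult[OF N] conj_mult[OF N'(1)]
      by (rule G_I[OF matrix_pairs_mult[OF sub hom 1(1) 2(1)]])
  qed
  have G_inv: "(inv2 A, inv2 B) \<in> G" if in_G: "(A, B) \<in> G" for A B
  proof -
    obtain A1 B1 where 1: "(A1, B1) \<in> matrix_pairs \<Gamma> \<rho>" "A = inv2 N ** A1 ** N" "B = inv2 N' ** B1 ** N'"
      using in_G by (auto simp: G_def)
    show ?thesis unfolding 1(2,3) conj_inv by (rule G_I[OF matrix_pairs_inv[OF sub hom 1(1)]])
  qed
  have G_det1: "det A = 1" and G_det2: "det B = 1" if "(A, B) \<in> G" for A B
    using that matrix_pairs_det[OF sub hom] N N'(1) by (auto simp: G_def conj_det)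
  have fst_G: "fst ` G = (\<lambda>A. inv2 N ** A ** N) ` (\<Union>\<Gamma>)"
    unfolding matrix_pairs_fst[OF sub hom, symmetric] by (force simp: G_def)
  have snd_G: "snd ` G = (\<lambda>A. inv2 N' ** A ** N') ` (\<Union>(\<rho> ` \<Gamma>))"
    unfolding matrix_pairs_snd[OF sub hom, symmetric] by (force simp: G_def)
  have gen1: "zariski_generic (fst ` G)"
    unfolding fst_G using lc.M_generic N by (intro zariski_generic_conj) (simp_all add: matrices_def)
  have gen2: "zariski_generic (snd ` G)"
    unfolding snd_G using rho_carrier[OF sub hom]
    by (intro zariski_generic_conj zariski_dense_generic assms(11) N') auto
  have dense1: "q A = 0" if "real_polynomial_function q" "\<And>A B. (A, B) \<in> G \<Longrightarrow> q A = 0" "det A = 1" for q and A :: "complex^2^2"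
  proof -
    have "\<forall>A\<in>fst ` G. q A = 0" using that(2) by auto
    then show ?thesis using gen1 that(1,3) unfolding zariski_generic_def by blast
  qed
  have dense2: "q A = 0" if "real_polynomial_function q" "\<And>A B. (A, B) \<in> G \<Longrightarrow> q B = 0" "det A = 1" for q and A :: "complex^2^2"
  proof -
    have "\<forall>A\<in>snd ` G. q A = 0" using that(2) by auto
    then show ?thesis using gen2 that(1,3) unfolding zariski_generic_def by blast
  qed
  have closedL: "closed L" using openC by (simp add: closed_def)
  have contS: "continuous_map (subtopology S2 \<Lambda>) S2 (moebius_mat (inv2 N') \<circ> f)"
    using N'(1) by (intro continuous_map_compose[OF f_cont moebius_continuous]) simp
  have contL: "continuous_on L F"
  proof -
    have "continuous_map (top_of_set L) (subtopology S2 \<Lambda>) (moebius_mat N \<circ> Some)"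
      unfolding continuous_map_in_subtopology
      using continuous_map_from_subtopology[OF continuous_map_compose[OF continuous_map_S2_Some moebius_continuous[OF N]]]
      by (auto simp: L_def)
    then have cm: "continuous_map (top_of_set L) S2 ((moebius_mat (inv2 N') \<circ> f) \<circ> (moebius_mat N \<circ> Some))"
      by (rule continuous_map_compose[OF _ contS])
    have "openin (top_of_set L) (L \<inter> F -` V)" if "open V" for V
    proof -
      have "openin S2 (Some ` V)" using that by (simp add: openin_S2 image_iff)
      then have "openin (top_of_set L) {z \<in> topspace (top_of_set L). ((moebius_mat (inv2 N') \<circ> f) \<circ> (moebius_mat N \<circ> Some)) z \<in> Some ` V}"
        by (rule openin_continuous_map_preimage[OF cm])
      moreover have "{z \<in> topspace (top_of_set L). ((moebius_mat (inv2 N') \<circ> f) \<circ> (moebius_mat N \<circ> Some)) z \<in> Some ` V} = L \<inter> F -` V"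
        using f'_Some by (auto simp: f'_def image_iff)
      ultimately show ?thesis by simp
    qed
    then show ?thesis by (simp add: continuous_on_open_gen[of F L UNIV])
  qed
  have injF: "inj_on F L"
  proof (rule inj_onI)
    fix x y assume "x \<in> L" "y \<in> L" "F x = F y"
    then have "f' (Some x) = f' (Some y)" by (simp add: f'_Some)
    then show "x = y" using f'_eq[of "Some x" "Some y"] \<open>x \<in> L\<close> \<open>y \<in> L\<close> by (simp add: L_def)
  qed
  have L0: "0 \<in> L" "F 0 = 0" using ends f'_0 by (simp_all add: L_def F_def)
  \<comment> \<open>This is continuity of \<open>f\<close> at the point that the chart
    \<open>N\<close> puts at infinity.\<close>
  have infinity: "\<exists>R'. \<forall>z\<in>L. norm z > R' \<longrightarrow> norm (F z) > R" for R
  proof -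
    define V where "V = insert None (Some ` {z :: complex. norm z > R})"
    have "openin S2 V" unfolding openin_S2
    proof
      have "{z. Some z \<in> V} = {z. norm z > R}" by (auto simp: V_def)
      then show "open {z. Some z \<in> V}" by (simp add: open_Collect_less continuous_intros)
    qed (auto simp: V_def)
    from openin_continuous_map_preimage[OF contS this]
    obtain W where W: "openin S2 W" "{\<xi> \<in> topspace (subtopology S2 \<Lambda>). (moebius_mat (inv2 N') \<circ> f) \<xi> \<in> V} = W \<inter> \<Lambda>"
      unfolding openin_subtopology by auto
    have "openin S2 {\<xi> \<in> topspace S2. moebius_mat N \<xi> \<in> W}"
      by (rule openin_continuous_map_preimage[OF moebius_continuous[OF N] W(1)])
    moreover have "None \<in> {\<xi> \<in> topspace S2. moebius_mat N \<xi> \<in> W}"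
    proof -
      have "moebius_mat N None \<in> {\<xi> \<in> topspace (subtopology S2 \<Lambda>). (moebius_mat (inv2 N') \<circ> f) \<xi> \<in> V}"
        using ends(1) f'_None by (simp add: f'_def V_def)
      then show ?thesis unfolding W(2) by simp
    qed
    ultimately obtain R' where R': "\<And>z. norm z > R' \<Longrightarrow> moebius_mat N (Some z) \<in> W"
      unfolding openin_S2 by auto
    have "norm (F z) > R" if "z \<in> L" "norm z > R'" for z
    proof -
      have "moebius_mat N (Some z) \<in> W \<inter> \<Lambda>" using R'[OF that(2)] that(1) by (simp add: L_def)
      then have "f' (Some z) \<in> V" unfolding W(2)[symmetric] by (simp add: f'_def)
      then show ?thesis using f'_Some[OF that(1)] by (auto simp: V_def)
    qed
    then show ?thesis by blast
  qed
  have act: "(A$1$1 * z + A$1$2) / (A$2$1 * z + A$2$2) \<in> L \<and> B$2$1 * F z + B$2$2 \<noteq> 0 \<and>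
      F ((A$1$1 * z + A$1$2) / (A$2$1 * z + A$2$2)) = (B$1$1 * F z + B$1$2) / (B$2$1 * F z + B$2$2)"
    if "(A, B) \<in> G" "z \<in> L" "A$2$1 * z + A$2$2 \<noteq> 0" for A B z
  proof -
    define w where "w = (A$1$1 * z + A$1$2) / (A$2$1 * z + A$2$2)"
    have Aw: "moebius_mat A (Some z) = Some w" using that(3) by (simp add: moebius_Some w_def)
    have "moebius_mat N (Some w) \<in> \<Lambda>" "f' (Some w) = moebius_mat B (f' (Some z))"
      using G_act[OF that(1), of "Some z"] that(2) Aw by (simp_all add: L_def)
    moreover from this(1) have "w \<in> L" by (simp add: L_def)
    ultimately have "Some (F w) = moebius_mat B (Some (F z))" using f'_Some that(2) by simp
    then show ?thesis using \<open>w \<in> L\<close> unfolding w_def[symmetric] by (simp add: moebius_Some split: if_splits)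
  qed
  have act_pole: "B$2$1 * F z + B$2$2 = 0" if "(A, B) \<in> G" "z \<in> L" "A$2$1 * z + A$2$2 = 0" for A B z
  proof -
    have "f' None = moebius_mat B (f' (Some z))"
      using G_act[OF that(1), of "Some z"] that(2,3) by (simp add: moebius_Some L_def)
    then have "moebius_mat B (Some (F z)) = None" using f'_None f'_Some[OF that(2)] by simp
    then show ?thesis by (simp add: moebius_Some split: if_splits)
  qed
  \<comment> \<open>The conjugated image of \<open>A0\<close> fixes 0 and infinity by equivariance,
    so it is diagonal.\<close>
  obtain l' where diag: "(mat2 l 0 0 (1 / l), mat2 l' 0 0 (1 / l')) \<in> G"
  proof -
    obtain \<gamma> where \<gamma>: "\<gamma> \<in> \<Gamma>" "A0 \<in> \<gamma>" using A0(1) by (auto simp: matrices_def)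
    obtain B0 where B0: "B0 \<in> \<rho> \<gamma>" using rho_carrier[OF sub hom \<gamma>(1)] by (auto simp: carrier_PSL2C)
    define B where "B = inv2 N' ** B0 ** N'"
    have "inv2 N ** A0 ** N = (inv2 N ** N) ** mat2 l 0 0 (1 / l) ** (inv2 N ** N)"
      unfolding A0(2) by (simp only: matrix_mul_assoc)
    then have "inv2 N ** A0 ** N = mat2 l 0 0 (1 / l)" by (simp add: inv2_inverse N)
    moreover have "(A0, B0) \<in> matrix_pairs \<Gamma> \<rho>" using \<gamma> B0 by (auto simp: matrix_pairs_def)
    ultimately have BG: "(mat2 l 0 0 (1 / l), B) \<in> G" using G_I B_def by metis
    have "l \<noteq> 0" using A0(4) by auto
    then have "moebius_mat (mat2 l 0 0 (1 / l)) None = None" "moebius_mat (mat2 l 0 0 (1 / l)) (Some 0) = Some 0"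
      by (simp_all add: moebius_mat_def Let_def)
    then have "moebius_mat B None = None" "moebius_mat B (Some 0) = Some 0"
      using G_act[OF BG, of None] G_act[OF BG, of "Some 0"] ends f'_None f'_0 by simp_all
    then have "B$2$1 = 0" "B$1$2 = 0"
      using G_det2[OF BG] by (auto simp: moebius_mat_def Let_def det_2 split: if_splits)
    moreover from this have "B$1$1 * B$2$2 = 1" using G_det2[OF BG] by (simp add: det_2)
    then have "B$2$2 = 1 / B$1$1" by (metis inverse_eq_divide inverse_unique)
    ultimately have "B = mat2 (B$1$1) 0 0 (1 / B$1$1)" by (simp add: mat2_eq_iff)
    then show thesis using that BG by metis
  qed
  \<comment> \<open>Together with infinity, collinear points form a concyclic quadruple; since
    \<open>f'\<close> fixes infinity, the images are collinear again.\<close>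
  have coll: "Im ((F y - F x) * cnj (F z - F x)) = 0"
    if xyz: "x \<in> L" "y \<in> L" "z \<in> L" "distinct [x, y, z]" "Im ((y - x) * cnj (z - x)) = 0" for x y z
  proof -
    have "concyclic {None, Some x, Some y, Some z}" by (rule concyclic_line) (use xyz in auto)
    then have "concyclic (moebius_mat N ` {None, Some x, Some y, Some z})" by (rule concyclic_moebius[OF _ N])
    then have "concyclic {f (moebius_mat N None), f (moebius_mat N (Some x)), f (moebius_mat N (Some y)), f (moebius_mat N (Some z))}"
      by (intro assms(13)) (use xyz ends moebius_eq_iff[OF N] in \<open>auto simp: L_def\<close>)
    then have "concyclic (moebius_mat (inv2 N') ` {f (moebius_mat N None), f (moebius_mat N (Some x)), f (moebius_mat N (Some y)), f (moebius_mat N (Some z))})"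
      by (rule concyclic_moebius) (simp add: N'(1))
    then have "concyclic {f' None, f' (Some x), f' (Some y), f' (Some z)}" by (simp add: f'_def)
    then show ?thesis using xyz by (intro concyclic_None_imp) (simp add: f'_None f'_Some)
  qed
  have alphaL: "\<alpha> \<in> L"
    using arc(1) P_Some[of 0] by (simp add: L_def lc.good_arc_def)
  \<comment> \<open>A curve close to the segment of the ray and disjoint from \<open>L\<close>,
    together with the balls around \<open>c\<^sub>1\<close> and \<open>c\<^sub>2\<close>, would
    connect the two marked points outside \<Lambda>.\<close>
  have rob: "robust_ray L \<alpha> s\<^sub>1 s\<^sub>2 \<epsilon> e\<^sub>0"
    unfolding robust_ray_def
  proof (intro allI impI, elim conjE, rule ccontr)
    fix q assume q: "continuous_on {s\<^sub>1..s\<^sub>2} q" "\<forall>r\<in>{s\<^sub>1..s\<^sub>2}. norm (q r - (\<alpha> + of_real r * e\<^sub>0)) < \<epsilon>"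
      "\<not> (\<exists>r\<in>{s\<^sub>1..s\<^sub>2}. q r \<in> L)"
    define K where "K = (ball c\<^sub>1 \<epsilon> \<union> q ` {s\<^sub>1..s\<^sub>2}) \<union> ball c\<^sub>2 \<epsilon>"
    have m: "q s\<^sub>1 \<in> ball c\<^sub>1 \<epsilon>" "q s\<^sub>2 \<in> ball c\<^sub>2 \<epsilon>"
      using q(2) s by (auto simp: c\<^sub>1_def c\<^sub>2_def dist_norm norm_minus_commute)
    have "connected (ball c\<^sub>1 \<epsilon> \<union> q ` {s\<^sub>1..s\<^sub>2})"
      by (rule connected_Un) (use m s in \<open>auto intro!: connected_continuous_image q(1)\<close>)
    moreover have "q s\<^sub>2 \<in> q ` {s\<^sub>1..s\<^sub>2}" using s(2) by (intro imageI) simp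
    then have "(ball c\<^sub>1 \<epsilon> \<union> q ` {s\<^sub>1..s\<^sub>2}) \<inter> ball c\<^sub>2 \<epsilon> \<noteq> {}" using m(2) by blast
    ultimately have "connected K" unfolding K_def by (rule connected_Un[OF _ connected_ball])
    moreover have "moebius_mat N (Some z) \<notin> \<Lambda>" if "z \<in> K" for z
      using that \<epsilon>(2,3) q(3) by (auto simp: K_def L_def)
    ultimately have "lc.joined (moebius_mat N (Some c\<^sub>1)) (moebius_mat N (Some c\<^sub>2))"
      by (rule lc.joined_chart[OF N]) (use \<epsilon>(1) in \<open>auto simp: K_def\<close>)
    then show False using c_arc(3) by simp
  qed
  have "plane_conjugacy G L F l l' \<alpha> e\<^sub>0 s\<^sub>1 s\<^sub>2 \<epsilon>"
    by (rule plane_conjugacy.intro)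
      (fact G_mult G_inv G_det1 G_det2 dense1 dense2 closedL contL injF L0 infinity act act_pole diag A0(4) coll alphaL e0(1) s \<epsilon>(1) rob)+
  then interpret pc: plane_conjugacy G L F l l' \<alpha> e\<^sub>0 s\<^sub>1 s\<^sub>2 \<epsilon> .
  obtain \<mu> where \<mu>: "\<mu> \<noteq> 0" "(\<forall>z\<in>L. F z = \<mu> * z) \<or> (\<forall>z\<in>L. F z = \<mu> * cnj z)"
    by (rule pc.affine_or_conjugate_affine)
  obtain \<tau> where \<tau>: "\<tau> = (\<lambda>z. \<mu> * z) \<or> \<tau> = (\<lambda>z. \<mu> * cnj z)" "\<And>z. z \<in> L \<Longrightarrow> F z = \<tau> z"
    using \<mu>(2) by metis
  define g where "g = moebius_mat N' \<circ> map_option \<tau> \<circ> moebius_mat (inv2 N)"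
  note g_props = Moeb_S2_conjugates[OF N N'(1) \<mu>(1) \<tau>(1), folded g_def]
  have fg: "f \<xi> = g \<xi>" if "\<xi> \<in> \<Lambda>" for \<xi>
  proof -
    define \<eta> where "\<eta> = moebius_mat (inv2 N) \<xi>"
    have N\<eta>: "moebius_mat N \<eta> = \<xi>" using N by (simp add: \<eta>_def)
    have "f' \<eta> = map_option \<tau> \<eta>"
      using f'_None f'_Some \<tau>(2) that N\<eta> by (cases \<eta>) (auto simp: L_def)
    then have "moebius_mat N' (f' \<eta>) = g \<xi>" by (simp add: g_def \<eta>_def)
    moreover have "moebius_mat N' (f' \<eta>) = f \<xi>" using N'(1) by (simp add: f'_def N\<eta>)
    ultimately show ?thesis by simp
  qed
  \<comment> \<open>A third point besides 0 and infinity: equivariance is known only on \<Lambda>,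
    and three points of \<Lambda> suffice to extend it to the sphere.\<close>
  obtain y where y: "y \<in> L" "y \<noteq> 0" by (rule pc.nonzero_point)
  have conj: "moebius_action (\<rho> \<gamma>) = g \<circ> moebius_action \<gamma> \<circ> inv_into UNIV g" if \<gamma>: "\<gamma> \<in> \<Gamma>" for \<gamma>
  proof
    fix \<eta>
    obtain A where A: "A \<in> \<gamma>" using matrices_carrier[OF sub \<gamma>] by (auto simp: carrier_PSL2C)
    obtain B where B: "B \<in> \<rho> \<gamma>" using rho_carrier[OF sub hom \<gamma>] by (auto simp: carrier_PSL2C)
    have AB: "(A, B) \<in> matrix_pairs \<Gamma> \<rho>" using \<gamma> A B by (auto simp: matrix_pairs_def)
    have AM: "A \<in> matrices \<Gamma>" using \<gamma> A by (auto simp: matrices_def)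
    have step: "g (moebius_mat A \<xi>) = moebius_mat B (g \<xi>)" for \<xi>
    proof (rule g_props(2)[of _ _ "moebius_mat N None" "moebius_mat N (Some 0)" "moebius_mat N (Some y)"])
      show "det A = 1" "det B = 1" using matrix_pairs_det[OF sub hom AB] by auto
      show "distinct [moebius_mat N None, moebius_mat N (Some 0), moebius_mat N (Some y)]"
        using moebius_eq_iff[OF N] y by auto
      fix \<xi> assume "\<xi> \<in> {moebius_mat N None, moebius_mat N (Some 0), moebius_mat N (Some y)}"
      then have "\<xi> \<in> \<Lambda>" using ends y by (auto simp: L_def)
      then show "g (moebius_mat A \<xi>) = moebius_mat B (g \<xi>)"
        using fg lc.invariant[OF AM] equivariant[OF AB] by metis
    qed
    have "g (inv_into UNIV g \<eta>) = \<eta>" using Moeb_S2_bij[OF g_props(1)] by (simp add: bij_is_surj surj_f_inv_f)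
    then have "moebius_mat B \<eta> = g (moebius_mat A (inv_into UNIV g \<eta>))" using step by metis
    then show "moebius_action (\<rho> \<gamma>) \<eta> = (g \<circ> moebius_action \<gamma> \<circ> inv_into UNIV g) \<eta>"
      using moebius_eq[OF matrices_carrier[OF sub \<gamma>] A] moebius_eq[OF rho_carrier[OF sub hom \<gamma>] B] by simp
  qed
  show ?thesis using g_props(1) fg conj by blast
qed

end
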